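(* Let $(U_q(\mathfrak g),U_q(\mathfrak k))$ be a quantum (pseudo-)symmetric pair of finite type, with associated automorphism $\phi_q$, quasi K-matrix $\Upsilon$, and tensor K-matrix $\mathbb{K}_{\bullet,V}=(R_{V^{\psi},\bullet})_{21}\cdot(1\otimes\Upsilon_V)\cdot R_{\bullet,V}$, $\psi=\phi_q^{-1}$. Let $D$ act on weight spaces $V_\mu$ as $q^{-2(\rho,\mu)}$, and let $\mathscr{T}_\phi$ be the ring homomorphism on $[\mathrm{Mod}_{\mathsf{fd}}(U_q(\mathfrak g))]$ given by $\mathscr{T}_\phi^{(V)}=\mathrm{Tr}_2\big((1\otimes D_V\Upsilon_V^{-1})\cdot\mathbb{K}_{\bullet,V}\big)$. Then the image of $\mathscr{T}_\phi$ lies in $U_q(\mathfrak g_X)\,U_q(\mathfrak h^\phi)^{\mathsf P}$, where $U_q(\mathfrak h^\phi)^{\mathsf P}$ is the weight lattice refinement of $U_q(\mathfrak h^\phi)$.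
   Context: Quantum group. $\mathfrak g$ is a simple finite-dimensional complex Lie algebra with Cartan matrix $(a_{ij})_{i,j\in I}$, positive integers $\epsilon_i$ with $(\epsilon_ia_{ij})$ symmetric, Cartan subalgebra $\mathfrak h$, simple roots $\alpha_i$, simple coroots $h_i$, root lattice $\mathsf Q$, $\mathsf Q^+=\sum\mathbb Z_{\ge0}\alpha_i$, coroot lattice $\mathsf Q^\vee$, weight lattice $\mathsf P$, bilinear form $(\alpha_i,\alpha_j)=\epsilon_ia_{ij}$ on $\mathfrak h^*$, and $\rho\in\mathsf P$ with $\rho(h_i)=1$ for all $i$. $\mathbb F$ is the algebraic closure of $\mathbb C(q)$ (a compatible choice of roots of $q$ is fixed), $q_i=q^{\epsilon_i}$. $U_q(\mathfrak g)$ is the $\mathbb F$-algebra generated by $E_i,F_i$ ($i\in I$), $k_h$ ($h\in\mathsf Q^\vee$), with $k_hk_{h'}=k_{h+h'}$, $k_0=1$, $k_hE_i=q^{\alpha_i(h)}E_ik_h$, $k_hF_i=q^{-\alpha_i(h)}F_ik_h$, $[E_i,F_j]=\delta_{ij}(k_i-k_i^{-1})/(q_i-q_i^{-1})$ where $k_i=k_{\epsilon_ih_i}$, and the quantum Serre relations; $\Delta(E_i)=E_i\otimes1+k_i\otimes E_i$, $\Delta(F_i)=F_i\otimes k_i^{-1}+1\otimes F_i$, $\Delta(k_h)=k_h\otimes k_h$. $U_q(\mathfrak n^\pm)$ are generated by the $E_i$, resp. $F_i$. The refinement $U_q(\mathfrak g)^{\mathsf P}\supseteq U_q(\mathfrak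 g)$ is obtained by adjoining commuting invertible elements $k_\lambda$ ($\lambda\in\mathsf P$), with $k_{\lambda}$ acting on weight-$\mu$ vectors by $q^{(\lambda,\mu)}$ (so $k_{\alpha_i}=k_i$). Modules. $\mathrm{Mod}_{\mathsf{fd}}(U_q(\mathfrak g))$: finite-dimensional type-$\mathbf 1$ modules, $V=\bigoplus_{\mu\in\mathsf P}V_\mu$, $k_h|_{V_\mu}=q^{\mu(h)}$; $[\cdot]$ is its Grothendieck ring (short exact sequences, product from $\otimes$). For an automorphism $\psi$, $V^\psi$ is $V$ with $a$ acting as $\psi(a)$. R-matrix. $R=\kappa\cdot\Xi$ where $\kappa$ acts on $V_\lambda\otimes W_\mu$ by $q^{(\lambda,\mu)}$ and $\Xi=\sum_{\lambda\in\mathsf Q^+}\Xi_\lambda$, $\Xi_\lambda\in U_q(\mathfrak n^-)_{-\lambda}\otimes U_q(\mathfrak n^+)_\lambda$, $\Xi_0=1\otimes 1$, is the unique such element with $R\Delta(x)=\Delta^{\mathsf{op}}(x)R$. For finite-dimensional $V$, $R_{\bullet,V}\in U_q(\mathfrak g)^{\mathsf P}\otimes\mathrm{End}(V)$ and $R_{V,\bullet}\in\mathrm{End}(V)\otimes U_q(\mathfrak g)^{\mathsf P}$ denote $R$ with the indicated leg acting on $V$; $(\cdot)_{21}$ flips the tensor legs; $\mathrm{Tr}_2(a\otimes f)=\mathrm{Tr}(f)a$. Quantum symmetric pair. $X\subseteq I$ is a subdiagram and $\tau$ an involutive (or trivial) diagram automorphism with $\tau(X)=X$, $w_X(\alpha_i)=-\alpha_{\tau(i)}$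 for $i\in X$ ($w_X$ the longest element of the parabolic Weyl group $W_X$), and such that for every $i\in I\setminus X$ with $\tau(i)=i$ the connected component of $X\cup\{i\}$ containing $i$ is not of type $A_2$ (generalized Satake diagram). The map $\phi=-w_X\circ\tau$ is an involution of $\mathfrak h$ and $\mathfrak h^*$; it is the restriction of a pseudo-involution $\phi=\mathrm{Ad}(\chi)\circ\mathrm{Ad}(\widetilde w_X)\circ\tau\circ\omega$ of $\mathfrak g$, with $\omega$ the Chevalley involution and $\chi\colon\mathsf Q\to\mathbb C^\times$ a character with $\chi(\alpha_i)=1$ for $i\in X$. Parameters: $\gamma\in(\mathbb F^\times)^I$ with $\gamma_i=1$ for $i\in X$ and $\gamma_i=\gamma_{\tau(i)}$ whenever $(\alpha_i,\phi(\alpha_i))=0$, specializing at $q=1$ to $(\chi(\alpha_{\tau(i)}))_i$; $\sigma\in\mathbb F^I$, with a specialization at $q=1$, with $\sigma_i=0$ unless $i\in I_{\mathsf{ns}}:=\{i\mid\phi(\alpha_i)=-\alpha_i\}$, and for all distinct $i,j\in I_{\mathsf{ns}}$: $a_{ij}\in2\mathbb Z$ or $\sigma_j=0$. Let $\chi_q\colon\mathsf Q\to\mathbb F^\times$ be the character with $\chi_q(\alpha_{\tau(i)})=\gamma_i$, and $\mathrm{Ad}(\chi_q)$ multiplication by $\chi_q(\lambda)$ on the root space $U_q(\mathfrak g)_\lambda$. Define $\phi_q=\mathrm{Ad}(\chi_q)\circ\omega\circ\tau\circ\mathrm{Ad}(T_\phi)$, where $\omega(E_i)=-F_i$, $\omega(F_i)=-E_i$,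 $\omega(k_h)=k_{-h}$; $\tau$ relabels generators; $\mathrm{Ad}(T_\phi)=\mathrm{Ad}(g_\phi)\circ T_{w_X}$ with $T_{w_X}$ Lusztig's automorphism $T''_{w_X,1}$ (for a simple reflection: $T_i(E_i)=-F_ik_i$, $T_i(F_i)=-k_i^{-1}E_i$, $T_i(E_j)=\sum_{r+s=-a_{ij}}(-1)^rq_i^{-r}E_i^{(s)}E_jE_i^{(r)}$, $T_i(F_j)=\sum_{r+s=-a_{ij}}(-1)^rq_i^{r}F_i^{(r)}F_jF_i^{(s)}$) and $g_\phi$ acting on weight-$\lambda$ vectors by $q^{(\phi(\lambda),\lambda)/2+(\lambda,\rho_X)}$, $\rho_X$ the half-sum of positive roots of $X$. Then $\phi_q$ is the identity on the subalgebra $U_q(\mathfrak g_X)=\langle E_i,F_i,k_i^{\pm1}\mid i\in X\rangle$ and $\phi_q(k_h)=k_{\phi(h)}$. The QSP subalgebra $U_q(\mathfrak k)\subseteq U_q(\mathfrak g)$ is generated by $B_i=F_i+\phi_q(F_i)+\sigma_ik_i^{-1}$ ($i\in I\setminus X$), $U_q(\mathfrak g_X)$ and $U_q(\mathfrak h^\phi)=\langle k_h\mid h\in\mathsf Q^\vee,\phi(h)=h\rangle$. The weight lattice refinement is $U_q(\mathfrak h^\phi)^{\mathsf P}=\langle k_h,k_\lambda\mid h\in\mathsf Q^\vee,\ \lambda\in\mathsf P,\ \phi(h)=h,\ \phi(\lambda)=\lambda\rangle\subseteq U_q(\mathfrak g)^{\mathsf P}$. Quasi K-matrix. $\Upsilon=\sum_{\lambda\in\mathsf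 Q^+}\Upsilon_\lambda$, $\Upsilon_\lambda\in U_q(\mathfrak n^+)_\lambda$, $\Upsilon_0=1$, is the unique such element (acting on finite-dimensional type-$\mathbf1$ modules) with $\Upsilon\cdot x=\phi_q^{-1}(x)\cdot\Upsilon$ for all $x\in U_q(\mathfrak k)$; its existence is known, and it is known that $\Upsilon_\lambda=0$ unless $\phi(\lambda)=-\lambda$. It is invertible. *)

theory Defs
  imports
    "HOL-Algebra.Algebraic_Closure_Type"
    "HOL-Algebra.Free_Abelian_Groups"
    "HOL-Library.Function_Algebras"
    "Jordan_Normal_Form.Matrix"
begin

section \<open>Base field\<close>

type_synonym ff = "complex poly fract alg_closure"

definition qq :: ff where
  "qq = to_ac (to_fract [:0, 1:])"

text \<open>A specialization at \<open>q = 1\<close>: a place of the base field, with valuation ring \<open>Od\<close>, residue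
  map \<open>sp\<close> and residue field the complex numbers, extending evaluation of polynomials
  at \<open>1\<close> and sending every chosen root of \<open>q\<close> to \<open>1\<close>.\<close>
definition specialization_at_1 :: "(rat \<Rightarrow> ff) \<Rightarrow> ff set \<Rightarrow> (ff \<Rightarrow> complex) \<Rightarrow> bool" where
  "specialization_at_1 qp Od sp \<longleftrightarrow>
     (\<forall>p. to_ac (to_fract p) \<in> Od \<and> sp (to_ac (to_fract p)) = poly p 1) \<and>
     (\<forall>x\<in>Od. \<forall>y\<in>Od. x + y \<in> Od \<and> sp (x + y) = sp x + sp y \<and>
                      x * y \<in> Od \<and> sp (x * y) = sp x * sp y) \<and>
     (\<forall>x. x \<notin> Od \<longrightarrow> inverse x \<in> Od \<and> sp (inverse x) = 0) \<and>
     (\<forall>r. qp r \<in> Od \<and> sp (qp r) = 1)"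

section \<open>Cartan data, weights and coweights\<close>

record 'i cartan_datum =
  cmat :: "'i \<Rightarrow> 'i \<Rightarrow> int"
  eps :: "'i \<Rightarrow> int"

text \<open>The rational span of the roots is \<open>'i \<Rightarrow> rat\<close> (coordinates with respect to the simple
  roots); the coroot lattice is \<open>'i \<Rightarrow> int\<close> (coordinates with respect to the simple
  coroots).\<close>
type_synonym 'i wt = "'i \<Rightarrow> rat"
type_synonym 'i cow = "'i \<Rightarrow> int"

definition sroot :: "'i \<Rightarrow> 'i wt" where
  "sroot i = (\<lambda>j. if j = i then 1 else 0)"

definition scoroot :: "'i \<Rightarrow> 'i cow" where
  "scoroot i = (\<lambda>j. if j = i then 1 else 0)"

text \<open>\<open>pair D \<nu> h\<close> is \<open>\<nu>(h)\<close>; in particular \<open>\<alpha>\<^sub>j(h\<^sub>i) = a\<^sub>i\<^sub>j\<close>.\<close>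
definition pair :: "('i::finite, 'z) cartan_datum_scheme \<Rightarrow> 'i wt \<Rightarrow> 'i cow \<Rightarrow> rat" where
  "pair D \<nu> h = (\<Sum>i\<in>UNIV. \<Sum>j\<in>UNIV. of_int (h i) * of_int (cmat D i j) * \<nu> j)"

definition form :: "('i::finite, 'z) cartan_datum_scheme \<Rightarrow> 'i wt \<Rightarrow> 'i wt \<Rightarrow> rat" where
  "form D \<nu> \<mu> = (\<Sum>i\<in>UNIV. \<Sum>j\<in>UNIV. \<nu> i * of_int (eps D i * cmat D i j) * \<mu> j)"

definition component :: "('i, 'z) cartan_datum_scheme \<Rightarrow> 'i set \<Rightarrow> 'i \<Rightarrow> 'i set" where
  "component D Y i = {j. (i, j) \<in> {(a, b). a \<in> Y \<and> b \<in> Y \<and> cmat D a b \<noteq> 0}\<^sup>*}"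

text \<open>Indecomposable Cartan matrices of finite type, i.e. the Cartan matrices of the simple
  finite-dimensional complex Lie algebras.\<close>
definition simple_cartan_datum :: "('i::finite, 'z) cartan_datum_scheme \<Rightarrow> bool" where
  "simple_cartan_datum D \<longleftrightarrow>
     (\<forall>i. cmat D i i = 2) \<and>
     (\<forall>i j. i \<noteq> j \<longrightarrow> cmat D i j \<le> 0) \<and>
     (\<forall>i. eps D i > 0) \<and>
     (\<forall>i j. eps D i * cmat D i j = eps D j * cmat D j i) \<and>
     (\<forall>\<nu>. \<nu> \<noteq> 0 \<longrightarrow> form D \<nu> \<nu> > 0) \<and>
     (\<forall>i. component D UNIV i = UNIV)"

definition root_lattice :: "'i wt set" where
  "root_lattice = {\<nu>. \<forall>i. \<nu> i \<in> \<int>}"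

definition pos_lattice :: "'i wt set" where
  "pos_lattice = {\<nu>. \<forall>i. \<nu> i \<in> \<nat>}"

definition wt_lattice :: "('i::finite, 'z) cartan_datum_scheme \<Rightarrow> 'i wt set" where
  "wt_lattice D = {\<nu>. \<forall>i. pair D \<nu> (scoroot i) \<in> \<int>}"

definition weyl_vector :: "('i::finite, 'z) cartan_datum_scheme \<Rightarrow> 'i wt" where
  "weyl_vector D = (THE r. \<forall>i. pair D r (scoroot i) = 1)"

definition refl :: "('i::finite, 'z) cartan_datum_scheme \<Rightarrow> 'i \<Rightarrow> 'i wt \<Rightarrow> 'i wt" where
  "refl D i \<nu> = (\<lambda>j. \<nu> j - pair D \<nu> (scoroot i) * sroot i j)"

definition corefl :: "('i::finite, 'z) cartan_datum_scheme \<Rightarrow> 'i \<Rightarrow> 'i cow \<Rightarrow> 'i cow" where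
  "corefl D i h = (\<lambda>j. h j - (\<Sum>k\<in>UNIV. h k * cmat D k i) * scoroot i j)"

text \<open>Elements of the Weyl group are given by words; the word \<open>[i\<^sub>1, \<dots>, i\<^sub>l]\<close> stands for
  \<open>s\<^bsub>i\<^sub>1\<^esub> \<cdots> s\<^bsub>i\<^sub>l\<^esub>\<close>.\<close>
definition reduced_word :: "('i::finite, 'z) cartan_datum_scheme \<Rightarrow> 'i list \<Rightarrow> bool" where
  "reduced_word D ws \<longleftrightarrow>
     (\<forall>vs. foldr (refl D) vs = foldr (refl D) ws \<longrightarrow> length ws \<le> length vs)"

definition longest_word :: "('i::finite, 'z) cartan_datum_scheme \<Rightarrow> 'i set \<Rightarrow> 'i list \<Rightarrow> bool" where
  "longest_word D Y ws \<longleftrightarrow> set ws \<subseteq> Y \<and> reduced_word D ws \<and>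
     (\<forall>vs. set vs \<subseteq> Y \<and> reduced_word D vs \<longrightarrow> length vs \<le> length ws)"

definition pos_roots :: "('i::finite, 'z) cartan_datum_scheme \<Rightarrow> 'i set \<Rightarrow> 'i wt set" where
  "pos_roots D Y = {foldr (refl D) vs (sroot i) | vs i. set vs \<subseteq> Y \<and> i \<in> Y} \<inter> pos_lattice"

definition half_sum :: "('i::finite, 'z) cartan_datum_scheme \<Rightarrow> 'i set \<Rightarrow> 'i wt" where
  "half_sum D Y = (\<lambda>j. (\<Sum>\<beta>\<in>pos_roots D Y. \<beta> j) / 2)"

section \<open>Algebras presented by generators and relations\<close>

datatype 'g word = Word (letters: "'g list")

instantiation word :: (type) monoid_add
begin
definition zero_word :: "'a word" where "zero_word = Word []"
definition plus_word :: "'a word \<Rightarrow> 'a word \<Rightarrow> 'a word" where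
  "plus_word u v = Word (letters u @ letters v)"
instance by standard (simp_all add: zero_word_def plus_word_def)
end

text \<open>The free algebra is the monoid algebra of the free monoid; its ring structure is the
  convolution product of \<^theory>\<open>HOL-Library.Poly_Mapping\<close>.\<close>
type_synonym 'g free_alg = "'g word \<Rightarrow>\<^sub>0 ff"

definition fconst :: "ff \<Rightarrow> 'g free_alg" where
  "fconst c = Poly_Mapping.single 0 c"

definition fgen :: "'g \<Rightarrow> 'g free_alg" where
  "fgen g = Poly_Mapping.single (Word [g]) 1"

definition free_alg_on :: "'g set \<Rightarrow> 'g free_alg set" where
  "free_alg_on G = {p. \<forall>w\<in>Poly_Mapping.keys p. set (letters w) \<subseteq> G}"

definition free_eval :: "(ff \<Rightarrow> 'u::ring_1) \<Rightarrow> ('g \<Rightarrow> 'u) \<Rightarrow> 'g free_alg \<Rightarrow> 'u" where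
  "free_eval s v p =
     (\<Sum>w\<in>Poly_Mapping.keys p. s (Poly_Mapping.lookup p w) * prod_list (map v (letters w)))"

inductive_set two_sided_ideal :: "'a::ring_1 set \<Rightarrow> 'a set" for R where
  zero: "0 \<in> two_sided_ideal R"
| step: "r \<in> R \<Longrightarrow> x \<in> two_sided_ideal R \<Longrightarrow> a * r * b + x \<in> two_sided_ideal R"

text \<open>A ring becomes an algebra through its structure map \<open>s\<close> into the centre.\<close>
definition is_algebra :: "(ff \<Rightarrow> 'u::ring_1) \<Rightarrow> bool" where
  "is_algebra s \<longleftrightarrow> s 1 = 1 \<and> (\<forall>a b. s (a + b) = s a + s b) \<and> (\<forall>a b. s (a * b) = s a * s b) \<and>
     (\<forall>a x. s a * x = x * s a)"

text \<open>The subalgebra \<open>A\<close> is presented by the generators \<open>v g\<close> (\<open>g \<in> G\<close>) and the relators \<open>R\<close>.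
  The ideal is formed with all generators; as \<open>R\<close> only involves generators from \<open>G\<close>, its
  intersection with the free algebra on \<open>G\<close> is the ideal generated by \<open>R\<close> there.\<close>
definition presented_by ::
    "(ff \<Rightarrow> 'u::ring_1) \<Rightarrow> ('g \<Rightarrow> 'u) \<Rightarrow> 'g set \<Rightarrow> 'g free_alg set \<Rightarrow> 'u set \<Rightarrow> bool" where
  "presented_by s v G R A \<longleftrightarrow>
     A = free_eval s v ` free_alg_on G \<and>
     (\<forall>p\<in>free_alg_on G. free_eval s v p = 0 \<longleftrightarrow> p \<in> two_sided_ideal R)"

inductive_set subalg :: "(ff \<Rightarrow> 'u::ring_1) \<Rightarrow> 'u set \<Rightarrow> 'u set" for s G where
  const: "s c \<in> subalg s G"
| gen: "g \<in> G \<Longrightarrow> g \<in> subalg s G"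
| add: "x \<in> subalg s G \<Longrightarrow> y \<in> subalg s G \<Longrightarrow> x + y \<in> subalg s G"
| mult: "x \<in> subalg s G \<Longrightarrow> y \<in> subalg s G \<Longrightarrow> x * y \<in> subalg s G"

text \<open>The additive span of the products \<open>a b\<close>, i.e. the product of two subspaces.\<close>
inductive_set span_prod :: "'u::ring_1 set \<Rightarrow> 'u set \<Rightarrow> 'u set" for A B where
  zero: "0 \<in> span_prod A B"
| step: "a \<in> A \<Longrightarrow> b \<in> B \<Longrightarrow> x \<in> span_prod A B \<Longrightarrow> a * b + x \<in> span_prod A B"

definition qint :: "ff \<Rightarrow> nat \<Rightarrow> ff" where
  "qint p n = (p ^ n - inverse p ^ n) / (p - inverse p)"

definition dpow :: "(ff \<Rightarrow> 'a::ring_1) \<Rightarrow> ff \<Rightarrow> 'a \<Rightarrow> nat \<Rightarrow> 'a" where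
  "dpow s p x n = s (inverse (\<Prod>m = 1..n. qint p m)) * x ^ n"

section \<open>The quantum group and its weight lattice refinement\<close>

text \<open>The type \<open>'u\<close> is the refined quantum group. The field \<open>qpow\<close> is a compatible system of
  rational powers of \<open>q\<close>, \<open>(spdom, spval)\<close> a specialization at \<open>q = 1\<close>, \<open>Kg h\<close> is \<open>k\<^sub>h\<close> for \<open>h\<close> in the
  coroot lattice, \<open>Kw \<nu>\<close> is \<open>k\<^sub>\<nu>\<close> for \<open>\<nu>\<close> in the weight lattice.\<close>
record ('i, 'u) qgroup = "'i cartan_datum" +
  qpow :: "rat \<Rightarrow> ff"
  spdom :: "ff set"
  spval :: "ff \<Rightarrow> complex"
  scal :: "ff \<Rightarrow> 'u"
  Eg :: "'i \<Rightarrow> 'u"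
  Fg :: "'i \<Rightarrow> 'u"
  Kg :: "'i cow \<Rightarrow> 'u"
  Kw :: "'i wt \<Rightarrow> 'u"

datatype 'i gen = GE 'i | GF 'i | GK "'i cow" | GL "'i wt"

fun gen_val :: "('i, 'u, 'z) qgroup_scheme \<Rightarrow> 'i gen \<Rightarrow> 'u" where
  "gen_val D (GE i) = Eg D i"
| "gen_val D (GF i) = Fg D i"
| "gen_val D (GK h) = Kg D h"
| "gen_val D (GL \<nu>) = Kw D \<nu>"

definition qi :: "('i, 'u, 'z) qgroup_scheme \<Rightarrow> 'i \<Rightarrow> ff" where
  "qi D i = qpow D (of_int (eps D i))"

definition kcow :: "('i, 'z) cartan_datum_scheme \<Rightarrow> 'i \<Rightarrow> 'i cow" where
  "kcow D i = (\<lambda>j. eps D i * scoroot i j)"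

definition serre :: "(ff \<Rightarrow> 'a::ring_1) \<Rightarrow> ff \<Rightarrow> 'a \<Rightarrow> 'a \<Rightarrow> nat \<Rightarrow> 'a" where
  "serre s p x y m = (\<Sum>r\<le>m. (- 1) ^ r * dpow s p x (m - r) * y * dpow s p x r)"

definition uq_rels :: "('i::finite, 'u, 'z) qgroup_scheme \<Rightarrow> 'i gen free_alg set" where
  "uq_rels D = (let E = (\<lambda>i. fgen (GE i)); F = (\<lambda>i. fgen (GF i)); K = (\<lambda>h. fgen (GK h)) in
       {K h * K h' - K (h + h') | h h'. True}
     \<union> {K 0 - 1}
     \<union> {K h * E i - fconst (qpow D (pair D (sroot i) h)) * E i * K h | h i. True}
     \<union> {K h * F i - fconst (qpow D (- pair D (sroot i) h)) * F i * K h | h i. True}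
     \<union> {E i * F i - F i * E i
          - fconst (inverse (qi D i - inverse (qi D i))) * (K (kcow D i) - K (- kcow D i)) | i. True}
     \<union> {E i * F j - F j * E i | i j. i \<noteq> j}
     \<union> {serre fconst (qi D i) (E i) (E j) (nat (1 - cmat D i j)) | i j. i \<noteq> j}
     \<union> {serre fconst (qi D i) (F i) (F j) (nat (1 - cmat D i j)) | i j. i \<noteq> j})"

text \<open>Both \<open>k\<^sub>h\<close> and \<open>k\<^sub>\<nu>\<close> act by scalars on weight vectors, \<open>q\<^bsup>\<mu>(h)\<^esup>\<close> and \<open>q\<^bsup>(\<nu>,\<mu>)\<^esup>\<close>; the last family of
  relators identifies them whenever these agree for all \<open>\<mu>\<close>, e.g. for \<open>\<nu> = \<alpha>\<^sub>i\<close>, \<open>h = \<epsilon>\<^sub>i h\<^sub>i\<close>.\<close>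
definition uqP_rels :: "('i::finite, 'u, 'z) qgroup_scheme \<Rightarrow> 'i gen free_alg set" where
  "uqP_rels D =
     (let E = (\<lambda>i. fgen (GE i)); F = (\<lambda>i. fgen (GF i)); K = (\<lambda>h. fgen (GK h));
          L = (\<lambda>\<nu>. fgen (GL \<nu>)); P = wt_lattice D in
       uq_rels D
     \<union> {L \<nu> * L \<mu> - L (\<nu> + \<mu>) | \<nu> \<mu>. \<nu> \<in> P \<and> \<mu> \<in> P}
     \<union> {L 0 - 1}
     \<union> {L \<nu> * K h - K h * L \<nu> | \<nu> h. \<nu> \<in> P}
     \<union> {L \<nu> * E i - fconst (qpow D (form D \<nu> (sroot i))) * E i * L \<nu> | \<nu> i. \<nu> \<in> P}
     \<union> {L \<nu> * F i - fconst (qpow D (- form D \<nu> (sroot i))) * F i * L \<nu> | \<nu> i. \<nu> \<in> P}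
     \<union> {L \<nu> - K h | \<nu> h. \<nu> \<in> P \<and> (\<forall>\<mu>. form D \<nu> \<mu> = pair D \<mu> h)})"

definition Uq :: "('i, 'u::ring_1, 'z) qgroup_scheme \<Rightarrow> 'u set" where
  "Uq D = subalg (scal D) (range (Eg D) \<union> range (Fg D) \<union> range (Kg D))"

definition quantum_group :: "('i::finite, 'u::ring_1, 'z) qgroup_scheme \<Rightarrow> bool" where
  "quantum_group D \<longleftrightarrow>
     simple_cartan_datum D \<and>
     qpow D 1 = qq \<and> (\<forall>r s. qpow D (r + s) = qpow D r * qpow D s) \<and>
     specialization_at_1 (qpow D) (spdom D) (spval D) \<and>
     is_algebra (scal D) \<and>
     presented_by (scal D) (gen_val D) (range GE \<union> range GF \<union> range GK) (uq_rels D) (Uq D) \<and>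
     presented_by (scal D) (gen_val D) (range GE \<union> range GF \<union> range GK \<union> GL ` wt_lattice D)
       (uqP_rels D) UNIV"

definition Uplus :: "('i, 'u::ring_1, 'z) qgroup_scheme \<Rightarrow> 'u set" where
  "Uplus D = subalg (scal D) (range (Eg D))"

definition Uminus :: "('i, 'u::ring_1, 'z) qgroup_scheme \<Rightarrow> 'u set" where
  "Uminus D = subalg (scal D) (range (Fg D))"

definition root_space :: "('i::finite, 'u::ring_1, 'z) qgroup_scheme \<Rightarrow> 'i wt \<Rightarrow> 'u set" where
  "root_space D \<nu> = {x \<in> Uq D. \<forall>h. Kg D h * x * Kg D (- h) = scal D (qpow D (pair D \<nu> h)) * x}"

definition alg_aut :: "('i, 'u::ring_1, 'z) qgroup_scheme \<Rightarrow> ('u \<Rightarrow> 'u) \<Rightarrow> bool" where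
  "alg_aut D f \<longleftrightarrow> bij_betw f (Uq D) (Uq D) \<and> (\<forall>c. f (scal D c) = scal D c) \<and>
     (\<forall>x\<in>Uq D. \<forall>y\<in>Uq D. f (x + y) = f x + f y \<and> f (x * y) = f x * f y)"

section \<open>Finite-dimensional type 1 modules\<close>

text \<open>A module is given in coordinates, as a dimension together with the representing matrices.
  Representing maps are \<open>undefined\<close> outside \<open>Uq D\<close>.\<close>
type_synonym 'u qmod = "nat \<times> ('u \<Rightarrow> ff mat)"

abbreviation vdim :: "'u qmod \<Rightarrow> nat" where "vdim \<equiv> fst"
abbreviation act :: "'u qmod \<Rightarrow> 'u \<Rightarrow> ff mat" where "act \<equiv> snd"

definition is_rep :: "('i, 'u::ring_1, 'z) qgroup_scheme \<Rightarrow> nat \<Rightarrow> ('u \<Rightarrow> ff mat) \<Rightarrow> bool" where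
  "is_rep D n r \<longleftrightarrow> r \<in> extensional (Uq D) \<and> (\<forall>x\<in>Uq D. r x \<in> carrier_mat n n) \<and>
     (\<forall>c. r (scal D c) = c \<cdot>\<^sub>m 1\<^sub>m n) \<and>
     (\<forall>x\<in>Uq D. \<forall>y\<in>Uq D. r (x + y) = r x + r y \<and> r (x * y) = r x * r y)"

definition wt_space :: "('i::finite, 'u, 'z) qgroup_scheme \<Rightarrow> 'u qmod \<Rightarrow> 'i wt \<Rightarrow> ff vec set" where
  "wt_space D V \<mu> = {v \<in> carrier_vec (vdim V).
     \<forall>h. act V (Kg D h) *\<^sub>v v = qpow D (pair D \<mu> h) \<cdot>\<^sub>v v}"

definition fdmod :: "('i::finite, 'u::ring_1, 'z) qgroup_scheme \<Rightarrow> 'u qmod set" where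
  "fdmod D = {V. is_rep D (vdim V) (act V) \<and>
     (\<forall>v\<in>carrier_vec (vdim V). \<exists>S w. finite S \<and> S \<subseteq> wt_lattice D \<and> (\<forall>\<mu>\<in>S. w \<mu> \<in> wt_space D V \<mu>) \<and>
        (\<forall>j<vdim V. v $ j = (\<Sum>\<mu>\<in>S. w \<mu> $ j)))}"

definition weights :: "('i::finite, 'u, 'z) qgroup_scheme \<Rightarrow> 'u qmod \<Rightarrow> 'i wt set" where
  "weights D V = {\<mu> \<in> wt_lattice D. \<exists>v\<in>wt_space D V \<mu>. v \<noteq> 0\<^sub>v (vdim V)}"

text \<open>The operator acting on each weight space by the scalar \<open>f \<mu>\<close>.\<close>
definition wt_op :: "('i::finite, 'u, 'z) qgroup_scheme \<Rightarrow> 'u qmod \<Rightarrow> ('i wt \<Rightarrow> ff) \<Rightarrow> ff mat" where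
  "wt_op D V f = (THE M. M \<in> carrier_mat (vdim V) (vdim V) \<and>
     (\<forall>\<mu>\<in>wt_lattice D. \<forall>v\<in>wt_space D V \<mu>. M *\<^sub>v v = f \<mu> \<cdot>\<^sub>v v))"

definition wt_proj :: "('i::finite, 'u, 'z) qgroup_scheme \<Rightarrow> 'u qmod \<Rightarrow> 'i wt \<Rightarrow> ff mat" where
  "wt_proj D V \<mu> = wt_op D V (\<lambda>\<nu>. if \<nu> = \<mu> then 1 else 0)"

definition twist :: "('i, 'u::ring_1, 'z) qgroup_scheme \<Rightarrow> ('u \<Rightarrow> 'u) \<Rightarrow> 'u qmod \<Rightarrow> 'u qmod" where
  "twist D \<psi> V = (vdim V, restrict (\<lambda>x. act V (\<psi> x)) (Uq D))"

text \<open>Sums over the positive root lattice of \<open>n \<times> n\<close> matrices, taken entrywise and over the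
  indices with non-zero contribution.\<close>
definition pos_sum :: "nat \<Rightarrow> ('i wt \<Rightarrow> 'x::comm_monoid_add mat) \<Rightarrow> 'x mat" where
  "pos_sum n M = mat n n (\<lambda>(i, j). \<Sum>\<nu> | \<nu> \<in> pos_lattice \<and> M \<nu> $$ (i, j) \<noteq> 0. M \<nu> $$ (i, j))"

definition kron :: "ff mat \<Rightarrow> ff mat \<Rightarrow> ff mat" where
  "kron A B = mat (dim_row A * dim_row B) (dim_col A * dim_col B)
     (\<lambda>(i, j). A $$ (i div dim_row B, j div dim_col B) * B $$ (i mod dim_row B, j mod dim_col B))"

text \<open>An element \<open>\<Sum> a \<otimes> b\<close> of a tensor product is represented by the list of the pairs \<open>(a, b)\<close>.
  Only expressions bilinear in \<open>(a, b)\<close> are evaluated on such lists.\<close>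
type_synonym 'u tens = "('u \<times> 'u) list"

definition tens_act :: "'u qmod \<Rightarrow> 'u qmod \<Rightarrow> 'u tens \<Rightarrow> ff mat" where
  "tens_act V W t = mat (vdim V * vdim W) (vdim V * vdim W)
     (\<lambda>ij. \<Sum>(a, b)\<leftarrow>t. kron (act V a) (act W b) $$ ij)"

definition comult_gens :: "('i, 'u::ring_1, 'z) qgroup_scheme \<Rightarrow> ('u \<times> 'u tens) set" where
  "comult_gens D =
     {(Eg D i, [(Eg D i, 1), (Kg D (kcow D i), Eg D i)]) | i. True}
   \<union> {(Fg D i, [(Fg D i, Kg D (- kcow D i)), (1, Fg D i)]) | i. True}
   \<union> {(Kg D h, [(Kg D h, Kg D h)]) | h. True}"

text \<open>The actions on \<open>V \<otimes> W\<close> through the coproduct and the opposite coproduct: the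
  representations with the prescribed values on the generators.\<close>
definition comult_act :: "('i, 'u::ring_1, 'z) qgroup_scheme \<Rightarrow> 'u qmod \<Rightarrow> 'u qmod \<Rightarrow> 'u \<Rightarrow> ff mat" where
  "comult_act D V W = (THE r. is_rep D (vdim V * vdim W) r \<and>
     (\<forall>(g, t)\<in>comult_gens D. r g = tens_act V W t))"

definition comult_op_act :: "('i, 'u::ring_1, 'z) qgroup_scheme \<Rightarrow> 'u qmod \<Rightarrow> 'u qmod \<Rightarrow> 'u \<Rightarrow> ff mat" where
  "comult_op_act D V W = (THE r. is_rep D (vdim V * vdim W) r \<and>
     (\<forall>(g, t)\<in>comult_gens D. r g = tens_act V W (map prod.swap t)))"

definition tensor_mod :: "('i, 'u::ring_1, 'z) qgroup_scheme \<Rightarrow> 'u qmod \<Rightarrow> 'u qmod \<Rightarrow> 'u qmod" where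
  "tensor_mod D V W = (vdim V * vdim W, comult_act D V W)"

definition trivial_mod :: "('i, 'u::ring_1, 'z) qgroup_scheme \<Rightarrow> 'u qmod" where
  "trivial_mod D = (1, THE r. is_rep D 1 r \<and> (\<forall>i. r (Eg D i) = 0\<^sub>m 1 1) \<and>
     (\<forall>i. r (Fg D i) = 0\<^sub>m 1 1) \<and> (\<forall>h. r (Kg D h) = 1\<^sub>m 1))"

section \<open>The Grothendieck ring\<close>

definition intertwiner :: "('i, 'u::ring_1, 'z) qgroup_scheme \<Rightarrow> 'u qmod \<Rightarrow> 'u qmod \<Rightarrow> ff mat \<Rightarrow> bool" where
  "intertwiner D V W f \<longleftrightarrow> f \<in> carrier_mat (vdim W) (vdim V) \<and>
     (\<forall>x\<in>Uq D. f * act V x = act W x * f)"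

definition short_exact :: "('i, 'u::ring_1, 'z) qgroup_scheme \<Rightarrow> 'u qmod \<Rightarrow> 'u qmod \<Rightarrow> 'u qmod \<Rightarrow> bool" where
  "short_exact D V' V V'' \<longleftrightarrow> (\<exists>f g. intertwiner D V' V f \<and> intertwiner D V V'' g \<and>
     inj_on ((*\<^sub>v) f) (carrier_vec (vdim V')) \<and>
     (*\<^sub>v) g ` carrier_vec (vdim V) = carrier_vec (vdim V'') \<and>
     (*\<^sub>v) f ` carrier_vec (vdim V') = {v \<in> carrier_vec (vdim V). g *\<^sub>v v = 0\<^sub>v (vdim V'')})"

abbreviation groth_free :: "('i::finite, 'u::ring_1, 'z) qgroup_scheme \<Rightarrow> ('u qmod \<Rightarrow>\<^sub>0 int) monoid" where
  "groth_free D \<equiv> free_Abelian_group (fdmod D)"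

definition groth_rels :: "('i::finite, 'u::ring_1, 'z) qgroup_scheme \<Rightarrow> ('u qmod \<Rightarrow>\<^sub>0 int) set" where
  "groth_rels D = generate (groth_free D)
     {frag_of V - frag_of V' - frag_of V'' | V' V V''.
        V' \<in> fdmod D \<and> V \<in> fdmod D \<and> V'' \<in> fdmod D \<and> short_exact D V' V V''}"

definition groth_tensor :: "('i, 'u::ring_1, 'z) qgroup_scheme \<Rightarrow>
    ('u qmod \<Rightarrow>\<^sub>0 int) \<Rightarrow> ('u qmod \<Rightarrow>\<^sub>0 int) \<Rightarrow> ('u qmod \<Rightarrow>\<^sub>0 int)" where
  "groth_tensor D x y = frag_extend (\<lambda>V. frag_extend (\<lambda>W. frag_of (tensor_mod D V W)) y) x"

definition groth_ring :: "('i::finite, 'u::ring_1, 'z) qgroup_scheme \<Rightarrow> ('u qmod \<Rightarrow>\<^sub>0 int) set ring" where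
  "groth_ring D =
     \<lparr>carrier = rcosets\<^bsub>groth_free D\<^esub> (groth_rels D),
      monoid.mult = (\<lambda>A B. \<Union>x\<in>A. \<Union>y\<in>B. groth_rels D #>\<^bsub>groth_free D\<^esub> groth_tensor D x y),
      one = groth_rels D #>\<^bsub>groth_free D\<^esub> frag_of (trivial_mod D),
      ring.zero = groth_rels D,
      add = (\<lambda>A B. A <#>\<^bsub>groth_free D\<^esub> B)\<rparr>"

section \<open>The R-matrix\<close>

definition kappa :: "('i::finite, 'u, 'z) qgroup_scheme \<Rightarrow> 'u qmod \<Rightarrow> 'u qmod \<Rightarrow> ff mat" where
  "kappa D V W = mat (vdim V * vdim W) (vdim V * vdim W) (\<lambda>ij.
     \<Sum>\<nu>\<in>weights D V. \<Sum>\<mu>\<in>weights D W.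
       qpow D (form D \<nu> \<mu>) * kron (wt_proj D V \<nu>) (wt_proj D W \<mu>) $$ ij)"

definition R_matrix :: "('i::finite, 'u, 'z) qgroup_scheme \<Rightarrow> ('i wt \<Rightarrow> 'u tens) \<Rightarrow>
    'u qmod \<Rightarrow> 'u qmod \<Rightarrow> ff mat" where
  "R_matrix D \<Xi> V W = kappa D V W * pos_sum (vdim V * vdim W) (\<lambda>\<nu>. tens_act V W (\<Xi> \<nu>))"

definition is_quasi_R :: "('i::finite, 'u::ring_1, 'z) qgroup_scheme \<Rightarrow> ('i wt \<Rightarrow> 'u tens) \<Rightarrow> bool" where
  "is_quasi_R D \<Xi> \<longleftrightarrow>
     (\<forall>\<nu>\<in>pos_lattice. set (\<Xi> \<nu>) \<subseteq>
        (Uminus D \<inter> root_space D (- \<nu>)) \<times> (Uplus D \<inter> root_space D \<nu>)) \<and>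
     \<Xi> 0 = [(1, 1)] \<and>
     (\<forall>V\<in>fdmod D. \<forall>W\<in>fdmod D. \<forall>x\<in>Uq D.
        R_matrix D \<Xi> V W * comult_act D V W x = comult_op_act D V W x * R_matrix D \<Xi> V W)"

text \<open>The tensor product of the refined quantum group with the endomorphisms of \<open>V\<close> is the ring of
  matrices over \<open>'u\<close>. As \<open>\<kappa>\<close> is symmetric, \<open>kappa_free\<close> serves for either leg acting on \<open>V\<close>.\<close>
definition kappa_free :: "('i::finite, 'u::ring_1, 'z) qgroup_scheme \<Rightarrow> 'u qmod \<Rightarrow> 'u mat" where
  "kappa_free D V = mat (vdim V) (vdim V) (\<lambda>ij.
     \<Sum>\<mu>\<in>weights D V. Kw D \<mu> * scal D (wt_proj D V \<mu> $$ ij))"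

text \<open>\<open>R\<^bsub>\<bullet>,V\<^esub>\<close>\<close>
definition R_free_mod :: "('i::finite, 'u::ring_1, 'z) qgroup_scheme \<Rightarrow> ('i wt \<Rightarrow> 'u tens) \<Rightarrow>
    'u qmod \<Rightarrow> 'u mat" where
  "R_free_mod D \<Xi> V = kappa_free D V * pos_sum (vdim V) (\<lambda>\<nu>.
     mat (vdim V) (vdim V) (\<lambda>ij. \<Sum>(a, b)\<leftarrow>\<Xi> \<nu>. a * scal D (act V b $$ ij)))"

text \<open>\<open>(R\<^bsub>V,\<bullet>\<^esub>)\<^sub>2\<^sub>1\<close>\<close>
definition R_mod_free21 :: "('i::finite, 'u::ring_1, 'z) qgroup_scheme \<Rightarrow> ('i wt \<Rightarrow> 'u tens) \<Rightarrow>
    'u qmod \<Rightarrow> 'u mat" where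
  "R_mod_free21 D \<Xi> V = kappa_free D V * pos_sum (vdim V) (\<lambda>\<nu>.
     mat (vdim V) (vdim V) (\<lambda>ij. \<Sum>(a, b)\<leftarrow>\<Xi> \<nu>. b * scal D (act V a $$ ij)))"

section \<open>Quantum symmetric pairs\<close>

text \<open>\<open>wX\<close> is a reduced expression of the longest element of the parabolic Weyl group; \<open>chi i\<close> is
  the value of the character \<open>\<chi>\<close> at \<open>\<alpha>\<^sub>i\<close>.\<close>
record ('i, 'u) qsp = "('i, 'u) qgroup" +
  Xset :: "'i set"
  tau :: "'i \<Rightarrow> 'i"
  wX :: "'i list"
  chi :: "'i \<Rightarrow> complex"
  gam :: "'i \<Rightarrow> ff"
  sig :: "'i \<Rightarrow> ff"

text \<open>\<open>\<phi> = - w\<^sub>X \<circ> \<tau>\<close> on weights and on coweights; \<open>\<tau>\<close> permutes coordinates by its inverse, which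
  is \<open>\<tau>\<close> itself.\<close>
definition phi_wt :: "('i::finite, 'u) qsp \<Rightarrow> 'i wt \<Rightarrow> 'i wt" where
  "phi_wt D \<nu> = - foldr (refl D) (wX D) (\<nu> \<circ> tau D)"

definition phi_cow :: "('i::finite, 'u) qsp \<Rightarrow> 'i cow \<Rightarrow> 'i cow" where
  "phi_cow D h = - foldr (corefl D) (wX D) (h \<circ> tau D)"

definition Ins :: "('i::finite, 'u) qsp \<Rightarrow> 'i set" where
  "Ins D = {i. phi_wt D (sroot i) = - sroot i}"

definition generalized_satake :: "('i::finite, 'u) qsp \<Rightarrow> bool" where
  "generalized_satake D \<longleftrightarrow>
     (\<forall>i. tau D (tau D i) = i) \<and> (\<forall>i j. cmat D (tau D i) (tau D j) = cmat D i j) \<and>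
     tau D ` Xset D = Xset D \<and>
     longest_word D (Xset D) (wX D) \<and>
     (\<forall>i\<in>Xset D. foldr (refl D) (wX D) (sroot i) = - sroot (tau D i)) \<and>
     (\<forall>i. i \<notin> Xset D \<and> tau D i = i \<longrightarrow>
        \<not> (\<exists>j. j \<noteq> i \<and> component D (insert i (Xset D)) i = {i, j} \<and>
               cmat D i j = - 1 \<and> cmat D j i = - 1))"

definition qsp_parameters :: "('i::finite, 'u) qsp \<Rightarrow> bool" where
  "qsp_parameters D \<longleftrightarrow>
     (\<forall>i. chi D i \<noteq> 0) \<and> (\<forall>i\<in>Xset D. chi D i = 1) \<and>
     (\<forall>i. gam D i \<noteq> 0) \<and> (\<forall>i\<in>Xset D. gam D i = 1) \<and>
     (\<forall>i. form D (sroot i) (phi_wt D (sroot i)) = 0 \<longrightarrow> gam D i = gam D (tau D i)) \<and>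
     (\<forall>i. gam D i \<in> spdom D \<and> spval D (gam D i) = chi D (tau D i)) \<and>
     (\<forall>i. sig D i \<in> spdom D) \<and>
     (\<forall>i. i \<notin> Ins D \<longrightarrow> sig D i = 0) \<and>
     (\<forall>i\<in>Ins D. \<forall>j\<in>Ins D. i \<noteq> j \<longrightarrow> even (cmat D i j) \<or> sig D j = 0)"

definition quantum_symmetric_datum :: "('i::finite, 'u::ring_1) qsp \<Rightarrow> bool" where
  "quantum_symmetric_datum D \<longleftrightarrow> quantum_group D \<and> generalized_satake D \<and> qsp_parameters D"

text \<open>The automorphisms entering \<open>\<phi>\<^sub>q\<close>, each determined by the stated values.\<close>

definition is_lusztig_aut :: "('i::finite, 'u::ring_1) qsp \<Rightarrow> 'i \<Rightarrow> ('u \<Rightarrow> 'u) \<Rightarrow> bool" where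
  "is_lusztig_aut D i T \<longleftrightarrow> alg_aut D T \<and>
     (\<forall>h. T (Kg D h) = Kg D (corefl D i h)) \<and>
     T (Eg D i) = - (Fg D i * Kg D (kcow D i)) \<and>
     T (Fg D i) = - (Kg D (- kcow D i) * Eg D i) \<and>
     (\<forall>j. j \<noteq> i \<longrightarrow> (let m = nat (- cmat D i j); q = qi D i in
        T (Eg D j) = (\<Sum>r\<le>m. scal D ((- 1) ^ r * inverse q ^ r) *
           dpow (scal D) q (Eg D i) (m - r) * Eg D j * dpow (scal D) q (Eg D i) r) \<and>
        T (Fg D j) = (\<Sum>r\<le>m. scal D ((- 1) ^ r * q ^ r) *
           dpow (scal D) q (Fg D i) r * Fg D j * dpow (scal D) q (Fg D i) (m - r))))"

definition is_chevalley_aut :: "('i::finite, 'u::ring_1) qsp \<Rightarrow> ('u \<Rightarrow> 'u) \<Rightarrow> bool" where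
  "is_chevalley_aut D \<omega> \<longleftrightarrow> alg_aut D \<omega> \<and>
     (\<forall>i. \<omega> (Eg D i) = - Fg D i \<and> \<omega> (Fg D i) = - Eg D i) \<and> (\<forall>h. \<omega> (Kg D h) = Kg D (- h))"

definition is_diagram_aut :: "('i::finite, 'u::ring_1) qsp \<Rightarrow> ('u \<Rightarrow> 'u) \<Rightarrow> bool" where
  "is_diagram_aut D t \<longleftrightarrow> alg_aut D t \<and>
     (\<forall>i. t (Eg D i) = Eg D (tau D i) \<and> t (Fg D i) = Fg D (tau D i)) \<and>
     (\<forall>h. t (Kg D h) = Kg D (h \<circ> tau D))"

definition chi_q :: "('i::finite, 'u) qsp \<Rightarrow> 'i wt \<Rightarrow> ff" where
  "chi_q D \<nu> = (\<Prod>i\<in>UNIV. gam D i powi \<lfloor>\<nu> (tau D i)\<rfloor>)"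

definition is_Ad_chi :: "('i::finite, 'u::ring_1) qsp \<Rightarrow> ('u \<Rightarrow> 'u) \<Rightarrow> bool" where
  "is_Ad_chi D A \<longleftrightarrow> alg_aut D A \<and>
     (\<forall>\<nu>\<in>root_lattice. \<forall>x\<in>root_space D \<nu>. A x = scal D (chi_q D \<nu>) * x)"

definition g_phi :: "('i::finite, 'u) qsp \<Rightarrow> 'i wt \<Rightarrow> ff" where
  "g_phi D \<nu> = qpow D (form D (phi_wt D \<nu>) \<nu> / 2 + form D \<nu> (half_sum D (Xset D)))"

text \<open>Conjugation by \<open>g\<^sub>\<phi>\<close>, an operator on modules: \<open>G x\<close> acts as \<open>g\<^sub>\<phi> x g\<^sub>\<phi>\<^sup>-\<^sup>1\<close> on every module.\<close>
definition is_Ad_g :: "('i::finite, 'u::ring_1) qsp \<Rightarrow> ('u \<Rightarrow> 'u) \<Rightarrow> bool" where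
  "is_Ad_g D G \<longleftrightarrow> alg_aut D G \<and>
     (\<forall>V\<in>fdmod D. \<forall>x\<in>Uq D. act V (G x) * wt_op D V (g_phi D) = wt_op D V (g_phi D) * act V x)"

definition is_phi_q :: "('i::finite, 'u::ring_1) qsp \<Rightarrow> ('u \<Rightarrow> 'u) \<Rightarrow> bool" where
  "is_phi_q D \<phi> \<longleftrightarrow> (\<exists>A \<omega> t G T.
     is_Ad_chi D A \<and> is_chevalley_aut D \<omega> \<and> is_diagram_aut D t \<and> is_Ad_g D G \<and>
     (\<forall>i. is_lusztig_aut D i (T i)) \<and>
     (\<forall>x\<in>Uq D. \<phi> x = A (\<omega> (t (G (foldr T (wX D) x))))))"

definition UgX :: "('i, 'u::ring_1) qsp \<Rightarrow> 'u set" where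
  "UgX D = subalg (scal D) (\<Union>i\<in>Xset D. {Eg D i, Fg D i, Kg D (kcow D i), Kg D (- kcow D i)})"

definition Uk :: "('i::finite, 'u::ring_1) qsp \<Rightarrow> ('u \<Rightarrow> 'u) \<Rightarrow> 'u set" where
  "Uk D \<phi> = subalg (scal D)
     ({Fg D i + \<phi> (Fg D i) + scal D (sig D i) * Kg D (- kcow D i) | i. i \<notin> Xset D} \<union>
      UgX D \<union> {Kg D h | h. phi_cow D h = h})"

definition UhphiP :: "('i::finite, 'u::ring_1) qsp \<Rightarrow> 'u set" where
  "UhphiP D = subalg (scal D)
     ({Kg D h | h. phi_cow D h = h} \<union> {Kw D \<nu> | \<nu>. \<nu> \<in> wt_lattice D \<and> phi_wt D \<nu> = \<nu>})"

section \<open>Quasi K-matrix, tensor K-matrix and transfer map\<close>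

definition phi_q_inv :: "('i, 'u::ring_1) qsp \<Rightarrow> ('u \<Rightarrow> 'u) \<Rightarrow> 'u \<Rightarrow> 'u" where
  "phi_q_inv D \<phi> = inv_into (Uq D) \<phi>"

definition quasi_K_op :: "('i wt \<Rightarrow> 'u) \<Rightarrow> 'u qmod \<Rightarrow> ff mat" where
  "quasi_K_op \<Upsilon> V = pos_sum (vdim V) (\<lambda>\<nu>. act V (\<Upsilon> \<nu>))"

definition is_quasi_K :: "('i::finite, 'u::ring_1) qsp \<Rightarrow> ('u \<Rightarrow> 'u) \<Rightarrow> ('i wt \<Rightarrow> 'u) \<Rightarrow> bool" where
  "is_quasi_K D \<phi> \<Upsilon> \<longleftrightarrow>
     (\<forall>\<nu>\<in>pos_lattice. \<Upsilon> \<nu> \<in> Uplus D \<inter> root_space D \<nu>) \<and>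
     \<Upsilon> 0 = 1 \<and>
     (\<forall>V\<in>fdmod D. \<forall>x\<in>Uk D \<phi>.
        quasi_K_op \<Upsilon> V * act V x = act V (phi_q_inv D \<phi> x) * quasi_K_op \<Upsilon> V)"

definition mat_inv :: "ff mat \<Rightarrow> ff mat" where
  "mat_inv M = (THE N. N \<in> carrier_mat (dim_row M) (dim_row M) \<and> inverts_mat M N \<and> inverts_mat N M)"

definition tensor_K :: "('i::finite, 'u::ring_1) qsp \<Rightarrow> ('u \<Rightarrow> 'u) \<Rightarrow> ('i wt \<Rightarrow> 'u tens) \<Rightarrow>
    ('i wt \<Rightarrow> 'u) \<Rightarrow> 'u qmod \<Rightarrow> 'u mat" where
  "tensor_K D \<phi> \<Xi> \<Upsilon> V =
     R_mod_free21 D \<Xi> (twist D (phi_q_inv D \<phi>) V) * map_mat (scal D) (quasi_K_op \<Upsilon> V) *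
     R_free_mod D \<Xi> V"

definition D_op :: "('i::finite, 'u) qsp \<Rightarrow> 'u qmod \<Rightarrow> ff mat" where
  "D_op D V = wt_op D V (\<lambda>\<mu>. qpow D (- 2 * form D (weyl_vector D) \<mu>))"

definition mat_trace :: "'x::comm_monoid_add mat \<Rightarrow> 'x" where
  "mat_trace M = (\<Sum>i<dim_row M. M $$ (i, i))"

definition transfer_mod :: "('i::finite, 'u::ring_1) qsp \<Rightarrow> ('u \<Rightarrow> 'u) \<Rightarrow> ('i wt \<Rightarrow> 'u tens) \<Rightarrow>
    ('i wt \<Rightarrow> 'u) \<Rightarrow> 'u qmod \<Rightarrow> 'u" where
  "transfer_mod D \<phi> \<Xi> \<Upsilon> V =
     mat_trace (map_mat (scal D) (D_op D V * mat_inv (quasi_K_op \<Upsilon> V)) * tensor_K D \<phi> \<Xi> \<Upsilon> V)"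

text \<open>The map induced on the Grothendieck ring by additive extension. The value does not depend on
  the representative of the coset, because the trace is additive on short exact sequences.\<close>
definition transfer_hom :: "('i::finite, 'u::ring_1) qsp \<Rightarrow> ('u \<Rightarrow> 'u) \<Rightarrow> ('i wt \<Rightarrow> 'u tens) \<Rightarrow>
    ('i wt \<Rightarrow> 'u) \<Rightarrow> ('u qmod \<Rightarrow>\<^sub>0 int) set \<Rightarrow> 'u" where
  "transfer_hom D \<phi> \<Xi> \<Upsilon> c =
     (let x = (SOME x. x \<in> c) in
      \<Sum>V\<in>Poly_Mapping.keys x. of_int (Poly_Mapping.lookup x V) * transfer_mod D \<phi> \<Xi> \<Upsilon> V)"

end

theory Submission
  imports Defs "Jordan_Normal_Form.Determinant"
begin

text \<open>Fix a module \<open>V\<close>. Write \<open>P \<mu>\<close> for the projection to the weight space of weight \<open>\<mu>\<close>, \<open>V'\<close> for the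
  twist of \<open>V\<close> by \<open>\<psi> = \<phi>\<^sub>q\<^sup>-\<^sup>1\<close> and \<open>P'\<close> for its weight projections. Expanding both R-matrices turns the value
  of the transfer map at \<open>V\<close> into a finite sum of terms
  \<open>k\<^bsub>\<mu>'\<^esub> b' k\<^bsub>\<mu>\<^esub> a \<cdot> tr(D \<Upsilon>\<^sup>-\<^sup>1 P' \<mu>' \<psi>(a') \<Upsilon> P \<mu> b)\<close> with \<open>a\<close>, \<open>b\<close> of degrees \<open>-\<nu>\<close>, \<open>\<nu>\<close> and \<open>a'\<close>, \<open>b'\<close> of degrees
  \<open>-\<nu>'\<close>, \<open>\<nu>'\<close> (\<open>tensor_K_expansion\<close>). It suffices to show that each term with a non-zero trace lies in
  \<open>U\<^sub>q(g\<^sub>X) U\<^sub>q(h\<^sup>\<phi>)\<^sup>P\<close>.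

  Measure a weight by the sum \<open>ht\<close> of its coordinates outside \<open>X\<close>. No operator in the trace lowers \<open>ht\<close>:
  \<open>b\<close> raises it by \<open>ht \<nu>\<close>, and \<open>\<psi>(a')\<close>, which shifts weights by \<open>-\<phi>(\<nu>')\<close>, raises it by \<open>ht \<nu>'\<close>. Moreover
  \<open>\<Upsilon>\<close> is the identity plus an operator which raises \<open>ht\<close> strictly, and so is its inverse
  (\<open>quasi_K_triangular\<close>, \<open>unitriangular_inverse\<close>): a component of \<open>\<Upsilon>\<close> of degree in the span of \<open>X\<close> commutes
  with \<open>k\<^sub>i\<close> for all \<open>i \<in> X\<close>, so its degree is orthogonal to this span, hence zero because the form is
  positive definite. A non-zero trace needs a weight that comes back to itself, which forces
  \<open>ht \<nu> = ht \<nu>' = 0\<close> and leaves only the identity parts of \<open>\<Upsilon>\<close> and \<open>\<Upsilon>\<^sup>-\<^sup>1\<close>. So \<open>\<nu>\<close> and \<open>\<nu>'\<close> lie in the span of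
  \<open>X\<close>, which \<open>\<phi>\<close> fixes pointwise, and if the trace starts in weight \<open>\<kappa>\<close>, then \<open>\<mu> = \<kappa> + \<nu>\<close> and \<open>\<mu>' = \<phi>(\<kappa>)\<close>
  (\<open>trace_nonzero\<close>).

  Then \<open>\<mu>' + \<mu> = \<phi>(\<kappa>) + \<kappa> + \<nu>\<close> is fixed by \<open>\<phi>\<close>. The elements \<open>b'\<close> and \<open>a\<close> involve only generators indexed by \<open>X\<close>
  and commute with the torus up to scalars (\<open>homogeneous_in_parabolic\<close>), so \<open>k\<^bsub>\<mu>'\<^esub> b' k\<^bsub>\<mu>\<^esub> a\<close> is a multiple of
  \<open>b' a k\<^bsub>\<mu>'+\<mu>\<^esub>\<close>.

  Two points need care. That \<open>V'\<close> has the weight space \<open>V\<^bsub>\<mu>\<^esub>\<close> in weight \<open>\<phi>(\<mu>)\<close> is derived from the factors of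
  \<open>\<phi>\<^sub>q\<close> by working on modules only (\<open>psi_K_diagonal\<close>); and that \<open>\<phi> = - w\<^sub>X \<circ> \<tau>\<close> is an involution follows from
  \<open>w\<^sub>X(\<alpha>\<^sub>i) = - \<alpha>\<^bsub>\<tau>(i)\<^esub>\<close> for \<open>i \<in> X\<close> and the positive definiteness of the form (\<open>w_shift\<close>).\<close>

(* The sign $ is kept for the entries of vectors. *)
no_notation fps_nth (infixl "$" 75)

section \<open>Powers of the parameter and independence of characters\<close>

lemma qpow_0:
  assumes "quantum_group D" shows "qpow D 0 = 1"
proof -
  have q: "qpow D 1 = qq" "\<And>r s. qpow D (r + s) = qpow D r * qpow D s"
    using assms by (auto simp: quantum_group_def)
  have "qq \<noteq> 0" by (simp add: qq_def)
  then show ?thesis using q(2)[of 0 1] q(1) by simp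
qed

lemma qpow_add:
  assumes "quantum_group D" shows "qpow D (r + s) = qpow D r * qpow D s"
  using assms by (auto simp: quantum_group_def)

lemma qpow_nonzero:
  assumes "quantum_group D" shows "qpow D r \<noteq> 0"
  using qpow_add[OF assms, of r "- r"] qpow_0[OF assms] by auto

lemma qpow_of_nat_mult:
  assumes "quantum_group D" shows "qpow D (of_nat n * r) = qpow D r ^ n"
  by (induction n) (simp_all add: qpow_0[OF assms] qpow_add[OF assms] algebra_simps)

lemma to_fract_power: "to_fract (x ^ n) = to_fract x ^ n"
  by (induction n) simp_all

lemma qq_power_neq_1:
  assumes "n > 0" shows "qq ^ n \<noteq> 1"
proof
  assume "qq ^ n = 1"
  then have "to_ac (to_fract ([:0, 1:] ^ n :: complex poly)) = to_ac (to_fract 1)"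
    by (simp only: qq_def to_fract_power to_ac_power to_fract_1 to_ac_1)
  then have "([:0, 1:] :: complex poly) ^ n = 1" by (simp only: to_ac_eq_iff to_fract_eq_iff)
  then have "poly ([:0, 1:] ^ n) (0::complex) = 1" by simp
  then show False using assms by (simp add: poly_power power_0_left)
qed

text \<open>The parameter is transcendental, so no non-trivial rational power of it equals one.\<close>
lemma qpow_eq_1_iff:
  assumes "quantum_group D" shows "qpow D r = 1 \<longleftrightarrow> r = 0"
proof
  assume r: "qpow D r = 1"
  obtain a b where ab: "quotient_of r = (a, b)" by (cases "quotient_of r")
  have b: "b > 0" using quotient_of_denom_pos[OF ab] .
  have eq: "r = of_int a / of_int b" using quotient_of_div[OF ab] .
  have m: "of_nat (nat b) * r = of_int a" using b eq by simp
  have "qpow D (of_int a) = 1"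
    using qpow_of_nat_mult[OF assms, of "nat b" r] r m by simp
  moreover have "qpow D (- of_int a) = 1"
    using qpow_add[OF assms, of "of_int a" "- of_int a"] calculation qpow_0[OF assms] by simp
  ultimately have "qpow D (of_nat (nat \<bar>a\<bar>) * 1) = 1" by (cases "a \<ge> 0") auto
  then have "qq ^ nat \<bar>a\<bar> = 1"
    unfolding qpow_of_nat_mult[OF assms] using assms by (simp add: quantum_group_def)
  then have "a = 0" using qq_power_neq_1[of "nat \<bar>a\<bar>"] by auto
  then show "r = 0" using eq by simp
qed (simp add: qpow_0[OF assms])

lemma qpow_inject:
  assumes "quantum_group D" shows "qpow D r = qpow D s \<longleftrightarrow> r = s"
proof
  assume "qpow D r = qpow D s"
  then have "qpow D (r + - s) = qpow D (s + - s)" by (simp only: qpow_add[OF assms])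
  then show "r = s" using qpow_eq_1_iff[OF assms, of "r - s"] qpow_0[OF assms] by simp
qed simp

lemma scal_simps:
  assumes "is_algebra s"
  shows "s 1 = 1" "s 0 = 0" "s (a + b) = s a + s b" "s (a * b) = s a * s b" "s (- a) = - s a"
    "s (a - b) = s a - s b" "s a * x = x * s a"
proof -
  show "s 1 = 1" "s (a + b) = s a + s b" "s (a * b) = s a * s b" "s a * x = x * s a"
    using assms unfolding is_algebra_def by blast+
  have add: "\<And>a b. s (a + b) = s a + s b" using assms unfolding is_algebra_def by blast
  show z: "s 0 = 0" using add[of 0 0] by simp
  show m: "s (- a) = - s a" for a using add[of a "- a"] z minus_unique[of "s a" "s (- a)"] by simp
  show "s (a - b) = s a - s b" using add[of a "- b"] m by simp
qed

lemma scal_sum: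
  assumes "is_algebra s"
  shows "s (sum f A) = (\<Sum>x\<in>A. s (f x))"
  by (induction A rule: infinite_finite_induct) (simp_all add: scal_simps(1-3)[OF assms])

lemma scal_cancel:
  assumes "is_algebra s" "c \<noteq> 0" "s c * x = 0"
  shows "x = 0"
proof -
  have "s (inverse c) * (s c * x) = s (inverse c * c) * x"
    by (simp only: scal_simps(4)[OF assms(1)] mult.assoc)
  also have "\<dots> = x" using assms(2) by (simp add: scal_simps(1)[OF assms(1)])
  finally show ?thesis using assms(3) by simp
qed

lemma is_algebra_id: "is_algebra (\<lambda>x. x :: ff)"
  by (auto simp: is_algebra_def)

lemma pair_add_left: "pair D (\<nu> + \<mu>) h = pair D \<nu> h + pair D \<mu> h"
  by (simp add: pair_def algebra_simps sum.distrib)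
lemma pair_add_right: "pair D \<nu> (h + h') = pair D \<nu> h + pair D \<nu> h'"
  by (simp add: pair_def algebra_simps sum.distrib)
lemma pair_uminus_left: "pair D (- \<nu>) h = - pair D \<nu> h"
  by (simp add: pair_def sum_negf)
lemma pair_uminus_right: "pair D \<nu> (- h) = - pair D \<nu> h"
  by (simp add: pair_def sum_negf)
lemma pair_diff_left: "pair D (\<nu> - \<mu>) h = pair D \<nu> h - pair D \<mu> h"
  using pair_add_left[of D \<nu> "- \<mu>" h] by (simp add: pair_uminus_left)
lemma pair_0_left: "pair D 0 h = 0" by (simp add: pair_def)
lemma pair_0_right: "pair D \<nu> 0 = 0" by (simp add: pair_def)

lemmas pair_linear = pair_add_left pair_add_right pair_uminus_left pair_uminus_right
  pair_diff_left pair_0_left pair_0_right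

lemma pair_scoroot: "pair D \<nu> (scoroot i) = (\<Sum>j\<in>UNIV. of_int (cmat D i j) * \<nu> j)"
proof -
  have "pair D \<nu> (scoroot i) = (\<Sum>k\<in>UNIV. if k = i then (\<Sum>j\<in>UNIV. of_int (cmat D i j) * \<nu> j) else 0)"
    unfolding pair_def scoroot_def by (rule sum.cong) auto
  then show ?thesis by simp
qed

lemma pair_expand: "pair D \<nu> h = (\<Sum>i\<in>UNIV. of_int (h i) * pair D \<nu> (scoroot i))"
  unfolding pair_scoroot by (simp add: pair_def sum_distrib_left mult.assoc)

lemma form_expand: "form D \<nu> \<mu> = (\<Sum>i\<in>UNIV. \<nu> i * (of_int (eps D i) * pair D \<mu> (scoroot i)))"
  unfolding pair_scoroot by (simp add: form_def sum_distrib_left mult.assoc)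

lemma pair_kcow: "pair D \<nu> (kcow D i) = of_int (eps D i) * pair D \<nu> (scoroot i)"
proof -
  have "pair D \<nu> (kcow D i) = (\<Sum>k\<in>UNIV. if k = i then of_int (eps D i) * pair D \<nu> (scoroot i) else 0)"
    unfolding pair_expand[of D \<nu> "kcow D i"] by (rule sum.cong) (auto simp: kcow_def scoroot_def)
  then show ?thesis by simp
qed

lemma pair_inject:
  assumes "simple_cartan_datum D" "\<And>h. pair D \<nu> h = pair D \<mu> h"
  shows "\<nu> = \<mu>"
proof (rule ccontr)
  assume "\<nu> \<noteq> \<mu>"
  then have "form D (\<nu> - \<mu>) (\<nu> - \<mu>) > 0" using assms(1) by (simp add: simple_cartan_datum_def)
  moreover have "form D (\<nu> - \<mu>) (\<nu> - \<mu>) = 0"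
    unfolding form_expand by (simp add: pair_linear assms(2))
  ultimately show False by simp
qed

text \<open>Artin's argument for the characters \<open>h \<mapsto> q\<^bsup>\<nu>(h)\<^esup>\<close> of the coroot lattice, which are distinct as the
  Cartan matrix is invertible. Coefficients in an arbitrary algebra serve both for coordinates of weight
  vectors and for elements of the quantum group.\<close>
lemma weights_independent:
  assumes "quantum_group D" "is_algebra s" "finite S"
    and "\<And>h. (\<Sum>\<nu>\<in>S. s (qpow D (pair D \<nu> h)) * y \<nu>) = 0" "\<nu> \<in> S"
  shows "y \<nu> = 0"
  using assms(3-5)
proof (induction S arbitrary: y \<nu> rule: finite_induct)
  case (insert \<rho> S)
  let ?c = "\<lambda>\<nu> h. qpow D (pair D \<nu> h)"
  note s = scal_simps[OF assms(2)]
  \<comment> \<open>Subtracting \<open>q\<^bsup>\<rho>(h0)\<^esup>\<close> times the relation from its translate by \<open>h0\<close> removes the term at \<open>\<rho>\<close>.\<close>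
  have z: "y \<mu> = 0" if \<mu>: "\<mu> \<in> S" for \<mu>
  proof -
    have "\<mu> \<noteq> \<rho>" using \<mu> insert.hyps by auto
    then obtain h0 where h0: "pair D \<mu> h0 \<noteq> pair D \<rho> h0"
      using pair_inject[of D \<mu> \<rho>] assms(1) by (auto simp: quantum_group_def)
    have "(\<Sum>\<nu>\<in>S. s (?c \<nu> h) * (s (?c \<nu> h0 - ?c \<rho> h0) * y \<nu>)) = 0" for h
    proof -
      have "(\<Sum>\<nu>\<in>insert \<rho> S. s (?c \<nu> (h + h0)) * y \<nu>)
          - s (?c \<rho> h0) * (\<Sum>\<nu>\<in>insert \<rho> S. s (?c \<nu> h) * y \<nu>) = 0"
        using insert.prems(1) by simp
      also have "(\<Sum>\<nu>\<in>insert \<rho> S. s (?c \<nu> (h + h0)) * y \<nu>)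
          - s (?c \<rho> h0) * (\<Sum>\<nu>\<in>insert \<rho> S. s (?c \<nu> h) * y \<nu>)
          = (\<Sum>\<nu>\<in>insert \<rho> S. s (?c \<nu> h) * (s (?c \<nu> h0 - ?c \<rho> h0) * y \<nu>))"
        unfolding sum_distrib_left sum_subtractf[symmetric]
      proof (rule sum.cong[OF refl])
        fix \<nu>
        have "s (?c \<nu> (h + h0)) = s (?c \<nu> h) * s (?c \<nu> h0)"
          by (simp only: pair_linear qpow_add[OF assms(1)] s(4))
        moreover have "s (?c \<rho> h0) * (s (?c \<nu> h) * y \<nu>) = s (?c \<nu> h) * (s (?c \<rho> h0) * y \<nu>)"
          by (simp only: mult.assoc s(7)[of "?c \<rho> h0"])
        ultimately show "s (?c \<nu> (h + h0)) * y \<nu> - s (?c \<rho> h0) * (s (?c \<nu> h) * y \<nu>)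
            = s (?c \<nu> h) * (s (?c \<nu> h0 - ?c \<rho> h0) * y \<nu>)"
          by (simp only: s(6) left_diff_distrib right_diff_distrib mult.assoc)
      qed
      finally show ?thesis using insert.hyps by (simp add: s(2))
    qed
    then have "s (?c \<mu> h0 - ?c \<rho> h0) * y \<mu> = 0"
      using insert.IH[of "\<lambda>\<nu>. s (?c \<nu> h0 - ?c \<rho> h0) * y \<nu>" \<mu>] \<mu> by blast
    moreover have "?c \<mu> h0 - ?c \<rho> h0 \<noteq> 0" using h0 by (simp add: qpow_inject[OF assms(1)])
    ultimately show ?thesis by (rule scal_cancel[OF assms(2), rotated])
  qed
  moreover have "s (?c \<rho> (\<lambda>_. 0)) * y \<rho> = 0" using insert.prems(1)[of "\<lambda>_. 0"] insert.hyps z by simp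
  then have "y \<rho> = 0" by (rule scal_cancel[OF assms(2) qpow_nonzero[OF assms(1)]])
  ultimately show ?case using insert.prems by auto
qed simp

section \<open>The involution of the weight lattice\<close>

lemma sum_delta_scaled: "(\<Sum>j\<in>UNIV. f j * (c * sroot i j)) = f (i::'i::finite) * (c::rat)"
  "(\<Sum>j\<in>UNIV. c * sroot i j * f j) = c * f i"
proof -
  have "(\<Sum>j\<in>UNIV. f j * (c * sroot i j)) = (\<Sum>j\<in>UNIV. if j = i then f i * c else 0)"
    by (rule sum.cong) (auto simp: sroot_def)
  then show 1: "(\<Sum>j\<in>UNIV. f j * (c * sroot i j)) = f i * c" by simp
  have "(\<Sum>j\<in>UNIV. c * sroot i j * f j) = (\<Sum>j\<in>UNIV. f j * (c * sroot i j))"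
    by (rule sum.cong) (auto simp: mult.commute)
  then show "(\<Sum>j\<in>UNIV. c * sroot i j * f j) = c * f i" using 1 by simp
qed

lemma pair_sroot_scoroot: "pair D (sroot i) (scoroot j) = of_int (cmat D j i)"
  using sum_delta_scaled(1)[of "\<lambda>k. of_int (cmat D j k)" 1 i] by (simp add: pair_scoroot)

lemma pair_sroot: "pair D (sroot i) h = (\<Sum>k\<in>UNIV. of_int (h k * cmat D k i))"
  by (simp add: pair_expand[of D "sroot i" h] pair_sroot_scoroot)

lemma pair_scale: "pair D (\<lambda>j. c * \<nu> j) h = c * pair D \<nu> h"
  by (simp add: pair_def sum_distrib_left mult.left_commute)

lemma pair_sum: "pair D (\<lambda>j. \<Sum>i\<in>A. f i j) h = (\<Sum>i\<in>A. pair D (f i) h)"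
proof (induction A rule: infinite_finite_induct)
  case (insert x F)
  have "(\<lambda>j. \<Sum>i\<in>insert x F. f i j) = f x + (\<lambda>j. \<Sum>i\<in>F. f i j)"
    using insert by (auto simp: fun_eq_iff)
  then show ?case using insert by (simp add: pair_linear)
qed (simp_all add: pair_def)

lemma refl_eq: "refl D i \<nu> = \<nu> - (\<lambda>j. pair D \<nu> (scoroot i) * sroot i j)"
  by (auto simp: refl_def fun_eq_iff)

lemma pair_refl: "pair D (refl D i \<nu>) h = pair D \<nu> h - pair D \<nu> (scoroot i) * pair D (sroot i) h"
  by (simp add: refl_eq pair_linear pair_scale)

lemma refl_add: "refl D i (\<nu> + \<mu>) = refl D i \<nu> + refl D i \<mu>"
  by (auto simp: refl_def pair_linear fun_eq_iff algebra_simps)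

lemma foldr_refl_add: "foldr (refl D) ws (\<nu> + \<mu>) = foldr (refl D) ws \<nu> + foldr (refl D) ws \<mu>"
  by (induction ws) (simp_all only: foldr.simps id_apply o_apply refl_add)

lemma sum_mult_sroot: "(\<Sum>i\<in>UNIV. \<nu> i * sroot i j) = \<nu> (j::'i::finite)"
proof -
  have "(\<Sum>i\<in>UNIV. \<nu> i * sroot i j) = (\<Sum>i\<in>UNIV. if i = j then \<nu> j else 0)"
    by (rule sum.cong) (auto simp: sroot_def)
  then show ?thesis by simp
qed

text \<open>Linearity over the rationals, expressed in the coordinates of the simple roots.\<close>
lemma foldr_refl_expand:
  "foldr (refl D) ws \<nu> = (\<lambda>j. \<Sum>i\<in>UNIV. \<nu> i * foldr (refl D) ws (sroot i) j)"
proof (induction ws)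
  case Nil
  show ?case by (simp add: sum_mult_sroot)
next
  case (Cons k ws)
  let ?f = "\<lambda>i. foldr (refl D) ws (sroot i)"
  have "foldr (refl D) (k # ws) \<nu> = refl D k (\<lambda>j. \<Sum>i\<in>UNIV. \<nu> i * ?f i j)"
    using Cons by simp
  also have "\<dots> = (\<lambda>j. \<Sum>i\<in>UNIV. \<nu> i * refl D k (?f i) j)"
    by (auto simp: refl_def pair_sum pair_scale fun_eq_iff sum_subtractf sum_distrib_right
        right_diff_distrib mult.assoc)
  finally show ?case by simp
qed

lemma foldr_refl_outside: "j \<notin> set ws \<Longrightarrow> foldr (refl D) ws \<nu> j = \<nu> j"
  by (induction ws) (auto simp: refl_def sroot_def)

lemma foldr_refl_wt_lattice:
  assumes "\<nu> \<in> wt_lattice D" shows "foldr (refl D) ws \<nu> \<in> wt_lattice D"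
  using assms
  by (induction ws) (auto simp: wt_lattice_def pair_refl pair_sroot_scoroot)

lemma scoroot_alg: "(\<lambda>j. h j - c * scoroot i j) = h - (\<lambda>j. c * scoroot i j)"
  by (simp add: fun_eq_iff)

lemma pair_corefl: "pair D \<nu> (corefl D i h) = pair D (refl D i \<nu>) h"
proof -
  have "pair D \<nu> (\<lambda>j. c * scoroot i j) = of_int c * pair D \<nu> (scoroot i)" for c
    unfolding pair_expand[of D \<nu> "\<lambda>j. c * scoroot i j"]
    by (simp add: pair_expand[of D \<nu> "scoroot i"] sum_distrib_left mult.assoc)
  then show ?thesis
    unfolding corefl_def scoroot_alg diff_conv_add_uminus[of h] pair_linear
    by (simp add: pair_refl pair_sroot)
qed

text \<open>Words act on coroots through the contragredient representation, so the word is reversed.\<close>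
lemma pair_foldr_refl:
  "pair D (foldr (refl D) ws \<nu>) h = pair D \<nu> (foldr (corefl D) (rev ws) h)"
  by (induction ws arbitrary: h) (simp_all add: pair_corefl[symmetric])

lemma corefl_involution:
  assumes "cmat D i i = 2" shows "corefl D i (corefl D i h) = h"
proof -
  let ?n = "\<Sum>k\<in>UNIV. h k * cmat D k i"
  have "(\<Sum>k\<in>UNIV. ?n * scoroot i k * cmat D k i) = (\<Sum>k\<in>UNIV. if k = i then ?n * cmat D i i else 0)"
    by (rule sum.cong) (auto simp: scoroot_def)
  then have "(\<Sum>k\<in>UNIV. corefl D i h k * cmat D k i) = - ?n"
    using assms by (simp add: corefl_def left_diff_distrib sum_subtractf)
  then show ?thesis by (auto simp: corefl_def fun_eq_iff)
qed

lemma foldr_corefl_rev: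
  assumes "\<And>i. cmat D i i = 2"
  shows "foldr (corefl D) ws (foldr (corefl D) (rev ws) h) = h"
  by (induction ws arbitrary: h) (simp_all add: corefl_involution[OF assms])

lemma form_commute:
  assumes "simple_cartan_datum D" shows "form D \<nu> \<mu> = form D \<mu> \<nu>"
proof -
  have e: "eps D i * cmat D i j = eps D j * cmat D j i" for i j
    using assms by (simp add: simple_cartan_datum_def)
  have "form D \<nu> \<mu> = (\<Sum>j\<in>UNIV. \<Sum>i\<in>UNIV. \<nu> i * of_int (eps D i * cmat D i j) * \<mu> j)"
    unfolding form_def by (rule sum.swap)
  also have "\<dots> = form D \<mu> \<nu>" unfolding form_def e[of _ _]
    by (intro sum.cong refl) (simp only: mult.commute mult.left_commute e)
  finally show ?thesis .
qed

lemma form_refl_left: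
  "form D (refl D i \<nu>) \<mu> = form D \<nu> \<mu> - pair D \<nu> (scoroot i) * (of_int (eps D i) * pair D \<mu> (scoroot i))"
  unfolding form_expand by (simp add: refl_def left_diff_distrib sum_subtractf sum_delta_scaled)

lemma form_refl:
  assumes "simple_cartan_datum D"
  shows "form D (refl D i \<nu>) (refl D i \<mu>) = form D \<nu> \<mu>"
proof -
  have c: "cmat D i i = 2" using assms by (simp add: simple_cartan_datum_def)
  have "form D \<nu> (refl D i \<mu>)
      = form D \<nu> \<mu> - pair D \<mu> (scoroot i) * (of_int (eps D i) * pair D \<nu> (scoroot i))"
    using form_refl_left[of D i \<mu> \<nu>] form_commute[OF assms] by metis
  then show ?thesis
    by (simp add: form_refl_left pair_refl pair_sroot_scoroot c algebra_simps)
qed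

lemma form_foldr_refl:
  assumes "simple_cartan_datum D"
  shows "form D (foldr (refl D) ws \<nu>) (foldr (refl D) ws \<mu>) = form D \<nu> \<mu>"
  by (induction ws) (simp_all add: form_refl[OF assms])

lemma form_sroot_left: "form D (sroot i) \<mu> = of_int (eps D i) * pair D \<mu> (scoroot i)"
  unfolding form_expand using sum_delta_scaled(2)[of 1 i "\<lambda>j. of_int (eps D j) * pair D \<mu> (scoroot j)"]
  by simp

lemma form_uminus_left: "form D (- \<nu>) \<mu> = - form D \<nu> \<mu>"
  by (simp add: form_def sum_negf)

lemma form_uminus_right: "form D \<nu> (- \<mu>) = - form D \<nu> \<mu>"
  by (simp add: form_def sum_negf)

text \<open>Such a \<open>\<delta>\<close> is orthogonal to itself, while the form is positive definite.\<close>
lemma zero_if_orthogonal: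
  assumes "simple_cartan_datum D" "\<And>j. j \<notin> Y \<Longrightarrow> \<delta> j = 0"
    and "\<And>j. j \<in> Y \<Longrightarrow> pair D \<delta> (scoroot j) = 0"
  shows "\<delta> = 0"
proof (rule ccontr)
  assume "\<delta> \<noteq> 0"
  then have "form D \<delta> \<delta> > 0" using assms(1) by (simp add: simple_cartan_datum_def)
  moreover have "\<delta> i * (of_int (eps D i) * pair D \<delta> (scoroot i)) = 0" for i
    using assms(2,3)[of i] by auto
  then have "form D \<delta> \<delta> = 0" unfolding form_expand by (intro sum.neutral) blast
  ultimately show False by simp
qed

locale satake_diagram =
  fixes D :: "('i::finite, 'u) qsp"
  assumes simple: "simple_cartan_datum D" and satake: "generalized_satake D"
begin

abbreviation "w \<equiv> foldr (refl D) (wX D)"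
abbreviation "\<tau> \<equiv> tau D"

lemma tau_involution [simp]: "\<tau> (\<tau> i) = i"
  and tau_cmat [simp]: "cmat D (\<tau> i) (\<tau> j) = cmat D i j"
  and tau_X: "\<tau> i \<in> Xset D \<longleftrightarrow> i \<in> Xset D"
  and word_X: "set (wX D) \<subseteq> Xset D"
  and w_sroot: "i \<in> Xset D \<Longrightarrow> w (sroot i) = - sroot (\<tau> i)"
proof -
  show t: "\<tau> (\<tau> i) = i" for i using satake by (simp add: generalized_satake_def)
  have "\<tau> ` (Xset D) = (Xset D)" using satake by (simp add: generalized_satake_def)
  then show "\<tau> i \<in> Xset D \<longleftrightarrow> i \<in> Xset D" using t by (metis imageI)
qed (use satake in \<open>auto simp: generalized_satake_def longest_word_def\<close>)

lemma comp_tau [simp]: "\<nu> \<circ> \<tau> \<circ> \<tau> = \<nu>" by (auto simp: fun_eq_iff)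

lemma bij_tau: "bij \<tau>" by (rule o_bij[of \<tau>]) (auto simp: fun_eq_iff)

lemma sum_tau: "(\<Sum>i\<in>UNIV. f (\<tau> i)) = (\<Sum>i\<in>UNIV. f i)"
  using sum.reindex_bij_betw[OF bij_tau] .

lemma pair_comp_tau: "pair D (\<nu> \<circ> \<tau>) h = pair D \<nu> (h \<circ> \<tau>)"
proof -
  have "pair D (\<nu> \<circ> \<tau>) h = (\<Sum>i\<in>UNIV. \<Sum>j\<in>UNIV. of_int (h i) * of_int (cmat D i (\<tau> j)) * \<nu> j)"
    unfolding pair_def
    using sum_tau[of "\<lambda>j. of_int (h i) * of_int (cmat D i (\<tau> j)) * \<nu> j" for i] by simp
  also have "\<dots> = pair D \<nu> (h \<circ> \<tau>)"
    unfolding pair_def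
    using sum_tau[of "\<lambda>i. \<Sum>j\<in>UNIV. of_int (h (\<tau> i)) * of_int (cmat D i j) * \<nu> j"]
      tau_cmat[of "\<tau> i" for i] by (simp flip: tau_cmat[of "\<tau> i" for i])
  finally show ?thesis .
qed

lemma scoroot_comp_tau: "scoroot i \<circ> \<tau> = scoroot (\<tau> i)"
  by (auto simp: scoroot_def fun_eq_iff)

text \<open>The roots \<open>\<alpha>\<^bsub>\<tau>(i)\<^esub>\<close> and \<open>\<alpha>\<^sub>i\<close> have the same length because \<open>w\<close> maps one to the negative of the other
  and preserves the form.\<close>
lemma eps_tau: "i \<in> Xset D \<Longrightarrow> eps D (\<tau> i) = eps D i"
proof -
  assume i: "i \<in> Xset D"
  have c: "cmat D j j = 2" for j using simple by (simp add: simple_cartan_datum_def)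
  have f: "form D (sroot j) (sroot j) = of_int (eps D j) * 2" for j
    by (simp add: form_sroot_left pair_sroot_scoroot c)
  have "form D (w (sroot i)) (w (sroot i)) = form D (sroot i) (sroot i)"
    by (rule form_foldr_refl[OF simple])
  then show ?thesis unfolding w_sroot[OF i] form_uminus_left form_uminus_right f by simp
qed

text \<open>Invariance of the form, with \<open>w\<close> moved from one argument to the other.\<close>
lemma pair_w:
  assumes "i \<in> Xset D" shows "pair D (w \<nu>) (scoroot i) = - pair D \<nu> (scoroot (\<tau> i))"
proof -
  have ti: "\<tau> i \<in> Xset D" using assms tau_X by simp
  have "form D (w (sroot (\<tau> i))) (w \<nu>) = form D (sroot (\<tau> i)) \<nu>"
    by (rule form_foldr_refl[OF simple])
  moreover have "eps D i > 0" using simple by (simp add: simple_cartan_datum_def)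
  ultimately show ?thesis
    unfolding w_sroot[OF ti] form_uminus_left form_sroot_left eps_tau[OF assms]
    by (simp add: minus_equation_iff[of "pair D (w \<nu>) (scoroot i)"] flip: mult_minus_right)
qed

lemma w_outside: "j \<notin> Xset D \<Longrightarrow> w \<nu> j = \<nu> j"
  using foldr_refl_outside word_X by (metis subsetD)

lemma w_on_X:
  assumes "\<And>j. j \<notin> Xset D \<Longrightarrow> \<nu> j = 0" shows "w \<nu> = - (\<nu> \<circ> \<tau>)"
proof -
  have "\<nu> i * w (sroot i) j = - (\<nu> i * sroot i (\<tau> j))" for i j
  proof (cases "i \<in> Xset D")
    case True
    have "sroot (\<tau> i) j = sroot i (\<tau> j)" by (auto simp: sroot_def)
    then show ?thesis by (simp add: w_sroot[OF True])
  qed (simp add: assms)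
  then have "w \<nu> = (\<lambda>j. - (\<Sum>i\<in>UNIV. \<nu> i * sroot i (\<tau> j)))"
    unfolding foldr_refl_expand[of D "wX D" \<nu>] by (simp add: sum_negf)
  also have "\<dots> = - (\<nu> \<circ> \<tau>)" by (auto simp: fun_eq_iff sum_mult_sroot)
  finally show ?thesis .
qed

text \<open>The three vectors compared here lie in the span of the roots in \<open>X\<close> and have the same pairings with the
  coroots in \<open>X\<close>, which determines them. It follows that \<open>w\<close> commutes with \<open>\<tau>\<close> and is an involution.\<close>
lemma w_shift:
  shows "w (\<mu> \<circ> \<tau>) - (\<mu> \<circ> \<tau>) = w \<mu> - \<mu>" and "((w \<mu> - \<mu>) \<circ> \<tau>) = w \<mu> - \<mu>"
proof -
  have p: "pair D (w \<nu> - \<nu>) (scoroot j) = - pair D \<nu> (scoroot (\<tau> j)) - pair D \<nu> (scoroot j)"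
    if "j \<in> Xset D" for \<nu> j using pair_w[OF that] by (simp add: pair_linear)
  have "w (\<mu> \<circ> \<tau>) - (\<mu> \<circ> \<tau>) - (w \<mu> - \<mu>) = 0"
    by (rule zero_if_orthogonal[OF simple, of "Xset D"])
      (simp_all add: w_outside pair_diff_left[of D "w _ - _"] p pair_comp_tau scoroot_comp_tau)
  then show "w (\<mu> \<circ> \<tau>) - (\<mu> \<circ> \<tau>) = w \<mu> - \<mu>" by simp
  have "((w \<mu> - \<mu>) \<circ> \<tau>) - (w \<mu> - \<mu>) = 0"
    by (rule zero_if_orthogonal[OF simple, of "Xset D"])
      (simp_all add: w_outside tau_X pair_diff_left[of D "_ \<circ> _"] p pair_comp_tau scoroot_comp_tau)
  then show "((w \<mu> - \<mu>) \<circ> \<tau>) = w \<mu> - \<mu>" by simp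
qed

lemma w_comp_tau: "w (\<mu> \<circ> \<tau>) = (w \<mu> \<circ> \<tau>)"
proof -
  have "w (\<mu> \<circ> \<tau>) = (\<mu> \<circ> \<tau>) + (w (\<mu> \<circ> \<tau>) - (\<mu> \<circ> \<tau>))" by simp
  also have "\<dots> = (\<mu> \<circ> \<tau>) + ((w \<mu> - \<mu>) \<circ> \<tau>)" by (simp only: w_shift)
  also have "\<dots> = (w \<mu> \<circ> \<tau>)" by (auto simp: fun_eq_iff)
  finally show ?thesis .
qed

lemma w_involution: "w (w \<mu>) = \<mu>"
proof -
  have "w (w \<mu> - \<mu>) = - ((w \<mu> - \<mu>) \<circ> \<tau>)" by (rule w_on_X) (simp add: w_outside)
  also have "\<dots> = - (w \<mu> - \<mu>)" by (simp only: w_shift)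
  finally have "w (w \<mu> - \<mu>) = - (w \<mu> - \<mu>)" .
  moreover have "w (w \<mu>) = w (w \<mu> - \<mu>) + w \<mu>" using foldr_refl_add[of D "wX D" "w \<mu> - \<mu>" \<mu>] by simp
  ultimately show ?thesis by simp
qed

lemma w_uminus: "w (- \<mu>) = - w \<mu>"
proof -
  have "w 0 = 0" using foldr_refl_add[of D "wX D" 0 0] by simp
  then have "w (- \<mu>) + w \<mu> = 0" using foldr_refl_add[of D "wX D" "- \<mu>" \<mu>] by simp
  then show ?thesis by (simp add: eq_neg_iff_add_eq_0)
qed

lemma phi_wt_involution: "phi_wt D (phi_wt D \<mu>) = \<mu>"
proof -
  have c: "(- \<nu>) \<circ> \<tau> = - (\<nu> \<circ> \<tau>)" for \<nu> :: "'i wt" by auto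
  show ?thesis unfolding phi_wt_def w_comp_tau c w_uminus by (simp add: w_involution)
qed

lemma phi_wt_alt: "phi_wt D \<mu> = - (w \<mu> \<circ> \<tau>)"
  by (simp add: phi_wt_def w_comp_tau)

lemma phi_wt_add: "phi_wt D (\<mu> + \<nu>) = phi_wt D \<mu> + phi_wt D \<nu>"
proof -
  have c: "((\<mu> + \<nu>) \<circ> \<tau>) = (\<mu> \<circ> \<tau>) + (\<nu> \<circ> \<tau>)" by auto
  show ?thesis unfolding phi_wt_def c foldr_refl_add by simp
qed

lemma phi_wt_inject: "phi_wt D \<mu> = phi_wt D \<nu> \<longleftrightarrow> \<mu> = \<nu>"
  using phi_wt_involution by metis

lemma comp_tau_wt_lattice: "\<nu> \<in> wt_lattice D \<Longrightarrow> (\<nu> \<circ> \<tau>) \<in> wt_lattice D"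
  by (auto simp: wt_lattice_def pair_comp_tau scoroot_comp_tau)

lemma phi_wt_lattice: "\<nu> \<in> wt_lattice D \<Longrightarrow> phi_wt D \<nu> \<in> wt_lattice D"
  using foldr_refl_wt_lattice[OF comp_tau_wt_lattice, of \<nu> "wX D"]
  by (simp add: phi_wt_def wt_lattice_def pair_linear)

lemma phi_wt_on_X:
  assumes "\<And>j. j \<notin> Xset D \<Longrightarrow> \<nu> j = 0" shows "phi_wt D \<nu> = \<nu>"
  using w_on_X[of "(\<nu> \<circ> \<tau>)"] assms by (simp add: phi_wt_def tau_X)

lemma phi_wt_outside: "j \<notin> Xset D \<Longrightarrow> phi_wt D \<nu> j = - \<nu> (\<tau> j)"
  by (simp add: phi_wt_def w_outside)

lemma pair_phi_wt_X:
  assumes "i \<in> Xset D" shows "pair D (phi_wt D \<nu>) (scoroot i) = pair D \<nu> (scoroot i)"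
  using pair_w[OF assms, of "(\<nu> \<circ> \<tau>)"] tau_X assms
  by (simp add: phi_wt_def pair_linear pair_comp_tau scoroot_comp_tau)

text \<open>The grading that no operator in the transfer trace lowers; it vanishes on the span of \<open>X\<close>.\<close>
definition ht :: "'i wt \<Rightarrow> rat" where "ht \<nu> = (\<Sum>i\<in>- Xset D. \<nu> i)"

lemma ht_add: "ht (\<nu> + \<mu>) = ht \<nu> + ht \<mu>" by (simp add: ht_def sum.distrib)
lemma ht_diff: "ht (\<nu> - \<mu>) = ht \<nu> - ht \<mu>" by (simp add: ht_def sum_subtractf)

text \<open>Outside \<open>X\<close> the coordinates of a weight are not changed by \<open>w\<close>, so \<open>\<phi>\<close> acts on them as \<open>- \<tau>\<close>.\<close>
lemma ht_phi_wt: "ht (phi_wt D \<nu>) = - ht \<nu>"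
proof -
  have "ht (phi_wt D \<nu>) = - (\<Sum>i\<in>- Xset D. \<nu> (\<tau> i))"
    by (simp add: ht_def phi_wt_outside sum_negf)
  also have "(\<Sum>i\<in>- Xset D. \<nu> (\<tau> i)) = (\<Sum>i\<in>- Xset D. \<nu> i)"
    by (rule sum.reindex_bij_witness[of _ \<tau> \<tau>]) (auto simp: tau_X)
  finally show ?thesis by (simp add: ht_def)
qed

lemma pos_lattice_nonneg: "\<nu> \<in> pos_lattice \<Longrightarrow> \<nu> i \<ge> 0"
  unfolding pos_lattice_def by (auto elim!: Nats_cases dest: spec[of _ i])

lemma ht_nonneg: "\<nu> \<in> pos_lattice \<Longrightarrow> ht \<nu> \<ge> 0"
  unfolding ht_def by (rule sum_nonneg) (rule pos_lattice_nonneg)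

lemma ht_eq_0:
  assumes "\<nu> \<in> pos_lattice" "ht \<nu> = 0" "j \<notin> Xset D" shows "\<nu> j = 0"
  using assms sum_nonneg_eq_0_iff[of "- Xset D" \<nu>] by (auto simp: ht_def pos_lattice_nonneg)

end

section \<open>Relations in the quantum group\<close>

lemma free_eval_superset:
  assumes "is_algebra s" "finite A" "Poly_Mapping.keys p \<subseteq> A"
  shows "free_eval s v p = (\<Sum>w\<in>A. s (Poly_Mapping.lookup p w) * prod_list (map v (letters w)))"
  unfolding free_eval_def
  by (rule sum.mono_neutral_left)
    (use assms in \<open>auto simp: in_keys_iff scal_simps(2)[OF assms(1)]\<close>)

lemma free_eval_diff:
  assumes "is_algebra s"
  shows "free_eval s v (p - q) = free_eval s v p - free_eval s v q"
proof -
  let ?A = "Poly_Mapping.keys p \<union> Poly_Mapping.keys q"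
  have f: "finite ?A" by simp
  have k: "Poly_Mapping.keys (p - q) \<subseteq> ?A" by (rule keys_diff)
  have "Poly_Mapping.keys p \<subseteq> ?A" "Poly_Mapping.keys q \<subseteq> ?A" by auto
  then have "free_eval s v p = (\<Sum>w\<in>?A. s (Poly_Mapping.lookup p w) * prod_list (map v (letters w)))"
    "free_eval s v q = (\<Sum>w\<in>?A. s (Poly_Mapping.lookup q w) * prod_list (map v (letters w)))"
    by (simp_all add: free_eval_superset[OF assms f])
  then show ?thesis
    unfolding free_eval_superset[OF assms f k]
    by (simp add: lookup_minus scal_simps(6)[OF assms] left_diff_distrib sum_subtractf)
qed

lemma free_eval_single:
  assumes "is_algebra s"
  shows "free_eval s v (Poly_Mapping.single w c) = s c * prod_list (map v (letters w))"
  using free_eval_superset[OF assms, of "{w}" "Poly_Mapping.single w c" v] by simp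

lemma qgroup_algebra:
  assumes "quantum_group D" shows "is_algebra (scal D)"
  using assms by (simp add: quantum_group_def)

lemma qgroup_simple:
  assumes "quantum_group D" shows "simple_cartan_datum D"
  using assms by (simp add: quantum_group_def)

text \<open>All defining relations used below equate two scalar multiples of monomials.\<close>
lemma binomial_relation:
  fixes D :: "('a::finite, 'u::ring_1, 'z) qgroup_scheme"
  assumes "quantum_group D"
    and "Poly_Mapping.single (Word u) c - Poly_Mapping.single (Word u') c' \<in> uqP_rels D"
    and "set u \<union> set u' \<subseteq> range GE \<union> range GF \<union> range GK \<union> GL ` wt_lattice D"
  shows "scal D c * prod_list (map (gen_val D) u) = scal D c' * prod_list (map (gen_val D) u')"
proof -
  let ?G = "range GE \<union> range GF \<union> range GK \<union> GL ` wt_lattice D"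
  let ?r = "Poly_Mapping.single (Word u) c - Poly_Mapping.single (Word u') c'"
  note alg = qgroup_algebra[OF assms(1)]
  have "Poly_Mapping.keys ?r \<subseteq> {Word u, Word u'}"
  proof (rule subset_trans[OF keys_diff])
    have "Poly_Mapping.keys (Poly_Mapping.single w d) \<subseteq> {w}" for w :: "'a gen word" and d :: ff
      by (cases "d = 0") simp_all
    from this[of "Word u" c] this[of "Word u'" c']
    show "Poly_Mapping.keys (Poly_Mapping.single (Word u) c) \<union> Poly_Mapping.keys (Poly_Mapping.single (Word u') c')
      \<subseteq> {Word u, Word u'}" by blast
  qed
  then have "letters w = u \<or> letters w = u'" if "w \<in> Poly_Mapping.keys ?r" for w
    using that by auto
  then have "?r \<in> free_alg_on ?G" using assms(3) unfolding free_alg_on_def by blast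
  moreover have "?r \<in> two_sided_ideal (uqP_rels D)"
    using two_sided_ideal.step[OF assms(2) two_sided_ideal.zero, of 1 1] by simp
  moreover have "presented_by (scal D) (gen_val D) ?G (uqP_rels D) UNIV"
    using assms(1) unfolding quantum_group_def by (elim conjE)
  ultimately have "free_eval (scal D) (gen_val D) ?r = 0"
    unfolding presented_by_def by (elim conjE) (drule bspec, assumption, simp)
  then show ?thesis by (simp add: free_eval_diff[OF alg] free_eval_single[OF alg])
qed

lemma fgen_mult: "fgen g * fgen g' = Poly_Mapping.single (Word [g, g']) 1"
  by (simp add: fgen_def mult_single plus_word_def)

lemma fconst_fgen_mult: "fconst c * fgen g * fgen g' = Poly_Mapping.single (Word [g, g']) c"
  by (simp add: fgen_def fconst_def mult_single plus_word_def zero_word_def)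

lemma one_single: "(1 :: 'g free_alg) = Poly_Mapping.single (Word []) 1"
  by (simp add: zero_word_def flip: single_one)

lemmas fgen_simps = fgen_mult fconst_fgen_mult one_single

lemma uq_rels_subset: "uq_rels D \<subseteq> uqP_rels D"
proof
  fix x assume x: "x \<in> uq_rels D"
  show "x \<in> uqP_rels D"
    unfolding uqP_rels_def Let_def
    by (rule UnI1, rule UnI1, rule UnI1, rule UnI1, rule UnI1, rule UnI1, rule x)
qed

context
  fixes D :: "('i::finite, 'u::ring_1, 'z) qgroup_scheme"
  assumes qg: "quantum_group D"
begin

(* In the next proofs, the chain of UnI1 and UnI2 selects one family in the union of all relators. *)

lemmas rel_simps = gen_val.simps list.map prod_list.Cons prod_list.Nil mult_1_left mult_1_right
  scal_simps(1)[OF qgroup_algebra[OF qg]]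

lemma Kg_add: "Kg D h * Kg D h' = Kg D (h + h')"
proof -
  have "fgen (GK h) * fgen (GK h') - fgen (GK (h + h')) \<in> uq_rels D"
    unfolding uq_rels_def Let_def
    by (rule UnI1, rule UnI1, rule UnI1, rule UnI1, rule UnI1, rule UnI1, rule UnI1, rule CollectI, intro exI conjI TrueI, rule refl)
  note rel = binomial_relation[OF qg subsetD[OF uq_rels_subset this, unfolded fgen_simps, unfolded fgen_def]]
  have "set [GK h, GK h'] \<union> set [GK (h + h')] \<subseteq> range GE \<union> range GF \<union> range GK \<union> GL ` wt_lattice D" by simp
  from rel[OF this] show ?thesis by (simp only: rel_simps)
qed

lemma Kg_0: "Kg D 0 = 1"
proof -
  have "fgen (GK 0) - 1 \<in> uq_rels D" unfolding uq_rels_def Let_def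
    by (rule UnI1, rule UnI1, rule UnI1, rule UnI1, rule UnI1, rule UnI1, rule UnI2, rule singletonI)
  note rel = binomial_relation[OF qg subsetD[OF uq_rels_subset this, unfolded fgen_simps, unfolded fgen_def]]
  have "set [GK 0] \<union> set [] \<subseteq> range GE \<union> range GF \<union> range GK \<union> GL ` wt_lattice D" by simp
  from rel[OF this] show ?thesis by (simp only: rel_simps)
qed

lemma Kg_Eg: "Kg D h * Eg D i = scal D (qpow D (pair D (sroot i) h)) * (Eg D i * Kg D h)"
proof -
  have "fgen (GK h) * fgen (GE i) - fconst (qpow D (pair D (sroot i) h)) * fgen (GE i) * fgen (GK h) \<in> uq_rels D"
    unfolding uq_rels_def Let_def
    by (rule UnI1, rule UnI1, rule UnI1, rule UnI1, rule UnI1, rule UnI2, rule CollectI, intro exI conjI TrueI, rule refl)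
  note rel = binomial_relation[OF qg subsetD[OF uq_rels_subset this, unfolded fgen_simps, unfolded fgen_def]]
  have "set [GK h, GE i] \<union> set [GE i, GK h] \<subseteq> range GE \<union> range GF \<union> range GK \<union> GL ` wt_lattice D" by simp
  from rel[OF this] show ?thesis by (simp only: rel_simps)
qed

lemma Kg_Fg: "Kg D h * Fg D i = scal D (qpow D (- pair D (sroot i) h)) * (Fg D i * Kg D h)"
proof -
  have "fgen (GK h) * fgen (GF i) - fconst (qpow D (- pair D (sroot i) h)) * fgen (GF i) * fgen (GK h) \<in> uq_rels D"
    unfolding uq_rels_def Let_def
    by (rule UnI1, rule UnI1, rule UnI1, rule UnI1, rule UnI2, rule CollectI, intro exI conjI TrueI, rule refl)
  note rel = binomial_relation[OF qg subsetD[OF uq_rels_subset this, unfolded fgen_simps, unfolded fgen_def]]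
  have "set [GK h, GF i] \<union> set [GF i, GK h] \<subseteq> range GE \<union> range GF \<union> range GK \<union> GL ` wt_lattice D" by simp
  from rel[OF this] show ?thesis by (simp only: rel_simps)
qed

lemma Kw_add:
  assumes "\<nu> \<in> wt_lattice D" "\<mu> \<in> wt_lattice D"
  shows "Kw D \<nu> * Kw D \<mu> = Kw D (\<nu> + \<mu>)"
proof -
  have "fgen (GL \<nu>) * fgen (GL \<mu>) - fgen (GL (\<nu> + \<mu>)) \<in> uqP_rels D"
    unfolding uqP_rels_def Let_def
    by (rule UnI1, rule UnI1, rule UnI1, rule UnI1, rule UnI1, rule UnI2, rule CollectI, intro exI conjI, rule refl, (rule assms)+)
  note rel = this[unfolded fgen_simps, unfolded fgen_def]
  have "\<nu> + \<mu> \<in> wt_lattice D" using assms by (simp add: wt_lattice_def pair_linear)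
  with assms have "set [GL \<nu>, GL \<mu>] \<union> set [GL (\<nu> + \<mu>)]
      \<subseteq> range GE \<union> range GF \<union> range GK \<union> GL ` wt_lattice D" by simp
  from binomial_relation[OF qg rel this] show ?thesis by (simp only: rel_simps)
qed

lemma Kw_Eg:
  assumes "\<nu> \<in> wt_lattice D"
  shows "Kw D \<nu> * Eg D i = scal D (qpow D (form D \<nu> (sroot i))) * (Eg D i * Kw D \<nu>)"
proof -
  have "fgen (GL \<nu>) * fgen (GE i) - fconst (qpow D (form D \<nu> (sroot i))) * fgen (GE i) * fgen (GL \<nu>) \<in> uqP_rels D"
    unfolding uqP_rels_def Let_def
    by (rule UnI1, rule UnI1, rule UnI2, rule CollectI, intro exI conjI, rule refl, (rule assms)+)
  note rel = binomial_relation[OF qg this[unfolded fgen_simps]]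
  have "set [GL \<nu>, GE i] \<union> set [GE i, GL \<nu>] \<subseteq> range GE \<union> range GF \<union> range GK \<union> GL ` wt_lattice D" using assms by simp
  from rel[OF this] show ?thesis by (simp only: rel_simps)
qed

lemma Kw_Fg:
  assumes "\<nu> \<in> wt_lattice D"
  shows "Kw D \<nu> * Fg D i = scal D (qpow D (- form D \<nu> (sroot i))) * (Fg D i * Kw D \<nu>)"
proof -
  have "fgen (GL \<nu>) * fgen (GF i) - fconst (qpow D (- form D \<nu> (sroot i))) * fgen (GF i) * fgen (GL \<nu>) \<in> uqP_rels D"
    unfolding uqP_rels_def Let_def
    by (rule UnI1, rule UnI2, rule CollectI, intro exI conjI, rule refl, (rule assms)+)
  note rel = binomial_relation[OF qg this[unfolded fgen_simps]]
  have "set [GL \<nu>, GF i] \<union> set [GF i, GL \<nu>] \<subseteq> range GE \<union> range GF \<union> range GK \<union> GL ` wt_lattice D" using assms by simp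
  from rel[OF this] show ?thesis by (simp only: rel_simps)
qed

end

section \<open>Finite-dimensional modules as sums of weight spaces\<close>

lemma mat_mult_entry:
  assumes "A \<in> carrier_mat n m" "B \<in> carrier_mat m k" "i < n" "j < k"
  shows "(A * B) $$ (i, j) = (\<Sum>l<m. A $$ (i, l) * B $$ (l, j))"
proof -
  have "(A * B) $$ (i, j) = (\<Sum>l = 0..<m. A $$ (i, l) * B $$ (l, j))"
    using assms by (simp add: scalar_prod_def)
  then show ?thesis by (simp add: atLeast0LessThan)
qed

lemma mat_vec_entry:
  assumes "A \<in> carrier_mat n m" "v \<in> carrier_vec m" "i < n"
  shows "(A *\<^sub>v v) $ i = (\<Sum>l<m. A $$ (i, l) * v $ l)"
proof -
  have "(A *\<^sub>v v) $ i = (\<Sum>l = 0..<m. A $$ (i, l) * v $ l)"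
    using assms by (simp add: scalar_prod_def)
  then show ?thesis by (simp add: atLeast0LessThan)
qed

lemma mat_trace_comm:
  fixes A B :: "'x::comm_semiring_0 mat"
  assumes "A \<in> carrier_mat n n" "B \<in> carrier_mat n n"
  shows "mat_trace (A * B) = mat_trace (B * A)"
proof -
  have "mat_trace (A * B) = (\<Sum>i<n. \<Sum>l<n. A $$ (i, l) * B $$ (l, i))"
    using assms by (auto simp: mat_trace_def mat_mult_entry[of A n n B n] intro!: sum.cong simp del: index_mult_mat(1))
  also have "\<dots> = (\<Sum>l<n. \<Sum>i<n. B $$ (l, i) * A $$ (i, l))"
    by (subst sum.swap) (simp add: mult.commute)
  also have "\<dots> = mat_trace (B * A)"
    using assms by (auto simp: mat_trace_def mat_mult_entry[of B n n A n] intro!: sum.cong simp del: index_mult_mat(1))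
  finally show ?thesis .
qed

lemma Uq_closed:
  "scal D c \<in> Uq D" "Kg D h \<in> Uq D" "Eg D i \<in> Uq D" "Fg D i \<in> Uq D"
  "x \<in> Uq D \<Longrightarrow> y \<in> Uq D \<Longrightarrow> x + y \<in> Uq D" "x \<in> Uq D \<Longrightarrow> y \<in> Uq D \<Longrightarrow> x * y \<in> Uq D"
  unfolding Uq_def by (auto intro: subalg.intros)

locale fd_module =
  fixes D :: "('i::finite, 'u::ring_1, 'z) qgroup_scheme" and V :: "'u qmod"
  assumes qg: "quantum_group D" and V: "V \<in> fdmod D"
begin

abbreviation "n \<equiv> vdim V"
abbreviation "Wt \<equiv> weights D V"
abbreviation "P \<equiv> wt_proj D V"

lemmas alg = qgroup_algebra[OF qg]

lemma rep: "is_rep D n (act V)" using V by (simp add: fdmod_def)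

lemma act_carrier [simp]: "x \<in> Uq D \<Longrightarrow> act V x \<in> carrier_mat n n"
  and act_scal: "act V (scal D c) = c \<cdot>\<^sub>m 1\<^sub>m n"
  and act_mult: "x \<in> Uq D \<Longrightarrow> y \<in> Uq D \<Longrightarrow> act V (x * y) = act V x * act V y"
  using rep by (auto simp: is_rep_def)

lemma act_K_carrier [simp]: "act V (Kg D h) \<in> carrier_mat n n"
  by (simp add: Uq_closed)

lemma act_one: "act V 1 = 1\<^sub>m n"
  using act_scal[of 1] by (auto simp: scal_simps(1)[OF alg] intro!: eq_matI)

lemma wt_space_carrier: "v \<in> wt_space D V \<mu> \<Longrightarrow> v \<in> carrier_vec n"
  by (simp add: wt_space_def)

lemma wt_space_zero: "0\<^sub>v n \<in> wt_space D V \<mu>"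
  by (auto simp: wt_space_def carrier_matD[OF act_K_carrier] intro!: eq_vecI)

lemma wt_space_entry:
  assumes "v \<in> wt_space D V \<mu>" "i < n"
  shows "(\<Sum>k<n. act V (Kg D h) $$ (i, k) * v $ k) = qpow D (pair D \<mu> h) * v $ i"
proof -
  have "(\<Sum>k<n. act V (Kg D h) $$ (i, k) * v $ k) = (act V (Kg D h) *\<^sub>v v) $ i"
    using assms by (simp add: mat_vec_entry[OF act_K_carrier wt_space_carrier] del: index_mult_mat_vec)
  also have "act V (Kg D h) *\<^sub>v v = qpow D (pair D \<mu> h) \<cdot>\<^sub>v v" using assms by (simp add: wt_space_def)
  finally show ?thesis using assms wt_space_carrier[OF assms(1)] by simp
qed

lemma wt_space_combination:
  assumes "\<And>j. j \<in> J \<Longrightarrow> u j \<in> wt_space D V \<mu>"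
  shows "vec n (\<lambda>i. \<Sum>j\<in>J. c j * u j $ i) \<in> wt_space D V \<mu>" (is "?v \<in> _")
proof -
  have "(act V (Kg D h) *\<^sub>v ?v) $ i = (qpow D (pair D \<mu> h) \<cdot>\<^sub>v ?v) $ i" if i: "i < n" for h i
  proof -
    have "(act V (Kg D h) *\<^sub>v ?v) $ i = (\<Sum>k<n. act V (Kg D h) $$ (i, k) * (\<Sum>j\<in>J. c j * u j $ k))"
      using i mat_vec_entry[OF act_K_carrier, of ?v i h] by simp
    also have "\<dots> = (\<Sum>j\<in>J. c j * (\<Sum>k<n. act V (Kg D h) $$ (i, k) * u j $ k))"
      unfolding sum_distrib_left by (subst sum.swap) (simp add: mult.left_commute)
    also have "\<dots> = (\<Sum>j\<in>J. c j * (qpow D (pair D \<mu> h) * u j $ i))"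
      by (rule sum.cong) (simp_all add: wt_space_entry[OF assms i])
    finally show ?thesis using i by (simp add: sum_distrib_left mult.left_commute)
  qed
  then show ?thesis unfolding wt_space_def by (auto intro!: eq_vecI simp: carrier_matD[OF act_K_carrier])
qed

text \<open>Applying \<open>k\<^sub>h\<close> to the relation and reading off one coordinate gives a relation between characters.\<close>
lemma weight_vectors_independent:
  assumes "finite S" "\<And>\<mu>. \<mu> \<in> S \<Longrightarrow> y \<mu> \<in> wt_space D V \<mu>"
    and "\<And>i. i < n \<Longrightarrow> (\<Sum>\<mu>\<in>S. y \<mu> $ i) = 0" "\<nu> \<in> S"
  shows "y \<nu> = 0\<^sub>v n"
proof (rule eq_vecI)
  fix i assume "i < dim_vec (0\<^sub>v n :: ff vec)"
  then have i: "i < n" by simp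
  have "(\<Sum>\<mu>\<in>S. qpow D (pair D \<mu> h) * y \<mu> $ i) = 0" for h
  proof -
    have "(\<Sum>\<mu>\<in>S. qpow D (pair D \<mu> h) * y \<mu> $ i)
        = (\<Sum>\<mu>\<in>S. \<Sum>k<n. act V (Kg D h) $$ (i, k) * y \<mu> $ k)"
      by (rule sum.cong) (simp_all add: wt_space_entry[OF assms(2) i])
    also have "\<dots> = (\<Sum>k<n. act V (Kg D h) $$ (i, k) * (\<Sum>\<mu>\<in>S. y \<mu> $ k))"
      unfolding sum_distrib_left by (rule sum.swap)
    finally show ?thesis using assms(3) by simp
  qed
  from weights_independent[OF qg is_algebra_id assms(1) this assms(4)]
  show "y \<nu> $ i = 0\<^sub>v n $ i" using i by simp
qed (use wt_space_carrier[OF assms(2)[OF assms(4)]] in simp)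

text \<open>Weight components \<open>U j \<mu>\<close> of all standard basis vectors, with one finite set \<open>S\<close> of weights; outside \<open>S\<close>
  they are set to zero so that sums over larger sets of weights may be used.\<close>
lemma weight_decomposition:
  obtains S U where "finite S" "S \<subseteq> wt_lattice D" "\<And>j \<mu>. j < n \<Longrightarrow> U j \<mu> \<in> wt_space D V \<mu>"
    "\<And>j \<mu>. j < n \<Longrightarrow> \<mu> \<notin> S \<Longrightarrow> U j \<mu> = 0\<^sub>v n"
    "\<And>i j. i < n \<Longrightarrow> j < n \<Longrightarrow> (\<Sum>\<mu>\<in>S. U j \<mu> $ i) = (if i = j then 1 else 0)"
proof -
  have "\<forall>j. \<exists>S w. j < n \<longrightarrow> finite S \<and> S \<subseteq> wt_lattice D \<and> (\<forall>\<mu>\<in>S. w \<mu> \<in> wt_space D V \<mu>) \<and>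
      (\<forall>i<n. unit_vec n j $ i = (\<Sum>\<mu>\<in>S. w \<mu> $ i))"
    using V unit_vec_carrier unfolding fdmod_def by blast
  then obtain S w where Sw: "\<And>j. j < n \<Longrightarrow> finite (S j) \<and> S j \<subseteq> wt_lattice D \<and>
      (\<forall>\<mu>\<in>S j. w j \<mu> \<in> wt_space D V \<mu>) \<and> (\<forall>i<n. unit_vec n j $ i = (\<Sum>\<mu>\<in>S j. w j \<mu> $ i))"
    by metis
  define U where "U j \<mu> = (if \<mu> \<in> S j then w j \<mu> else 0\<^sub>v n)" for j \<mu>
  have 1: "finite (\<Union>j<n. S j)" "(\<Union>j<n. S j) \<subseteq> wt_lattice D"
    "\<And>j \<mu>. j < n \<Longrightarrow> U j \<mu> \<in> wt_space D V \<mu>"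
    "\<And>j \<mu>. j < n \<Longrightarrow> \<mu> \<notin> (\<Union>j<n. S j) \<Longrightarrow> U j \<mu> = 0\<^sub>v n"
    using Sw by (auto simp: U_def wt_space_zero)
  have 2: "(\<Sum>\<mu>\<in>(\<Union>j<n. S j). U j \<mu> $ i) = (if i = j then 1 else 0)" if "i < n" "j < n" for i j
  proof -
    have "(\<Sum>\<mu>\<in>(\<Union>j<n. S j). U j \<mu> $ i) = (\<Sum>\<mu>\<in>S j. w j \<mu> $ i)"
      by (rule sum.mono_neutral_cong_right) (use 1(1) that in \<open>auto simp: U_def\<close>)
    also have "\<dots> = unit_vec n j $ i" using Sw that by auto
    finally show ?thesis using that by simp
  qed
  show ?thesis by (rule that[OF 1 2])
qed

text \<open>The module is the direct sum of its weight spaces, so an operator may be prescribed on each of them, and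
  only finitely many of them are non-zero.\<close>
lemma wt_op_unique_exists:
  "\<exists>!M. M \<in> carrier_mat n n \<and> (\<forall>\<mu>\<in>wt_lattice D. \<forall>v\<in>wt_space D V \<mu>. M *\<^sub>v v = f \<mu> \<cdot>\<^sub>v v)"
  and mat_eqI_weights: "\<lbrakk>A \<in> carrier_mat n n; B \<in> carrier_mat n n;
    \<And>\<mu> v. \<mu> \<in> wt_lattice D \<Longrightarrow> v \<in> wt_space D V \<mu> \<Longrightarrow> A *\<^sub>v v = B *\<^sub>v v\<rbrakk> \<Longrightarrow> A = B"
  and finite_weights: "finite (weights D V)"
proof -
  obtain S U where S: "finite S" "S \<subseteq> wt_lattice D"
    and U: "\<And>j \<mu>. j < n \<Longrightarrow> U j \<mu> \<in> wt_space D V \<mu>"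
      "\<And>j \<mu>. j < n \<Longrightarrow> \<mu> \<notin> S \<Longrightarrow> U j \<mu> = 0\<^sub>v n"
      "\<And>i j. i < n \<Longrightarrow> j < n \<Longrightarrow> (\<Sum>\<mu>\<in>S. U j \<mu> $ i) = (if i = j then 1 else 0)"
    using weight_decomposition by blast
  \<comment> \<open>The components \<open>U\<close>, extended linearly, give the components of every vector.\<close>
  have comp: "(\<Sum>j<n. v $ j * U j \<mu> $ i) = (if \<mu> = \<nu> then v $ i else 0)"
    if v: "v \<in> wt_space D V \<nu>" and i: "i < n" for v \<mu> \<nu> i
  proof -
    define y where "y \<mu> = vec n (\<lambda>i. (\<Sum>j<n. v $ j * U j \<mu> $ i))" for \<mu>
    have y: "y \<mu> \<in> wt_space D V \<mu>" for \<mu> unfolding y_def by (rule wt_space_combination) (use U in auto)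
    \<comment> \<open>\<open>z \<mu>\<close> is the computed component minus the expected one, written as a linear combination of weight vectors.\<close>
    define z where "z \<mu> = vec n (\<lambda>i. \<Sum>b\<in>UNIV. (if b then 1 else - 1) * (if b then y \<mu> else if \<mu> = \<nu> then v else 0\<^sub>v n) $ i)" for \<mu>
    have z: "z \<mu> \<in> wt_space D V \<mu>" for \<mu>
      unfolding z_def by (rule wt_space_combination) (use y v wt_space_zero in auto)
    have z_entry: "z \<mu> $ i = y \<mu> $ i - (if \<mu> = \<nu> then v $ i else 0)" if "i < n" for \<mu> i
      using that by (simp add: z_def UNIV_bool)
    have ysum: "(\<Sum>\<mu>\<in>insert \<mu> (insert \<nu> S). y \<mu> $ i) = v $ i" if i: "i < n" for \<mu> i
    proof -
      have "(\<Sum>\<mu>\<in>insert \<mu> (insert \<nu> S). y \<mu> $ i) = (\<Sum>\<mu>\<in>S. y \<mu> $ i)"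
        by (rule sum.mono_neutral_right) (use S U(2) i in \<open>auto simp: y_def\<close>)
      also have "\<dots> = (\<Sum>j<n. v $ j * (\<Sum>\<mu>\<in>S. U j \<mu> $ i))"
        unfolding sum_distrib_left using i by (simp add: y_def) (rule sum.swap)
      also have "\<dots> = (\<Sum>j<n. if j = i then v $ i else 0)"
        by (rule sum.cong) (use U(3)[OF i] in auto)
      finally show ?thesis using i by simp
    qed
    have "z \<mu> = 0\<^sub>v n"
    proof (rule weight_vectors_independent[of "insert \<mu> (insert \<nu> S)"])
      fix i assume i: "i < n"
      have "(\<Sum>\<mu>\<in>insert \<mu> (insert \<nu> S). z \<mu> $ i) = v $ i - (\<Sum>\<mu>\<in>insert \<mu> (insert \<nu> S). if \<mu> = \<nu> then v $ i else 0)"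
        unfolding z_entry[OF i] sum_subtractf ysum[OF i] ..
      then show "(\<Sum>\<mu>\<in>insert \<mu> (insert \<nu> S). z \<mu> $ i) = 0"
        using S(1) by (subst (asm) sum.delta) auto
    qed (use S z in auto)
    then have "z \<mu> $ i = 0" using i by simp
    then show ?thesis using z_entry[OF i, of \<mu>] i by (simp add: y_def)
  qed
  show uniq: "A = B" if AB: "A \<in> carrier_mat n n" "B \<in> carrier_mat n n"
    "\<And>\<mu> v. \<mu> \<in> wt_lattice D \<Longrightarrow> v \<in> wt_space D V \<mu> \<Longrightarrow> A *\<^sub>v v = B *\<^sub>v v" for A B
  proof (rule eq_matI)
    fix i j assume "i < dim_row B" "j < dim_col B"
    then have ij: "i < n" "j < n" using AB by auto
    have *: "M $$ (i, j) = (\<Sum>\<mu>\<in>S. (M *\<^sub>v U j \<mu>) $ i)" if M: "M \<in> carrier_mat n n" for M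
    proof -
      have "(\<Sum>\<mu>\<in>S. (M *\<^sub>v U j \<mu>) $ i) = (\<Sum>\<mu>\<in>S. \<Sum>k<n. M $$ (i, k) * U j \<mu> $ k)"
        by (rule sum.cong[OF refl], rule mat_vec_entry[OF M wt_space_carrier[OF U(1)] ij(1)]) (rule ij(2))
      also have "\<dots> = (\<Sum>k<n. M $$ (i, k) * (\<Sum>\<mu>\<in>S. U j \<mu> $ k))"
        unfolding sum_distrib_left by (rule sum.swap)
      also have "\<dots> = (\<Sum>k<n. if k = j then M $$ (i, j) else 0)"
        by (rule sum.cong) (use U(3) ij in auto)
      finally show ?thesis using ij by simp
    qed
    have "A *\<^sub>v U j \<mu> = B *\<^sub>v U j \<mu>" if "\<mu> \<in> S" for \<mu> using AB(3) U(1)[OF ij(2)] S(2) that by blast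
    then show "A $$ (i, j) = B $$ (i, j)" unfolding *[OF AB(1)] *[OF AB(2)] by simp
  qed (use AB in auto)
  show "finite (weights D V)"
  proof (rule finite_subset[OF _ S(1)], rule subsetI, rule ccontr)
    fix \<mu> assume "\<mu> \<in> weights D V" "\<mu> \<notin> S"
    then obtain v where v: "v \<in> wt_space D V \<mu>" "v \<noteq> 0\<^sub>v n" by (auto simp: weights_def)
    have "v $ i = 0" if "i < n" for i
      using comp[OF v(1) that, of \<mu>] U(2)[OF _ \<open>\<mu> \<notin> S\<close>] that by simp
    then have "v = 0\<^sub>v n" using wt_space_carrier[OF v(1)] by (auto intro!: eq_vecI)
    then show False using v by simp
  qed
  define M where "M = mat n n (\<lambda>(i, j). \<Sum>\<mu>\<in>S. f \<mu> * U j \<mu> $ i)"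
  have M: "M \<in> carrier_mat n n" by (simp add: M_def)
  have "M *\<^sub>v v = f \<nu> \<cdot>\<^sub>v v" if v: "v \<in> wt_space D V \<nu>" for \<nu> v
  proof (rule eq_vecI)
    note vc = wt_space_carrier[OF v]
    fix i assume "i < dim_vec (f \<nu> \<cdot>\<^sub>v v)"
    then have i: "i < n" using vc by simp
    have "(M *\<^sub>v v) $ i = (\<Sum>j<n. (\<Sum>\<mu>\<in>S. f \<mu> * U j \<mu> $ i) * v $ j)"
      using mat_vec_entry[OF M vc i] i by (simp add: M_def)
    also have "\<dots> = (\<Sum>\<mu>\<in>S. f \<mu> * (\<Sum>j<n. v $ j * U j \<mu> $ i))"
      unfolding sum_distrib_left sum_distrib_right by (subst sum.swap) (simp add: ac_simps)
    also have "\<dots> = (\<Sum>\<mu>\<in>S. if \<mu> = \<nu> then f \<nu> * v $ i else 0)"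
      by (rule sum.cong) (simp_all add: comp[OF v i])
    also have "\<dots> = f \<nu> * v $ i"
    proof (cases "\<nu> \<in> S")
      case False
      then have "v $ i = 0" using comp[OF v i, of \<nu>] U(2) i by simp
      then show ?thesis by (auto intro!: sum.neutral)
    qed (use S(1) in simp)
    finally show "(M *\<^sub>v v) $ i = (f \<nu> \<cdot>\<^sub>v v) $ i" using i vc by simp
  qed (use M wt_space_carrier[OF v] in auto)
  then show "\<exists>!M. M \<in> carrier_mat n n \<and> (\<forall>\<mu>\<in>wt_lattice D. \<forall>v\<in>wt_space D V \<mu>. M *\<^sub>v v = f \<mu> \<cdot>\<^sub>v v)"
    using M by (intro ex1I[of _ M] uniq conjI) auto
qed

lemma wt_op_carrier [simp]: "wt_op D V f \<in> carrier_mat n n"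
  and wt_op_apply: "\<mu> \<in> wt_lattice D \<Longrightarrow> v \<in> wt_space D V \<mu> \<Longrightarrow> wt_op D V f *\<^sub>v v = f \<mu> \<cdot>\<^sub>v v"
  using theI'[OF wt_op_unique_exists[of f]] by (auto simp: wt_op_def)

end

section \<open>Blocks of operators with respect to the weight decomposition\<close>

text \<open>The entrywise convention in \<open>pos_sum\<close> only agrees with a sum of matrices when finitely many summands are
  non-zero; \<open>F\<close> is any finite set containing their indices.\<close>
lemma pos_sum_sandwich:
  fixes M :: "'i wt \<Rightarrow> ff mat"
  assumes L: "L \<in> carrier_mat m m" and Y: "Y \<in> carrier_mat m m"
    and M: "\<And>\<nu>. \<nu> \<in> pos_lattice \<Longrightarrow> M \<nu> \<in> carrier_mat m m"
    and fin: "finite F" "F \<subseteq> pos_lattice" "\<And>\<nu>. \<nu> \<in> pos_lattice \<Longrightarrow> \<nu> \<notin> F \<Longrightarrow> M \<nu> = 0\<^sub>m m m"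
    and ij: "i < m" "j < m"
  shows "(L * pos_sum m M * Y) $$ (i, j) = (\<Sum>\<nu>\<in>F. (L * M \<nu> * Y) $$ (i, j))"
proof -
  have entry: "(L * A * Y) $$ (i, j) = (\<Sum>l<m. (\<Sum>k<m. L $$ (i, k) * A $$ (k, l)) * Y $$ (l, j))"
    if A: "A \<in> carrier_mat m m" for A
    using L Y A ij by (simp add: mat_mult_entry[of "L * A" m m Y m] mat_mult_entry[of L m m A m]
        del: index_mult_mat(1) assoc_mult_mat)
  have pc: "pos_sum m M \<in> carrier_mat m m" by (simp add: pos_sum_def)
  have ps: "pos_sum m M $$ (k, l) = (\<Sum>\<nu>\<in>F. M \<nu> $$ (k, l))" if "k < m" "l < m" for k l
  proof -
    have "x \<in> F" if "x \<in> pos_lattice" "M x $$ (k, l) \<noteq> 0" for x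
      using fin(3)[of x] that \<open>k < m\<close> \<open>l < m\<close> by (cases "x \<in> F") auto
    then have "(\<Sum>\<nu> | \<nu> \<in> pos_lattice \<and> M \<nu> $$ (k, l) \<noteq> 0. M \<nu> $$ (k, l)) = (\<Sum>\<nu>\<in>F. M \<nu> $$ (k, l))"
      by (intro sum.mono_neutral_left) (use fin in auto)
    then show ?thesis using that by (simp add: pos_sum_def)
  qed
  have "(L * pos_sum m M * Y) $$ (i, j)
      = (\<Sum>l<m. (\<Sum>k<m. \<Sum>\<nu>\<in>F. L $$ (i, k) * M \<nu> $$ (k, l)) * Y $$ (l, j))"
    unfolding entry[OF pc] by (intro sum.cong refl) (simp add: ps sum_distrib_left)
  also have "\<dots> = (\<Sum>\<nu>\<in>F. \<Sum>l<m. (\<Sum>k<m. L $$ (i, k) * M \<nu> $$ (k, l)) * Y $$ (l, j))"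
    unfolding sum_distrib_right
    by (subst sum.swap[of _ F]) (intro sum.cong[OF refl] sum.swap)
  also have "\<dots> = (\<Sum>\<nu>\<in>F. (L * M \<nu> * Y) $$ (i, j))"
    by (rule sum.cong) (use fin(2) M in \<open>auto simp: entry\<close>)
  finally show ?thesis .
qed

context fd_module
begin

definition acts_diagonally :: "ff mat \<Rightarrow> ('i wt \<Rightarrow> ff) \<Rightarrow> bool" where
  "acts_diagonally M c \<longleftrightarrow> M \<in> carrier_mat n n \<and>
     (\<forall>\<mu>\<in>wt_lattice D. \<forall>v\<in>wt_space D V \<mu>. M *\<^sub>v v = c \<mu> \<cdot>\<^sub>v v)"

lemma wt_op_diagonal: "acts_diagonally (wt_op D V f) f"
  by (simp add: acts_diagonally_def wt_op_apply)

lemma acts_diagonally_unique: "acts_diagonally M c \<Longrightarrow> acts_diagonally N c \<Longrightarrow> M = N"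
  by (rule mat_eqI_weights) (auto simp: acts_diagonally_def)

lemma acts_diagonally_mult:
  assumes "acts_diagonally M c" "acts_diagonally N d"
  shows "acts_diagonally (M * N) (\<lambda>\<mu>. c \<mu> * d \<mu>)"
  unfolding acts_diagonally_def
proof (intro conjI ballI)
  fix \<mu> v assume v: "\<mu> \<in> wt_lattice D" "v \<in> wt_space D V \<mu>"
  have M: "M \<in> carrier_mat n n" and N: "N \<in> carrier_mat n n"
    and Mv: "M *\<^sub>v v = c \<mu> \<cdot>\<^sub>v v" and Nv: "N *\<^sub>v v = d \<mu> \<cdot>\<^sub>v v"
    using assms v by (auto simp: acts_diagonally_def)
  note vc = wt_space_carrier[OF v(2)]
  show "M * N *\<^sub>v v = (c \<mu> * d \<mu>) \<cdot>\<^sub>v v"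
    unfolding assoc_mult_mat_vec[OF M N vc] Nv mult_mat_vec[OF M vc] Mv smult_smult_assoc
    by (simp add: mult.commute)
qed (use assms in \<open>auto simp: acts_diagonally_def\<close>)

lemma acts_diagonally_one: "acts_diagonally (1\<^sub>m n) (\<lambda>_. 1)"
  using wt_space_carrier by (auto simp: acts_diagonally_def)

lemma acts_diagonally_smult:
  assumes "acts_diagonally M c" shows "acts_diagonally (a \<cdot>\<^sub>m M) (\<lambda>\<mu>. a * c \<mu>)"
  unfolding acts_diagonally_def
proof (intro conjI ballI)
  fix \<mu> v assume v: "\<mu> \<in> wt_lattice D" "v \<in> wt_space D V \<mu>"
  have M: "M \<in> carrier_mat n n" and Mv: "M *\<^sub>v v = c \<mu> \<cdot>\<^sub>v v"
    using assms v by (auto simp: acts_diagonally_def)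
  note vc = wt_space_carrier[OF v(2)]
  have "a \<cdot>\<^sub>m M *\<^sub>v v = a \<cdot>\<^sub>v (M *\<^sub>v v)" using M vc by (auto intro!: eq_vecI)
  then show "a \<cdot>\<^sub>m M *\<^sub>v v = (a * c \<mu>) \<cdot>\<^sub>v v" by (simp add: Mv smult_smult_assoc)
qed (use assms in \<open>auto simp: acts_diagonally_def\<close>)

lemma P_diagonal: "acts_diagonally (P \<kappa>) (\<lambda>\<mu>. if \<mu> = \<kappa> then 1 else 0)"
  unfolding wt_proj_def by (rule wt_op_diagonal)

lemma P_carrier [simp]: "P \<kappa> \<in> carrier_mat n n"
  unfolding wt_proj_def by simp

lemma P_dim [simp]: "dim_row (P \<kappa>) = n" "dim_col (P \<kappa>) = n"
  using P_carrier[of \<kappa>] by (auto simp del: P_carrier)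

lemmas square_mult = mult_carrier_mat[of _ n n _ n] left_mult_one_mat[of _ n n]
  right_mult_one_mat[of _ n n] left_mult_zero_mat[of _ n n n] right_mult_zero_mat[of _ n n n]
  assoc_mult_mat[of _ n n _ n _ n] mult_smult_distrib[of _ n n _ n] mult_smult_assoc_mat[of _ n n _ n]

lemma K_diagonal: "acts_diagonally (act V (Kg D h)) (\<lambda>\<mu>. qpow D (pair D \<mu> h))"
  by (simp add: acts_diagonally_def wt_space_def)

lemma diagonal_P:
  assumes "acts_diagonally M c"
  shows "M * P \<kappa> = c \<kappa> \<cdot>\<^sub>m P \<kappa>" and "P \<kappa> * M = c \<kappa> \<cdot>\<^sub>m P \<kappa>"
proof -
  have f: "(\<lambda>\<mu>. c \<mu> * (if \<mu> = \<kappa> then 1 else 0)) = (\<lambda>\<mu>. c \<kappa> * (if \<mu> = \<kappa> then 1 else 0))"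
    "(\<lambda>\<mu>. (if \<mu> = \<kappa> then 1 else 0) * c \<mu>) = (\<lambda>\<mu>. c \<kappa> * (if \<mu> = \<kappa> then 1 else 0))" by auto
  note r = acts_diagonally_smult[OF P_diagonal[of \<kappa>], of "c \<kappa>"]
  show "M * P \<kappa> = c \<kappa> \<cdot>\<^sub>m P \<kappa>"
    using acts_diagonally_unique[OF acts_diagonally_mult[OF assms P_diagonal[of \<kappa>], unfolded f] r] .
  show "P \<kappa> * M = c \<kappa> \<cdot>\<^sub>m P \<kappa>"
    using acts_diagonally_unique[OF acts_diagonally_mult[OF P_diagonal[of \<kappa>] assms, unfolded f] r] .
qed

lemma P_mult_P: "P \<kappa> * P \<rho> = (if \<kappa> = \<rho> then P \<kappa> else 0\<^sub>m n n)"
  using diagonal_P(1)[OF P_diagonal[of \<kappa>], of \<rho>] by (auto intro!: eq_matI)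

lemma sum_P:
  assumes "i < n" "j < n"
  shows "(\<Sum>\<kappa>\<in>Wt. P \<kappa> $$ (i, j)) = (if i = j then 1 else 0)"
proof -
  define Q where "Q = mat n n (\<lambda>ij. \<Sum>\<kappa>\<in>Wt. P \<kappa> $$ ij)"
  have Q: "Q \<in> carrier_mat n n" by (simp add: Q_def)
  have "Q = 1\<^sub>m n"
  proof (rule mat_eqI_weights[OF Q])
    fix \<mu> v assume \<mu>: "\<mu> \<in> wt_lattice D" and v: "v \<in> wt_space D V \<mu>"
    note vc = wt_space_carrier[OF v]
    show "Q *\<^sub>v v = 1\<^sub>m n *\<^sub>v v"
    proof (rule eq_vecI)
      fix i assume "i < dim_vec (1\<^sub>m n *\<^sub>v v)"
      then have i: "i < n" by simp
      have "(Q *\<^sub>v v) $ i = (\<Sum>\<kappa>\<in>Wt. \<Sum>l<n. P \<kappa> $$ (i, l) * v $ l)"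
        using mat_vec_entry[OF Q vc i] i
        by (simp add: Q_def sum_distrib_right) (rule sum.swap)
      also have "\<dots> = (\<Sum>\<kappa>\<in>Wt. if \<kappa> = \<mu> then v $ i else 0)"
      proof (rule sum.cong[OF refl])
        fix \<kappa>
        have "(\<Sum>l<n. P \<kappa> $$ (i, l) * v $ l) = (P \<kappa> *\<^sub>v v) $ i"
          by (rule mat_vec_entry[OF P_carrier vc i, symmetric])
        also have "P \<kappa> *\<^sub>v v = (if \<mu> = \<kappa> then 1 else 0) \<cdot>\<^sub>v v"
          using P_diagonal[of \<kappa>] \<mu> v unfolding acts_diagonally_def by blast
        finally show "(\<Sum>l<n. P \<kappa> $$ (i, l) * v $ l) = (if \<kappa> = \<mu> then v $ i else 0)"
          using vc i by auto
      qed
      also have "\<dots> = v $ i"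
      proof (cases "v = 0\<^sub>v n")
        case True
        then show ?thesis using i by (auto intro!: sum.neutral)
      next
        case False
        then have "\<mu> \<in> Wt" using \<mu> v by (auto simp: weights_def)
        then show ?thesis by (simp add: finite_weights)
      qed
      finally show "(Q *\<^sub>v v) $ i = (1\<^sub>m n *\<^sub>v v) $ i" using vc by simp
    qed (use Q in simp)
  qed simp
  then have "Q $$ (i, j) = (if i = j then 1 else 0)" using assms by simp
  then show ?thesis using assms by (simp add: Q_def)
qed

text \<open>The identity is the sum of the projections \<open>P \<kappa>\<close>.\<close>
lemma insert_projections:
  assumes A: "A \<in> carrier_mat n n" and B: "B \<in> carrier_mat n n" and ij: "i < n" "j < n"
  shows "(A * B) $$ (i, j) = (\<Sum>\<kappa>\<in>Wt. (A * P \<kappa> * B) $$ (i, j))"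
proof -
  have "(\<Sum>\<kappa>\<in>Wt. (A * P \<kappa> * B) $$ (i, j))
      = (\<Sum>\<kappa>\<in>Wt. \<Sum>l<n. (\<Sum>k<n. A $$ (i, k) * P \<kappa> $$ (k, l)) * B $$ (l, j))"
    by (intro sum.cong refl) (use A B ij in \<open>simp add: mat_mult_entry[of "A * P _" n n B n]
        mat_mult_entry[of A n n "P _" n] del: index_mult_mat(1)\<close>)
  also have "\<dots> = (\<Sum>l<n. (\<Sum>k<n. A $$ (i, k) * (\<Sum>\<kappa>\<in>Wt. P \<kappa> $$ (k, l))) * B $$ (l, j))"
    unfolding sum_distrib_left sum_distrib_right
    by (subst sum.swap) (intro sum.cong[OF refl] sum.swap)
  also have "\<dots> = (\<Sum>l<n. (\<Sum>k<n. if k = l then A $$ (i, l) else 0) * B $$ (l, j))"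
    by (intro sum.cong refl arg_cong2[where f = "(*)"]) (simp_all add: sum_P)
  also have "\<dots> = (A * B) $$ (i, j)"
    using A B ij by (simp add: mat_mult_entry[of A n n B n] del: index_mult_mat(1))
  finally show ?thesis ..
qed

text \<open>The relation \<open>r\<close> bounds the set of non-zero blocks. Under this bookkeeping products of operators become
  compositions of relations, and a trace vanishes unless its relation has a fixed weight.\<close>
definition supported :: "('i wt \<Rightarrow> 'i wt \<Rightarrow> bool) \<Rightarrow> ff mat \<Rightarrow> bool" where
  "supported r A \<longleftrightarrow> A \<in> carrier_mat n n \<and>
     (\<forall>\<kappa>\<in>Wt. \<forall>\<rho>\<in>Wt. P \<kappa> * A * P \<rho> \<noteq> 0\<^sub>m n n \<longrightarrow> r \<kappa> \<rho>)"

lemma supported_carrier: "supported r A \<Longrightarrow> A \<in> carrier_mat n n"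
  by (simp add: supported_def)

lemma supported_mono: "supported r A \<Longrightarrow> (\<And>\<kappa> \<rho>. r \<kappa> \<rho> \<Longrightarrow> s \<kappa> \<rho>) \<Longrightarrow> supported s A"
  by (auto simp: supported_def)

text \<open>Doubling the projection \<open>P \<sigma>\<close> exhibits the product as a product of two blocks.\<close>
lemma block_mult:
  assumes A: "A \<in> carrier_mat n n" and B: "B \<in> carrier_mat n n" and L: "L \<in> carrier_mat n n" and Y: "Y \<in> carrier_mat n n"
  shows "L * A * P \<sigma> * (B * Y) = (L * A * P \<sigma>) * (P \<sigma> * B * Y)"
proof -
  have "P \<sigma> * (B * Y) = (P \<sigma> * P \<sigma>) * (B * Y)" by (simp add: P_mult_P)
  also have "\<dots> = P \<sigma> * (P \<sigma> * B * Y)" using B Y by (simp add: square_mult)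
  finally have "P \<sigma> * (B * Y) = P \<sigma> * (P \<sigma> * B * Y)" .
  then show ?thesis using A B L Y by (simp add: square_mult)
qed

lemma supported_mult:
  assumes "supported r A" "supported s B"
  shows "supported (\<lambda>\<kappa> \<rho>. \<exists>\<sigma>\<in>Wt. r \<kappa> \<sigma> \<and> s \<sigma> \<rho>) (A * B)"
proof -
  note c = supported_carrier[OF assms(1)] supported_carrier[OF assms(2)]
  have "\<exists>\<sigma>\<in>Wt. r \<kappa> \<sigma> \<and> s \<sigma> \<rho>" if kr: "\<kappa> \<in> Wt" "\<rho> \<in> Wt" and nz: "P \<kappa> * (A * B) * P \<rho> \<noteq> 0\<^sub>m n n" for \<kappa> \<rho>
  proof (rule ccontr)
    assume contr: "\<not> (\<exists>\<sigma>\<in>Wt. r \<kappa> \<sigma> \<and> s \<sigma> \<rho>)"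
    have z: "P \<kappa> * A * P \<sigma> * (B * P \<rho>) = 0\<^sub>m n n" if "\<sigma> \<in> Wt" for \<sigma>
    proof -
      have "P \<kappa> * A * P \<sigma> = 0\<^sub>m n n \<or> P \<sigma> * B * P \<rho> = 0\<^sub>m n n"
        using contr that assms kr unfolding supported_def by blast
      then show ?thesis unfolding block_mult[OF c P_carrier P_carrier]
        using c by (elim disjE) (simp_all add: square_mult)
    qed
    have "P \<kappa> * (A * B) * P \<rho> = (P \<kappa> * A) * (B * P \<rho>)"
      using c by (simp add: square_mult)
    also have "\<dots> = 0\<^sub>m n n"
    proof (rule eq_matI)
      fix i j assume "i < dim_row (0\<^sub>m n n :: ff mat)" "j < dim_col (0\<^sub>m n n :: ff mat)"
      then have ij: "i < n" "j < n" by auto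
      show "(P \<kappa> * A * (B * P \<rho>)) $$ (i, j) = 0\<^sub>m n n $$ (i, j)"
        using c ij by (subst insert_projections) (auto simp: z simp del: index_mult_mat(1))
    qed (use c in auto)
    finally show False using nz by simp
  qed
  then show ?thesis using c by (auto simp: supported_def)
qed

lemma supported_diagonal:
  assumes "acts_diagonally M c"
  shows "supported (\<lambda>\<kappa> \<rho>. \<kappa> = \<rho> \<and> c \<kappa> \<noteq> 0) M"
proof -
  have M: "M \<in> carrier_mat n n" using assms by (simp add: acts_diagonally_def)
  have "P \<kappa> * M * P \<rho> = c \<kappa> \<cdot>\<^sub>m (P \<kappa> * P \<rho>)" for \<kappa> \<rho>
    unfolding diagonal_P(2)[OF assms] by (simp add: square_mult)
  then have "P \<kappa> * M * P \<rho> = 0\<^sub>m n n" if "\<not> (\<kappa> = \<rho> \<and> c \<kappa> \<noteq> 0)" for \<kappa> \<rho>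
    using that by (auto simp: P_mult_P intro!: eq_matI)
  then show ?thesis using M unfolding supported_def by blast
qed

lemma zero_if_blocks_zero:
  assumes A: "A \<in> carrier_mat n n"
    and z: "\<And>\<kappa> \<rho>. \<kappa> \<in> Wt \<Longrightarrow> \<rho> \<in> Wt \<Longrightarrow> P \<kappa> * A * P \<rho> = 0\<^sub>m n n"
  shows "A = 0\<^sub>m n n"
proof (rule eq_matI)
  fix i j assume "i < dim_row (0\<^sub>m n n :: ff mat)" "j < dim_col (0\<^sub>m n n :: ff mat)"
  then have ij: "i < n" "j < n" by auto
  have "A $$ (i, j) = (1\<^sub>m n * A) $$ (i, j)" using A by simp
  also have "\<dots> = (\<Sum>\<kappa>\<in>Wt. (1\<^sub>m n * P \<kappa> * A) $$ (i, j))"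
    by (rule insert_projections[OF one_carrier_mat A ij])
  also have "\<dots> = (\<Sum>\<kappa>\<in>Wt. (P \<kappa> * A * 1\<^sub>m n) $$ (i, j))"
    by (rule sum.cong[OF refl]) (use A in \<open>simp add: square_mult\<close>)
  also have "\<dots> = (\<Sum>\<kappa>\<in>Wt. \<Sum>\<rho>\<in>Wt. (P \<kappa> * A * P \<rho> * 1\<^sub>m n) $$ (i, j))"
    by (rule sum.cong[OF refl], rule insert_projections) (use A ij in auto)
  also have "\<dots> = 0"
    by (intro sum.neutral ballI) (use z A ij in simp)
  finally show "A $$ (i, j) = 0\<^sub>m n n $$ (i, j)" using ij by simp
qed (use A in auto)

text \<open>The trace is the sum of the traces of the diagonal blocks.\<close>
lemma supported_trace:
  assumes "supported r A" "mat_trace A \<noteq> 0"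
  shows "\<exists>\<kappa>\<in>Wt. r \<kappa> \<kappa>"
proof (rule ccontr)
  assume "\<not> (\<exists>\<kappa>\<in>Wt. r \<kappa> \<kappa>)"
  then have z: "P \<kappa> * A * P \<kappa> = 0\<^sub>m n n" if "\<kappa> \<in> Wt" for \<kappa>
    using assms(1) that by (auto simp: supported_def)
  note A = supported_carrier[OF assms(1)]
  have "mat_trace A = (\<Sum>i<n. (1\<^sub>m n * A) $$ (i, i))" using A by (auto simp: mat_trace_def)
  also have "\<dots> = (\<Sum>i<n. \<Sum>\<kappa>\<in>Wt. (P \<kappa> * A) $$ (i, i))"
    by (rule sum.cong[OF refl], subst insert_projections) (use A in \<open>simp_all add: square_mult del: index_mult_mat(1)\<close>)
  also have "\<dots> = (\<Sum>\<kappa>\<in>Wt. mat_trace (P \<kappa> * A))"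
    by (subst sum.swap) (use A in \<open>simp add: mat_trace_def carrier_matD[OF P_carrier]\<close>)
  also have "\<dots> = (\<Sum>\<kappa>\<in>Wt. mat_trace (P \<kappa> * A * P \<kappa>))"
  proof (rule sum.cong[OF refl])
    fix \<kappa>
    have "mat_trace (P \<kappa> * A * P \<kappa>) = mat_trace (P \<kappa> * (P \<kappa> * A))"
      by (rule mat_trace_comm) (use A in auto)
    also have "P \<kappa> * (P \<kappa> * A) = P \<kappa> * A"
      using assoc_mult_mat[OF P_carrier P_carrier A, of \<kappa> \<kappa>] by (simp add: P_mult_P)
    finally show "mat_trace (P \<kappa> * A) = mat_trace (P \<kappa> * A * P \<kappa>)" ..
  qed
  also have "\<dots> = 0" by (intro sum.neutral ballI) (simp add: z mat_trace_def)
  finally show False using assms(2) by simp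
qed

lemma block_entry_cancel:
  assumes "a \<cdot>\<^sub>m A = b \<cdot>\<^sub>m A" "A \<in> carrier_mat n n" "A \<noteq> 0\<^sub>m n n"
  shows "a = (b :: ff)"
proof (rule ccontr)
  assume ab: "a \<noteq> b"
  have "A $$ (i, j) = 0" if ij: "i < n" "j < n" for i j
  proof -
    have "(a \<cdot>\<^sub>m A) $$ (i, j) = (b \<cdot>\<^sub>m A) $$ (i, j)" by (simp only: assms(1))
    then show ?thesis using ab assms(2) ij by simp
  qed
  then have "A = 0\<^sub>m n n" using assms(2) by (intro eq_matI) auto
  then show False using assms(3) by simp
qed

text \<open>The torus acts on a non-zero block by the difference of its two weights and also by the degree of the
  operator. The weights are relabelled by \<open>c\<close> to cover twisted modules.\<close>
lemma supported_homogeneous: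
  assumes K: "\<And>h. acts_diagonally (K h) (\<lambda>\<mu>. qpow D (pair D (c \<mu>) h))"
    and A: "A \<in> carrier_mat n n"
    and h: "\<And>h. K h * A * K (- h) = qpow D (pair D \<nu> h) \<cdot>\<^sub>m A"
  shows "supported (\<lambda>\<kappa> \<rho>. c \<kappa> = c \<rho> + \<nu>) A"
  unfolding supported_def
proof (intro conjI ballI impI)
  fix \<kappa> \<rho> assume "\<kappa> \<in> Wt" "\<rho> \<in> Wt" and nz: "P \<kappa> * A * P \<rho> \<noteq> 0\<^sub>m n n"
  have Kc: "K h \<in> carrier_mat n n" for h using K by (simp add: acts_diagonally_def)
  have "pair D (c \<kappa>) h = pair D (c \<rho> + \<nu>) h" for h
  proof -
    have "P \<kappa> * (K h * A * K (- h)) * P \<rho> = (P \<kappa> * K h) * A * (K (- h) * P \<rho>)"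
      using A Kc by (simp add: square_mult)
    also have "\<dots> = (qpow D (pair D (c \<kappa>) h) * qpow D (- pair D (c \<rho>) h)) \<cdot>\<^sub>m (P \<kappa> * A * P \<rho>)"
      unfolding diagonal_P(2)[OF K] diagonal_P(1)[OF K]
      using A by (auto simp: pair_linear mult_smult_distrib[of _ n n _ n] mult_smult_assoc_mat[of _ n n _ n]
          mult.commute intro!: eq_matI)
    finally have "P \<kappa> * (qpow D (pair D \<nu> h) \<cdot>\<^sub>m A) * P \<rho>
      = (qpow D (pair D (c \<kappa>) h) * qpow D (- pair D (c \<rho>) h)) \<cdot>\<^sub>m (P \<kappa> * A * P \<rho>)"
      unfolding h .
    moreover have "P \<kappa> * (qpow D (pair D \<nu> h) \<cdot>\<^sub>m A) * P \<rho> = qpow D (pair D \<nu> h) \<cdot>\<^sub>m (P \<kappa> * A * P \<rho>)"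
      using A by (simp add: square_mult)
    ultimately have "qpow D (pair D \<nu> h) \<cdot>\<^sub>m (P \<kappa> * A * P \<rho>)
      = (qpow D (pair D (c \<kappa>) h) * qpow D (- pair D (c \<rho>) h)) \<cdot>\<^sub>m (P \<kappa> * A * P \<rho>)" by simp
    then have "qpow D (pair D \<nu> h) = qpow D (pair D (c \<kappa>) h) * qpow D (- pair D (c \<rho>) h)"
      by (rule block_entry_cancel) (use A nz in \<open>auto simp: square_mult\<close>)
    then have "pair D \<nu> h = pair D (c \<kappa>) h + - pair D (c \<rho>) h"
      by (simp only: qpow_add[OF qg, symmetric] qpow_inject[OF qg])
    then show ?thesis by (simp add: pair_linear)
  qed
  then show "c \<kappa> = c \<rho> + \<nu>" by (rule pair_inject[OF qgroup_simple[OF qg]])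
qed (rule A)

text \<open>Solving a block unitriangular system: the block of the solution at \<open>\<kappa>\<close> is that of the right-hand
  side once all blocks of smaller height vanish.\<close>
lemma unitriangular_step:
  assumes Y: "supported (\<lambda>\<kappa> \<rho>. \<kappa> = \<rho> \<or> f \<kappa> > f \<rho>) Y"
    and diag: "\<And>\<kappa>. \<kappa> \<in> Wt \<Longrightarrow> P \<kappa> * Y * P \<kappa> = P \<kappa>"
    and B: "B \<in> carrier_mat n n" and Q: "Q \<in> carrier_mat n n" and \<kappa>: "\<kappa> \<in> Wt"
    and low: "\<And>\<rho>. \<rho> \<in> Wt \<Longrightarrow> f \<rho> < (f \<kappa> :: rat) \<Longrightarrow> P \<rho> * B * Q = 0\<^sub>m n n"
  shows "P \<kappa> * B * Q = P \<kappa> * (Y * B) * Q"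
proof (rule eq_matI)
  note Yc = supported_carrier[OF Y]
  fix i j assume "i < dim_row (P \<kappa> * (Y * B) * Q)" "j < dim_col (P \<kappa> * (Y * B) * Q)"
  then have ij: "i < n" "j < n" using Q by (auto simp: carrier_matD[OF P_carrier])
  have z: "P \<kappa> * Y * P \<rho> * (B * Q) = (if \<rho> = \<kappa> then P \<kappa> * B * Q else 0\<^sub>m n n)" if \<rho>: "\<rho> \<in> Wt" for \<rho>
  proof -
    consider "\<rho> = \<kappa>" | "\<rho> \<noteq> \<kappa>" "P \<kappa> * Y * P \<rho> = 0\<^sub>m n n" | "\<rho> \<noteq> \<kappa>" "P \<rho> * B * Q = 0\<^sub>m n n"
      using Y \<kappa> \<rho> low[OF \<rho>] unfolding supported_def by metis
    then show ?thesis
    proof cases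
      case 1
      then show ?thesis by (simp only: diag[OF \<kappa>] assoc_mult_mat[OF P_carrier B Q] simp_thms if_True)
    next
      case 2
      then show ?thesis by (simp only: left_mult_zero_mat[OF mult_carrier_mat[OF B Q]] if_False)
    next
      case 3
      have "P \<kappa> * Y * P \<rho> \<in> carrier_mat n n" using Yc by (simp add: square_mult)
      with 3 show ?thesis
        by (simp only: block_mult[OF Yc B P_carrier Q] right_mult_zero_mat if_False)
    qed
  qed
  have "(P \<kappa> * (Y * B) * Q) $$ (i, j) = ((P \<kappa> * Y) * (B * Q)) $$ (i, j)"
    using Yc B Q by (simp add: square_mult del: index_mult_mat(1))
  also have "\<dots> = (\<Sum>\<rho>\<in>Wt. (P \<kappa> * Y * P \<rho> * (B * Q)) $$ (i, j))"
    by (rule insert_projections) (use Yc B Q ij in auto)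
  also have "\<dots> = (\<Sum>\<rho>\<in>Wt. if \<rho> = \<kappa> then (P \<kappa> * B * Q) $$ (i, j) else 0)"
    by (rule sum.cong[OF refl]) (use ij in \<open>simp add: z del: index_mult_mat(1)\<close>)
  also have "\<dots> = (P \<kappa> * B * Q) $$ (i, j)" using \<kappa> by (simp add: finite_weights)
  finally show "(P \<kappa> * B * Q) $$ (i, j) = (P \<kappa> * (Y * B) * Q) $$ (i, j)" ..
qed (use Y B Q in auto)

text \<open>Well-founded because there are finitely many weights.\<close>
lemma weights_induct [consumes 1]:
  assumes "\<kappa> \<in> Wt"
    and "\<And>\<kappa>. \<kappa> \<in> Wt \<Longrightarrow> (\<And>\<rho>. \<rho> \<in> Wt \<Longrightarrow> f \<rho> < (f \<kappa> :: rat) \<Longrightarrow> Q \<rho>) \<Longrightarrow> Q \<kappa>"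
  shows "Q \<kappa>"
  using assms(1)
proof (induction "card {\<rho> \<in> Wt. f \<rho> < f \<kappa>}" arbitrary: \<kappa> rule: less_induct)
  case less
  show ?case
  proof (rule assms(2)[OF less.prems])
    fix \<rho> assume \<rho>: "\<rho> \<in> Wt" "f \<rho> < f \<kappa>"
    have "{\<sigma> \<in> Wt. f \<sigma> < f \<rho>} \<subset> {\<sigma> \<in> Wt. f \<sigma> < f \<kappa>}" using \<rho> by auto
    then have "card {\<sigma> \<in> Wt. f \<sigma> < f \<rho>} < card {\<sigma> \<in> Wt. f \<sigma> < f \<kappa>}"
      by (intro psubset_card_mono) (simp_all add: finite_weights)
    then show "Q \<rho>" using less.hyps \<rho> by blast
  qed
qed

text \<open>By induction on \<open>f\<close>, a kernel vector of \<open>Y\<close> has zero components, so \<open>Y\<close> is invertible; the same induction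
  applied to \<open>Y * M = 1\<close> bounds the blocks of the inverse \<open>M\<close>.\<close>
lemma unitriangular_inverse:
  assumes Y: "supported (\<lambda>\<kappa> \<rho>. \<kappa> = \<rho> \<or> f \<kappa> > (f \<rho> :: rat)) Y"
    and diag: "\<And>\<kappa>. \<kappa> \<in> Wt \<Longrightarrow> P \<kappa> * Y * P \<kappa> = P \<kappa>"
  shows "supported (\<lambda>\<kappa> \<rho>. \<kappa> = \<rho> \<or> f \<kappa> > f \<rho>) (mat_inv Y)"
proof -
  note Yc = supported_carrier[OF Y]
  have "det Y \<noteq> 0"
  proof
    assume "det Y = 0"
    then obtain v where v: "v \<in> carrier_vec n" "v \<noteq> 0\<^sub>v n" "Y *\<^sub>v v = 0\<^sub>v n"
      using det_0_iff_vec_prod_zero_field[OF Yc] by auto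
    \<comment> \<open>A square matrix all of whose columns are \<open>v\<close>, so that \<open>unitriangular_step\<close> applies.\<close>
    define B where "B = mat n n (\<lambda>(i, j). v $ i)"
    have B: "B \<in> carrier_mat n n" by (simp add: B_def)
    have YB: "Y * B = 0\<^sub>m n n"
    proof (rule eq_matI)
      fix i j assume "i < dim_row (0\<^sub>m n n :: ff mat)" "j < dim_col (0\<^sub>m n n :: ff mat)"
      then have ij: "i < n" "j < n" by auto
      have "(Y * B) $$ (i, j) = (Y *\<^sub>v v) $ i"
        using mat_mult_entry[OF Yc B ij] mat_vec_entry[OF Yc v(1) ij(1)] ij by (simp add: B_def)
      then show "(Y * B) $$ (i, j) = 0\<^sub>m n n $$ (i, j)" using v(3) ij by simp
    qed (use Yc B in auto)
    have "P \<kappa> * B * 1\<^sub>m n = 0\<^sub>m n n" if "\<kappa> \<in> Wt" for \<kappa>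
      using that
    proof (induction \<kappa> rule: weights_induct[where f = f])
      case (1 \<kappa>)
      have "P \<kappa> * B * 1\<^sub>m n = P \<kappa> * (Y * B) * 1\<^sub>m n"
        by (rule unitriangular_step[OF Y diag B one_carrier_mat 1(1)]) (use 1 in auto)
      then show ?case by (simp add: YB square_mult)
    qed
    then have "P \<kappa> * B = 0\<^sub>m n n" if "\<kappa> \<in> Wt" for \<kappa>
      using that B by (simp add: square_mult)
    then have "P \<kappa> * B * P \<rho> = 0\<^sub>m n n" if "\<kappa> \<in> Wt" for \<kappa> \<rho>
      using that by (simp add: square_mult del: assoc_mult_mat)
    then have "B = 0\<^sub>m n n" using zero_if_blocks_zero[OF B] by blast
    then have "v $ i = 0" if "i < n" for i
      using that by (auto simp: B_def dest!: arg_cong[where f = "\<lambda>M. M $$ (i, i)"])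
    then have "v = 0\<^sub>v n" using v(1) by (auto intro!: eq_vecI)
    then show False using v(2) by simp
  qed
  then obtain M where M: "M \<in> carrier_mat n n" "Y * M = 1\<^sub>m n" "M * Y = 1\<^sub>m n"
    using det_non_zero_imp_unit[OF Yc] by (auto simp: Units_def ring_mat_def)
  have inv: "mat_inv Y = M"
    unfolding mat_inv_def
  proof (rule the_equality)
    show "M \<in> carrier_mat (dim_row Y) (dim_row Y) \<and> inverts_mat Y M \<and> inverts_mat M Y"
      using Yc M by (auto simp: inverts_mat_def)
    fix N assume "N \<in> carrier_mat (dim_row Y) (dim_row Y) \<and> inverts_mat Y N \<and> inverts_mat N Y"
    then have N: "N \<in> carrier_mat n n" "N * Y = 1\<^sub>m n" using Yc by (auto simp: inverts_mat_def)
    have "N = N * (Y * M)" using N M by simp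
    also have "\<dots> = (N * Y) * M" using N(1) Yc M(1) by (simp add: square_mult)
    also have "\<dots> = M" using N M by simp
    finally show "N = M" .
  qed
  have "P \<kappa> * M * P \<rho> = 0\<^sub>m n n" if "\<kappa> \<in> Wt" "\<rho> \<in> Wt" "\<kappa> \<noteq> \<rho>" "f \<kappa> \<le> f \<rho>" for \<kappa> \<rho>
    using that
  proof (induction \<kappa> rule: weights_induct[where f = f])
    case (1 \<kappa>)
    have "P \<kappa> * M * P \<rho> = P \<kappa> * (Y * M) * P \<rho>"
    proof (rule unitriangular_step[OF Y diag M(1) P_carrier 1(1)])
      fix \<rho>' assume r: "\<rho>' \<in> Wt" "f \<rho>' < f \<kappa>"
      then have "\<rho>' \<noteq> \<rho>" "f \<rho>' \<le> f \<rho>" using 1(5) by auto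
      then show "P \<rho>' * M * P \<rho> = 0\<^sub>m n n" using 1(2)[OF r 1(3)] by blast
    qed
    also have "\<dots> = P \<kappa> * P \<rho>" by (simp add: M(2))
    finally show ?case using 1 by (simp add: P_mult_P)
  qed
  then show ?thesis unfolding inv supported_def using M(1) by force
qed

end

section \<open>Twisting a module by an automorphism\<close>

lemma alg_aut_in_Uq: "alg_aut D f \<Longrightarrow> x \<in> Uq D \<Longrightarrow> f x \<in> Uq D"
  by (auto simp: alg_aut_def bij_betw_def)

lemma alg_aut_inv_into:
  assumes "alg_aut D f"
  shows "x \<in> Uq D \<Longrightarrow> inv_into (Uq D) f x \<in> Uq D" "x \<in> Uq D \<Longrightarrow> f (inv_into (Uq D) f x) = x"
    "x \<in> Uq D \<Longrightarrow> inv_into (Uq D) f (f x) = x"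
proof -
  have b: "inj_on f (Uq D)" "f ` Uq D = Uq D" using assms by (auto simp: alg_aut_def bij_betw_def)
  show "x \<in> Uq D \<Longrightarrow> inv_into (Uq D) f x \<in> Uq D" using inv_into_into[of x f "Uq D"] b by simp
  show "x \<in> Uq D \<Longrightarrow> f (inv_into (Uq D) f x) = x" using f_inv_into_f[of x f "Uq D"] b by simp
  show "x \<in> Uq D \<Longrightarrow> inv_into (Uq D) f (f x) = x" using inv_into_f_f[OF b(1)] .
qed

lemma alg_aut_inv:
  assumes f: "alg_aut D f" shows "alg_aut D (inv_into (Uq D) f)" (is "alg_aut D ?g")
proof -
  note i = alg_aut_inv_into[OF f]
  have hom: "f (x + y) = f x + f y" "f (x * y) = f x * f y" if "x \<in> Uq D" "y \<in> Uq D" for x y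
    using f that by (auto simp: alg_aut_def)
  have "?g (scal D c) = scal D c" for c
    using i(3)[OF Uq_closed(1)[of D c]] f by (simp add: alg_aut_def)
  moreover have "?g (x + y) = ?g x + ?g y" "?g (x * y) = ?g x * ?g y" if "x \<in> Uq D" "y \<in> Uq D" for x y
  proof -
    have g: "?g x \<in> Uq D" "?g y \<in> Uq D" using i(1) that by auto
    have "f (?g x + ?g y) = x + y" "f (?g x * ?g y) = x * y"
      using hom[OF g] i(2) that by auto
    then show "?g (x + y) = ?g x + ?g y" "?g (x * y) = ?g x * ?g y"
      using i(3)[OF Uq_closed(5)[OF g]] i(3)[OF Uq_closed(6)[OF g]] by auto
  qed
  moreover have "bij_betw ?g (Uq D) (Uq D)"
    using f by (auto simp: alg_aut_def intro: bij_betw_inv_into)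
  ultimately show ?thesis by (auto simp: alg_aut_def)
qed

lemma alg_aut_comp:
  assumes "alg_aut D f" "alg_aut D g" shows "alg_aut D (\<lambda>x. f (g x))"
proof -
  have "bij_betw (f \<circ> g) (Uq D) (Uq D)"
    using assms by (auto simp: alg_aut_def intro: bij_betw_trans)
  then show ?thesis using assms alg_aut_in_Uq[OF assms(2)] by (auto simp: alg_aut_def o_def)
qed

lemma alg_aut_id: "alg_aut D (\<lambda>x. x)"
  by (auto simp: alg_aut_def bij_betw_def)

lemma alg_aut_foldr: "(\<And>i. alg_aut D (T i)) \<Longrightarrow> alg_aut D (foldr T ws)"
proof (induction ws)
  case (Cons i ws)
  then show ?case using alg_aut_comp[of D "T i" "foldr T ws"] by (simp add: o_def)
qed (simp add: id_def alg_aut_id)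

lemma alg_aut_cong:
  assumes "alg_aut D f" "\<And>x. x \<in> Uq D \<Longrightarrow> g x = f x" shows "alg_aut D g"
proof -
  have "bij_betw g (Uq D) (Uq D) \<longleftrightarrow> bij_betw f (Uq D) (Uq D)"
    by (rule bij_betw_cong) (rule assms(2))
  then show ?thesis using assms Uq_closed[where D = D] by (auto simp: alg_aut_def)
qed

lemma act_twist: "x \<in> Uq D \<Longrightarrow> act (twist D f V) x = act V (f x)"
  by (simp add: twist_def)

lemma vdim_twist [simp]: "vdim (twist D f V) = vdim V"
  by (simp add: twist_def)

text \<open>The twist has the same weight vectors as \<open>V\<close>, in the weights relabelled by \<open>c\<close>.\<close>
lemma twist_fdmod:
  assumes V: "V \<in> fdmod D" and f: "alg_aut D f"
    and c: "\<And>\<mu>. c' (c \<mu>) = \<mu>" "\<And>\<mu>. \<mu> \<in> wt_lattice D \<Longrightarrow> c \<mu> \<in> wt_lattice D"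
    and sp: "\<And>\<mu> v. \<mu> \<in> wt_lattice D \<Longrightarrow> v \<in> wt_space D V \<mu> \<Longrightarrow> v \<in> wt_space D (twist D f V) (c \<mu>)"
  shows "twist D f V \<in> fdmod D"
proof -
  have r: "is_rep D (vdim V) (act V)" using V by (simp add: fdmod_def)
  have fh: "f (scal D a) = scal D a" "x \<in> Uq D \<Longrightarrow> f x \<in> Uq D" for a x
    using f alg_aut_in_Uq[OF f] by (auto simp: alg_aut_def)
  have fh2: "f (x + y) = f x + f y" "f (x * y) = f x * f y" if "x \<in> Uq D" "y \<in> Uq D" for x y
    using f that by (auto simp: alg_aut_def)
  have "is_rep D (vdim V) (act (twist D f V))"
    unfolding is_rep_def
  proof (intro conjI ballI allI)
    show "act (twist D f V) \<in> extensional (Uq D)" by (simp add: twist_def)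
    show "act (twist D f V) x \<in> carrier_mat (vdim V) (vdim V)" if "x \<in> Uq D" for x
      using r fh(2)[OF that] that by (simp add: act_twist is_rep_def)
    show "act (twist D f V) (scal D a) = a \<cdot>\<^sub>m 1\<^sub>m (vdim V)" for a
      using r by (simp add: act_twist Uq_closed(1) fh(1) is_rep_def)
    show "act (twist D f V) (x + y) = act (twist D f V) x + act (twist D f V) y"
      "act (twist D f V) (x * y) = act (twist D f V) x * act (twist D f V) y"
      if "x \<in> Uq D" "y \<in> Uq D" for x y
      using r fh(2)[OF that(1)] fh(2)[OF that(2)] fh2[OF that] that
      by (auto simp: act_twist Uq_closed(5,6) is_rep_def)
  qed
  moreover have "\<exists>S w. finite S \<and> S \<subseteq> wt_lattice D \<and> (\<forall>\<mu>\<in>S. w \<mu> \<in> wt_space D (twist D f V) \<mu>) \<and>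
      (\<forall>j<vdim V. v $ j = (\<Sum>\<mu>\<in>S. w \<mu> $ j))" if v: "v \<in> carrier_vec (vdim V)" for v
  proof -
    have "\<exists>S w. finite S \<and> S \<subseteq> wt_lattice D \<and> (\<forall>\<mu>\<in>S. w \<mu> \<in> wt_space D V \<mu>) \<and>
        (\<forall>j<vdim V. v $ j = (\<Sum>\<mu>\<in>S. w \<mu> $ j))"
      using V v unfolding fdmod_def by blast
    then obtain S w where Sw: "finite S" "S \<subseteq> wt_lattice D" "\<forall>\<mu>\<in>S. w \<mu> \<in> wt_space D V \<mu>"
      "\<forall>j<vdim V. v $ j = (\<Sum>\<mu>\<in>S. w \<mu> $ j)" by blast
    have inj: "inj_on c S" using c(1) by (metis inj_onI)
    have "finite (c ` S) \<and> c ` S \<subseteq> wt_lattice D \<and>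
        (\<forall>\<mu>\<in>c ` S. w (c' \<mu>) \<in> wt_space D (twist D f V) \<mu>) \<and>
        (\<forall>j<vdim V. v $ j = (\<Sum>\<mu>\<in>c ` S. w (c' \<mu>) $ j))"
    proof (intro conjI ballI allI impI)
      show "finite (c ` S)" using Sw by simp
      show "c ` S \<subseteq> wt_lattice D" using Sw(2) c(2) by auto
      show "w (c' \<mu>) \<in> wt_space D (twist D f V) \<mu>" if "\<mu> \<in> c ` S" for \<mu>
        using that Sw(2,3) sp c(1) by auto
      show "v $ j = (\<Sum>\<mu>\<in>c ` S. w (c' \<mu>) $ j)" if "j < vdim V" for j
        using Sw(4) that by (simp add: sum.reindex[OF inj] c(1))
    qed
    then show ?thesis by (intro exI)
  qed
  ultimately show ?thesis by (simp add: fdmod_def)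
qed

locale qsp_module = fd_module D V
  for D :: "('i::finite, 'u::ring_1) qsp" and V :: "'u qmod" +
  fixes \<phi> :: "'u \<Rightarrow> 'u"
  assumes satake_datum: "generalized_satake D" and phi: "is_phi_q D \<phi>"

sublocale qsp_module \<subseteq> satake_diagram D
  by unfold_locales (use qgroup_simple[OF qg] satake_datum in auto)

context qsp_module
begin

abbreviation "\<psi> \<equiv> phi_q_inv D \<phi>"
abbreviation "V' \<equiv> twist D \<psi> V"

lemma phi_aut: "alg_aut D \<phi>" and psi_aut: "alg_aut D \<psi>"
proof -
  obtain A \<omega> t G T where a: "is_Ad_chi D A" "is_chevalley_aut D \<omega>" "is_diagram_aut D t" "is_Ad_g D G"
    "\<forall>i. is_lusztig_aut D i (T i)" "\<forall>x\<in>Uq D. \<phi> x = A (\<omega> (t (G (foldr T (wX D) x))))"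
    using phi unfolding is_phi_q_def by blast
  have b: "alg_aut D A" "alg_aut D \<omega>" "alg_aut D t" "alg_aut D G" "\<And>i. alg_aut D (T i)"
    using a by (auto simp: is_Ad_chi_def is_chevalley_aut_def is_diagram_aut_def is_Ad_g_def is_lusztig_aut_def)
  have "alg_aut D (\<lambda>x. A (\<omega> (t (G (foldr T (wX D) x)))))"
    by (rule alg_aut_comp[OF b(1) alg_aut_comp[OF b(2) alg_aut_comp[OF b(3)
      alg_aut_comp[OF b(4) alg_aut_foldr[OF b(5)]]]]])
  then show 1: "alg_aut D \<phi>" by (rule alg_aut_cong) (use a(6) in blast)
  show "alg_aut D \<psi>" unfolding phi_q_inv_def by (rule alg_aut_inv[OF 1])
qed

text \<open>On \<open>k\<^sub>h\<close> the factors \<open>Ad(\<chi>\<^sub>q)\<close>, \<open>\<omega>\<close>, \<open>\<tau>\<close> and \<open>T\<^sub>w\<close> of \<open>\<phi>\<^sub>q\<close> act by explicit formulas, but \<open>Ad(g\<^sub>\<phi>)\<close> is given only by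
  its effect on modules. The twist \<open>V1\<close> of \<open>V\<close> by the inverse of \<open>T\<^sub>w\<close> is a module, with the weights of \<open>V\<close> moved
  by \<open>w\<close>; there \<open>g\<^sub>\<phi>\<close> is diagonal on weight spaces and hence commutes with \<open>k\<^sub>h\<close>.\<close>
lemma psi_K_diagonal: "acts_diagonally (act V (\<psi> (Kg D h))) (\<lambda>\<mu>. qpow D (pair D (phi_wt D \<mu>) h))"
proof -
  obtain A \<omega> t G T where a: "is_Ad_chi D A" "is_chevalley_aut D \<omega>" "is_diagram_aut D t" "is_Ad_g D G"
    "\<And>i. is_lusztig_aut D i (T i)" and phi_eq: "\<forall>x\<in>Uq D. \<phi> x = A (\<omega> (t (G (foldr T (wX D) x))))"
    using phi unfolding is_phi_q_def by blast
  have c2: "cmat D i i = 2" for i using simple by (simp add: simple_cartan_datum_def)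
  let ?T = "foldr T (wX D)"
  have T: "alg_aut D ?T" by (rule alg_aut_foldr) (use a(5) in \<open>simp add: is_lusztig_aut_def\<close>)
  have "T i (Kg D h) = Kg D (corefl D i h)" for i h using a(5)[of i] by (simp add: is_lusztig_aut_def)
  then have TK: "foldr T ws (Kg D h) = Kg D (foldr (corefl D) ws h)" for ws h
    by (induction ws) simp_all
  define Ti where "Ti = inv_into (Uq D) ?T"
  have TiK: "Ti (Kg D h) = Kg D (foldr (corefl D) (rev (wX D)) h)" for h
    using alg_aut_inv_into(3)[OF T Uq_closed(2), of "foldr (corefl D) (rev (wX D)) h"]
    by (simp only: TK foldr_corefl_rev[OF c2] Ti_def)
  define V1 where "V1 = twist D Ti V"
  have V1_sp: "v \<in> wt_space D V1 (w \<mu>)" if "v \<in> wt_space D V \<mu>" for v \<mu>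
    using that unfolding wt_space_def V1_def by (simp add: act_twist Uq_closed TiK pair_foldr_refl)
  have "V1 \<in> fdmod D"
    unfolding V1_def
    by (rule twist_fdmod[OF V, where c = w and c' = w])
      (use w_involution foldr_refl_wt_lattice V1_sp alg_aut_inv[OF T] in \<open>auto simp: Ti_def V1_def\<close>)
  then interpret V1: fd_module D V1 using qg by unfold_locales
  have V1n: "vdim V1 = n" by (simp add: V1_def)
  define h' where "h' = - (h \<circ> \<tau>)"
  define x where "x = inv_into (Uq D) G (Kg D h')"
  have G: "alg_aut D G" using a(4) by (simp add: is_Ad_g_def)
  have x: "x \<in> Uq D" "G x = Kg D h'" using alg_aut_inv_into[OF G Uq_closed(2)] by (auto simp: x_def)
  have x_act: "act V1 x = act V1 (Kg D h')"
  proof (rule V1.acts_diagonally_unique[OF _ V1.K_diagonal])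
    let ?g = "wt_op D V1 (g_phi D)" and ?gi = "wt_op D V1 (\<lambda>\<nu>. inverse (g_phi D \<nu>))"
    have nz: "g_phi D \<nu> \<noteq> 0" for \<nu> by (simp add: g_phi_def qpow_nonzero[OF qg])
    have "V1.acts_diagonally (?gi * ?g) (\<lambda>\<nu>. inverse (g_phi D \<nu>) * g_phi D \<nu>)"
      by (intro V1.acts_diagonally_mult V1.wt_op_diagonal)
    then have "V1.acts_diagonally (?gi * ?g) (\<lambda>_. 1)" by (simp add: nz)
    from V1.acts_diagonally_unique[OF this V1.acts_diagonally_one] have "?gi * ?g = 1\<^sub>m n"
      by (simp only: V1n)
    then have "act V1 x = ?gi * ?g * act V1 x" using V1.act_carrier[OF x(1)] by (simp add: V1n)
    also have "\<dots> = ?gi * (?g * act V1 x)"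
      by (rule assoc_mult_mat[OF V1.wt_op_carrier V1.wt_op_carrier V1.act_carrier[OF x(1)]])
    also have "?g * act V1 x = act V1 (G x) * ?g"
      using a(4) V1.V x(1) by (simp add: is_Ad_g_def)
    finally have e: "act V1 x = ?gi * (act V1 (Kg D h') * ?g)" by (simp only: x(2))
    have "V1.acts_diagonally (act V1 x)
      (\<lambda>\<nu>. inverse (g_phi D \<nu>) * (qpow D (pair D \<nu> h') * g_phi D \<nu>))"
      unfolding e by (intro V1.acts_diagonally_mult V1.wt_op_diagonal V1.K_diagonal)
    moreover have "(\<lambda>\<nu>. inverse (g_phi D \<nu>) * (qpow D (pair D \<nu> h') * g_phi D \<nu>))
        = (\<lambda>\<nu>. qpow D (pair D \<nu> h'))"
      using nz by (simp add: fun_eq_iff field_simps)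
    ultimately show "V1.acts_diagonally (act V1 x) (\<lambda>\<nu>. qpow D (pair D \<nu> h'))" by simp
  qed
  \<comment> \<open>\<open>z\<close> is the preimage of \<open>k\<^sub>h\<close> under \<open>\<phi>\<^sub>q\<close>, found by inverting the factors from the left.\<close>
  define z where "z = Ti x"
  have z: "z \<in> Uq D" "?T z = x" using alg_aut_inv_into[OF T x(1)] by (auto simp: z_def Ti_def)
  have "t (Kg D h') = Kg D (- h)"
    using a(3) unfolding is_diagram_aut_def h'_def by (simp add: fun_eq_iff o_def fun_Compl_def)
  moreover have "\<omega> (Kg D (- h)) = Kg D h" using a(2) by (simp add: is_chevalley_aut_def)
  moreover have "A (Kg D h) = Kg D h"
  proof -
    have "Kg D h \<in> root_space D 0"
      unfolding root_space_def
      by (simp add: Uq_closed Kg_add[OF qg] pair_linear qpow_0[OF qg] scal_simps(1)[OF alg])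
    moreover have "(0 :: 'i wt) \<in> root_lattice" by (simp add: root_lattice_def)
    ultimately have "A (Kg D h) = scal D (chi_q D 0) * Kg D h"
      using a(1) unfolding is_Ad_chi_def by blast
    moreover have "chi_q D 0 = 1" by (simp add: chi_q_def)
    ultimately show ?thesis by (simp add: scal_simps(1)[OF alg])
  qed
  ultimately have "\<phi> z = Kg D h" using phi_eq z x(2) by simp
  then have "\<psi> (Kg D h) = z" using alg_aut_inv_into(3)[OF phi_aut z(1)] by (simp add: phi_q_inv_def)
  moreover have "act V z = act V1 (Kg D h')" using x(1) x_act by (simp add: V1_def act_twist z_def)
  ultimately have e: "act V (\<psi> (Kg D h)) = act V1 (Kg D h')" by simp
  have p: "pair D (w \<mu>) h' = pair D (phi_wt D \<mu>) h" for \<mu>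
    by (simp add: h'_def phi_wt_alt pair_linear pair_comp_tau)
  show ?thesis
    unfolding acts_diagonally_def
  proof (intro conjI ballI)
    show "act V (\<psi> (Kg D h)) \<in> carrier_mat n n"
      using act_carrier[OF alg_aut_in_Uq[OF psi_aut Uq_closed(2)]] .
    fix \<mu> v assume "v \<in> wt_space D V \<mu>"
    then have "v \<in> wt_space D V1 (w \<mu>)" by (rule V1_sp)
    then show "act V (\<psi> (Kg D h)) *\<^sub>v v = qpow D (pair D (phi_wt D \<mu>) h) \<cdot>\<^sub>v v"
      unfolding e p[symmetric] by (simp add: wt_space_def)
  qed
qed

lemma twisted_K_diagonal: "acts_diagonally (act V' (Kg D h)) (\<lambda>\<mu>. qpow D (pair D (phi_wt D \<mu>) h))"
  using psi_K_diagonal by (simp add: act_twist Uq_closed)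

lemma wt_space_twisted:
  assumes "\<mu> \<in> wt_lattice D" "v \<in> wt_space D V \<mu>" shows "v \<in> wt_space D V' (phi_wt D \<mu>)"
  using assms twisted_K_diagonal unfolding wt_space_def[of D V'] acts_diagonally_def
  by (auto dest: wt_space_carrier)

lemma twisted_fdmod: "V' \<in> fdmod D"
  by (rule twist_fdmod[OF V psi_aut, where c = "phi_wt D" and c' = "phi_wt D"])
    (use phi_wt_involution phi_wt_lattice wt_space_twisted in auto)

sublocale twisted: fd_module D V'
  by unfold_locales (use qg twisted_fdmod in auto)

lemma twisted_P_diagonal: "acts_diagonally (wt_proj D V' \<nu>) (\<lambda>\<mu>. if phi_wt D \<mu> = \<nu> then 1 else 0)"
  unfolding acts_diagonally_def
proof (intro conjI ballI)
  show "wt_proj D V' \<nu> \<in> carrier_mat n n" using twisted.P_carrier[of \<nu>] by simp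
  fix \<mu> v assume "\<mu> \<in> wt_lattice D" "v \<in> wt_space D V \<mu>"
  then have "phi_wt D \<mu> \<in> wt_lattice D" "v \<in> wt_space D V' (phi_wt D \<mu>)"
    using phi_wt_lattice wt_space_twisted by auto
  then show "wt_proj D V' \<nu> *\<^sub>v v = (if phi_wt D \<mu> = \<nu> then 1 else 0) \<cdot>\<^sub>v v"
    using twisted.P_diagonal[of \<nu>] unfolding twisted.acts_diagonally_def by blast
qed

lemma homogeneous_supported:
  assumes "x \<in> root_space D \<nu>"
  shows "supported (\<lambda>\<kappa> \<rho>. \<kappa> = \<rho> + \<nu>) (act V x)"
    and "supported (\<lambda>\<kappa> \<rho>. \<kappa> = \<rho> + phi_wt D \<nu>) (act V' x)"
proof -
  have x: "x \<in> Uq D" and h: "Kg D h * x * Kg D (- h) = scal D (qpow D (pair D \<nu> h)) * x" for h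
    using assms by (auto simp: root_space_def)
  have e: "act V (Kg D h) * act V x * act V (Kg D (- h)) = qpow D (pair D \<nu> h) \<cdot>\<^sub>m act V x" for h
  proof -
    have "act V (Kg D h) * act V x * act V (Kg D (- h)) = act V (Kg D h * x * Kg D (- h))"
      using x by (simp only: act_mult Uq_closed)
    also have "\<dots> = (qpow D (pair D \<nu> h) \<cdot>\<^sub>m 1\<^sub>m n) * act V x"
      unfolding h using x by (simp only: act_mult Uq_closed act_scal)
    finally show ?thesis using act_carrier[OF x] by (simp add: square_mult)
  qed
  show "supported (\<lambda>\<kappa> \<rho>. \<kappa> = \<rho> + \<nu>) (act V x)"
    by (rule supported_homogeneous[where K = "\<lambda>h. act V (Kg D h)"]) (use K_diagonal x e in auto)
  have e': "act V' (Kg D h) * act V' x * act V' (Kg D (- h)) = qpow D (pair D \<nu> h) \<cdot>\<^sub>m act V' x" for h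
  proof -
    have "act V' (Kg D h) * act V' x * act V' (Kg D (- h)) = act V' (Kg D h * x * Kg D (- h))"
      using x by (simp only: twisted.act_mult Uq_closed)
    also have "\<dots> = (qpow D (pair D \<nu> h) \<cdot>\<^sub>m 1\<^sub>m n) * act V' x"
      unfolding h using x by (simp only: twisted.act_mult Uq_closed twisted.act_scal vdim_twist)
    finally show ?thesis using twisted.act_carrier[OF x] by (simp add: square_mult)
  qed
  have "supported (\<lambda>\<kappa> \<rho>. phi_wt D \<kappa> = phi_wt D \<rho> + \<nu>) (act V' x)"
    by (rule supported_homogeneous[where K = "\<lambda>h. act V' (Kg D h)"])
      (use twisted_K_diagonal twisted.act_carrier[OF x] e' in auto)
  then show "supported (\<lambda>\<kappa> \<rho>. \<kappa> = \<rho> + phi_wt D \<nu>) (act V' x)"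
    by (rule supported_mono) (metis phi_wt_add phi_wt_involution)
qed

end

section \<open>Block triangularity of the quasi K-matrix\<close>

context fd_module
begin

text \<open>Only differences of weights occur as degrees of non-zero operators.\<close>
lemma finite_degrees:
  fixes c :: "'i wt \<Rightarrow> 'i wt"
  assumes "\<And>\<nu> A. \<nu> \<in> N \<Longrightarrow> A \<in> B \<nu> \<Longrightarrow> supported (\<lambda>\<kappa> \<rho>. \<kappa> = \<rho> + c \<nu>) A" "inj c"
  shows "finite {\<nu> \<in> N. \<exists>A\<in>B \<nu>. A \<noteq> 0\<^sub>m n n}"
proof (rule finite_subset)
  show "finite (c -` ((\<lambda>(\<kappa>, \<rho>). \<kappa> - \<rho>) ` (Wt \<times> Wt)))"
    by (intro finite_vimageI finite_imageI finite_cartesian_product finite_weights assms(2))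
  show "{\<nu> \<in> N. \<exists>A\<in>B \<nu>. A \<noteq> 0\<^sub>m n n} \<subseteq> c -` ((\<lambda>(\<kappa>, \<rho>). \<kappa> - \<rho>) ` (Wt \<times> Wt))"
  proof
    fix \<nu> assume "\<nu> \<in> {\<nu> \<in> N. \<exists>A\<in>B \<nu>. A \<noteq> 0\<^sub>m n n}"
    then obtain A where \<nu>: "supported (\<lambda>\<kappa> \<rho>. \<kappa> = \<rho> + c \<nu>) A" "A \<noteq> 0\<^sub>m n n" using assms(1) by blast
    then obtain \<kappa> \<rho> where kr: "\<kappa> \<in> Wt" "\<rho> \<in> Wt" "P \<kappa> * A * P \<rho> \<noteq> 0\<^sub>m n n"
      using zero_if_blocks_zero[OF supported_carrier] by blast
    then have "\<kappa> = \<rho> + c \<nu>" using \<nu>(1) unfolding supported_def by blast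
    then have "c \<nu> = (\<lambda>(\<kappa>, \<rho>). \<kappa> - \<rho>) (\<kappa>, \<rho>)" by simp
    then show "\<nu> \<in> c -` ((\<lambda>(\<kappa>, \<rho>). \<kappa> - \<rho>) ` (Wt \<times> Wt))" using kr by blast
  qed
qed

lemma supported_intertwining:
  assumes M: "acts_diagonally M c" and N: "acts_diagonally N d"
    and A: "A \<in> carrier_mat n n" and eq: "A * M = N * A"
  shows "supported (\<lambda>\<kappa> \<rho>. d \<kappa> = c \<rho>) A"
  unfolding supported_def
proof (intro conjI ballI impI)
  fix \<kappa> \<rho> assume nz: "P \<kappa> * A * P \<rho> \<noteq> 0\<^sub>m n n"
  have Mc: "M \<in> carrier_mat n n" and Nc: "N \<in> carrier_mat n n"
    using M N by (auto simp: acts_diagonally_def)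
  have "d \<kappa> \<cdot>\<^sub>m (P \<kappa> * A * P \<rho>) = (P \<kappa> * N) * A * P \<rho>"
    unfolding diagonal_P(2)[OF N] using A by (simp add: square_mult)
  also have "\<dots> = P \<kappa> * (N * A) * P \<rho>" using A Nc by (simp add: square_mult)
  also have "\<dots> = P \<kappa> * A * (M * P \<rho>)" using A Mc by (simp add: square_mult flip: eq)
  also have "\<dots> = c \<rho> \<cdot>\<^sub>m (P \<kappa> * A * P \<rho>)"
    unfolding diagonal_P(1)[OF M] using A by (simp add: square_mult)
  finally show "d \<kappa> = c \<rho>" using nz A by (rule_tac block_entry_cancel) (auto simp: square_mult)
qed (rule A)

end

context qsp_module
begin

text \<open>A non-zero block of \<open>\<Upsilon>\<close> from \<open>\<rho>\<close> to \<open>\<kappa>\<close> has \<open>\<kappa> - \<rho>\<close> in the positive cone, and \<open>\<kappa> - \<rho>\<close> pairs to zero with the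
  coroots in \<open>X\<close> because \<open>\<Upsilon>\<close> intertwines the action of \<open>k\<^sub>i\<close> (\<open>i \<in> X\<close>) with that of \<open>\<psi>(k\<^sub>i)\<close>, which has the same
  eigenvalues. If \<open>\<kappa> - \<rho>\<close> has height zero, it lies in the span of \<open>X\<close> and is therefore zero.\<close>
lemma quasi_K_triangular:
  assumes "is_quasi_K D \<phi> \<Upsilon>"
  shows "supported (\<lambda>\<kappa> \<rho>. \<kappa> = \<rho> \<or> ht \<kappa> > ht \<rho>) (quasi_K_op \<Upsilon> V)"
    and "\<kappa> \<in> Wt \<Longrightarrow> P \<kappa> * quasi_K_op \<Upsilon> V * P \<kappa> = P \<kappa>"
proof -
  let ?Y = "quasi_K_op \<Upsilon> V"
  \<comment> \<open>The degree zero is included so that its term can be singled out in the diagonal blocks.\<close>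
  define F where "F = insert 0 {\<nu> \<in> pos_lattice. act V (\<Upsilon> \<nu>) \<noteq> 0\<^sub>m n n}"
  have U: "\<Upsilon> \<nu> \<in> root_space D \<nu>" if "\<nu> \<in> pos_lattice" for \<nu>
    using assms that by (auto simp: is_quasi_K_def)
  have sup: "supported (\<lambda>\<kappa> \<rho>. \<kappa> = \<rho> + \<nu>) (act V (\<Upsilon> \<nu>))" if "\<nu> \<in> pos_lattice" for \<nu>
    using homogeneous_supported(1)[OF U[OF that]] .
  have zero_pos: "(0 :: 'i wt) \<in> pos_lattice" by (simp add: pos_lattice_def)
  have F: "finite F" "F \<subseteq> pos_lattice"
    using finite_degrees[of pos_lattice "\<lambda>\<nu>. {act V (\<Upsilon> \<nu>)}" "\<lambda>\<nu>. \<nu>"] sup zero_pos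
    by (auto simp: F_def)
  have Fz: "act V (\<Upsilon> \<nu>) = 0\<^sub>m n n" if "\<nu> \<in> pos_lattice" "\<nu> \<notin> F" for \<nu>
    using that by (auto simp: F_def)
  have Yc: "?Y \<in> carrier_mat n n" by (simp add: quasi_K_op_def pos_sum_def)
  have block: "(P \<kappa> * ?Y * P \<rho>) $$ (i, j) = (\<Sum>\<nu>\<in>F. (P \<kappa> * act V (\<Upsilon> \<nu>) * P \<rho>) $$ (i, j))"
    if "i < n" "j < n" for \<kappa> \<rho> i j
    unfolding quasi_K_op_def
    by (rule pos_sum_sandwich[OF P_carrier P_carrier supported_carrier[OF sup] F Fz that])
  have off: "P \<kappa> * act V (\<Upsilon> \<nu>) * P \<rho> = 0\<^sub>m n n"
    if "\<kappa> \<in> Wt" "\<rho> \<in> Wt" "\<nu> \<in> F" "\<kappa> \<noteq> \<rho> + \<nu>" for \<kappa> \<rho> \<nu>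
    using sup[of \<nu>] that F(2) unfolding supported_def by blast
  have pos: "\<kappa> - \<rho> \<in> pos_lattice" if kr: "\<kappa> \<in> Wt" "\<rho> \<in> Wt" "P \<kappa> * ?Y * P \<rho> \<noteq> 0\<^sub>m n n" for \<kappa> \<rho>
  proof (rule ccontr)
    assume "\<kappa> - \<rho> \<notin> pos_lattice"
    then have "\<kappa> \<noteq> \<rho> + \<nu>" if "\<nu> \<in> F" for \<nu> using that F(2) by auto
    then have "(P \<kappa> * ?Y * P \<rho>) $$ (i, j) = 0" if "i < n" "j < n" for i j
      unfolding block[OF that] using off[OF kr(1,2)] that by (intro sum.neutral ballI) simp
    then have "P \<kappa> * ?Y * P \<rho> = 0\<^sub>m n n"
      by (intro eq_matI) (simp_all del: index_mult_mat(1) assoc_mult_mat)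
    then show False using kr(3) by simp
  qed
  have torus: "pair D \<kappa> (scoroot i) = pair D \<rho> (scoroot i)"
    if "\<kappa> \<in> Wt" "\<rho> \<in> Wt" "P \<kappa> * ?Y * P \<rho> \<noteq> 0\<^sub>m n n" "i \<in> Xset D" for \<kappa> \<rho> i
  proof -
    let ?x = "Kg D (kcow D i)"
    have "?x \<in> UgX D" unfolding UgX_def using that(4) by (auto intro: subalg.gen)
    then have "?x \<in> Uk D \<phi>" unfolding Uk_def by (intro subalg.gen) auto
    then have "?Y * act V ?x = act V (\<psi> ?x) * ?Y" using assms V by (simp add: is_quasi_K_def)
    then have "supported (\<lambda>\<kappa> \<rho>. qpow D (pair D (phi_wt D \<kappa>) (kcow D i)) = qpow D (pair D \<rho> (kcow D i))) ?Y"
      by (intro supported_intertwining[OF K_diagonal psi_K_diagonal Yc])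
    then have "qpow D (pair D (phi_wt D \<kappa>) (kcow D i)) = qpow D (pair D \<rho> (kcow D i))"
      using that unfolding supported_def by blast
    moreover have "eps D i > 0" using simple by (simp add: simple_cartan_datum_def)
    ultimately show ?thesis
      by (simp add: qpow_inject[OF qg] pair_kcow pair_phi_wt_X[OF that(4)])
  qed
  show "supported (\<lambda>\<kappa> \<rho>. \<kappa> = \<rho> \<or> ht \<kappa> > ht \<rho>) ?Y"
    unfolding supported_def
  proof (intro conjI ballI impI)
    fix \<kappa> \<rho> assume kr: "\<kappa> \<in> Wt" "\<rho> \<in> Wt" "P \<kappa> * ?Y * P \<rho> \<noteq> 0\<^sub>m n n"
    show "\<kappa> = \<rho> \<or> ht \<kappa> > ht \<rho>"
    proof (rule ccontr)
      assume "\<not> (\<kappa> = \<rho> \<or> ht \<kappa> > ht \<rho>)"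
      then have ne: "\<kappa> \<noteq> \<rho>" "ht (\<kappa> - \<rho>) = 0" using ht_nonneg[OF pos[OF kr]] by (auto simp: ht_diff)
      have "\<kappa> - \<rho> = 0"
      proof (rule zero_if_orthogonal[OF simple])
        show "(\<kappa> - \<rho>) j = 0" if "j \<notin> Xset D" for j using ht_eq_0[OF pos[OF kr] ne(2) that] .
        show "pair D (\<kappa> - \<rho>) (scoroot j) = 0" if "j \<in> Xset D" for j
          using torus[OF kr that] by (simp add: pair_diff_left)
      qed
      then show False using ne by simp
    qed
  qed (rule Yc)
  show "P \<kappa> * ?Y * P \<kappa> = P \<kappa>" if k: "\<kappa> \<in> Wt"
  proof (rule eq_matI)
    fix i j assume "i < dim_row (P \<kappa>)" "j < dim_col (P \<kappa>)"
    then have ij: "i < n" "j < n" by auto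
    have one: "P \<kappa> * act V (\<Upsilon> 0) * P \<kappa> = P \<kappa>"
      using assms by (simp add: is_quasi_K_def act_one P_mult_P)
    have "(P \<kappa> * ?Y * P \<kappa>) $$ (i, j) = (\<Sum>\<nu>\<in>F. if \<nu> = 0 then P \<kappa> $$ (i, j) else 0)"
      unfolding block[OF ij]
    proof (rule sum.cong[OF refl])
      fix \<nu> assume "\<nu> \<in> F"
      then show "(P \<kappa> * act V (\<Upsilon> \<nu>) * P \<kappa>) $$ (i, j) = (if \<nu> = 0 then P \<kappa> $$ (i, j) else 0)"
        using one off[OF k k, of \<nu>] ij by (cases "\<nu> = 0") (simp_all del: index_mult_mat(1) assoc_mult_mat)
    qed
    also have "\<dots> = P \<kappa> $$ (i, j)" using F(1) by (simp add: F_def)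
    finally show "(P \<kappa> * ?Y * P \<kappa>) $$ (i, j) = P \<kappa> $$ (i, j)" .
  qed (use Yc in auto)
qed

text \<open>The block relations of the factors, composed around the trace, form a cycle of weights along which the
  height cannot decrease; so it is constant and every inequality is an equality.\<close>
lemma trace_nonzero:
  assumes K: "is_quasi_K D \<phi> \<Upsilon>"
    and \<nu>: "\<nu> \<in> pos_lattice" "b \<in> root_space D \<nu>" and \<nu>': "\<nu>' \<in> pos_lattice" "a' \<in> root_space D (- \<nu>')"
    and tr: "mat_trace ((D_op D V * mat_inv (quasi_K_op \<Upsilon> V)) *
      (wt_proj D V' \<mu>' * act V' a' * quasi_K_op \<Upsilon> V * (P \<mu> * act V b))) \<noteq> 0"
  shows "\<forall>j. j \<notin> Xset D \<longrightarrow> \<nu> j = 0 \<and> \<nu>' j = 0" and "phi_wt D (\<mu>' + \<mu>) = \<mu>' + \<mu>"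
proof -
  note Y = quasi_K_triangular[OF K]
  have Dop: "supported (\<lambda>\<kappa> \<rho>. \<kappa> = \<rho>) (D_op D V)"
    unfolding D_op_def by (rule supported_mono[OF supported_diagonal[OF wt_op_diagonal]]) auto
  have P': "supported (\<lambda>\<kappa> \<rho>. \<kappa> = \<rho> \<and> phi_wt D \<kappa> = \<mu>') (wt_proj D V' \<mu>')"
    by (rule supported_mono[OF supported_diagonal[OF twisted_P_diagonal]]) (auto split: if_splits)
  have Pm: "supported (\<lambda>\<kappa> \<rho>. \<kappa> = \<rho> \<and> \<kappa> = \<mu>) (P \<mu>)"
    by (rule supported_mono[OF supported_diagonal[OF P_diagonal]]) (auto split: if_splits)
  note M = unitriangular_inverse[OF Y]
  from supported_trace[OF supported_mult[OF supported_mult[OF Dop M]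
      supported_mult[OF supported_mult[OF supported_mult[OF P' homogeneous_supported(2)[OF \<nu>'(2)]] Y(1)]
        supported_mult[OF Pm homogeneous_supported(1)[OF \<nu>(2)]]]] tr]
  \<comment> \<open>\<open>s5\<close>, \<open>s4\<close> and \<open>s3\<close> are the weights reached from \<open>\<kappa>\<close> after applying \<open>P \<mu> b\<close>, \<open>\<Upsilon>\<close> and \<open>P' \<mu>' \<psi>(a')\<close>.\<close>
  obtain \<kappa> s3 s4 s5 where c: "\<kappa> = s3 \<or> ht \<kappa> > ht s3" "phi_wt D s3 = \<mu>'"
    "s3 = s4 + phi_wt D (- \<nu>')" "s4 = s5 \<or> ht s4 > ht s5" "s5 = \<mu>" "s5 = \<kappa> + \<nu>"
    by blast
  have m: "ht (- \<nu>') = - ht \<nu>'" by (simp add: ht_def sum_negf)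
  have h3: "ht s3 = ht s4 + ht \<nu>'" and h5: "ht s5 = ht \<kappa> + ht \<nu>"
    unfolding c(3) c(6) by (simp_all only: ht_add ht_phi_wt m minus_minus)
  have n: "ht \<nu> \<ge> 0" "ht \<nu>' \<ge> 0" using ht_nonneg \<nu> \<nu>' by auto
  have le: "ht \<kappa> \<ge> ht s3" "ht s4 \<ge> ht s5" using c(1,4) by auto
  have z: "ht \<nu> = 0" "ht \<nu>' = 0" "ht \<kappa> = ht s3" using h3 h5 n le by linarith+
  show X: "\<forall>j. j \<notin> Xset D \<longrightarrow> \<nu> j = 0 \<and> \<nu>' j = 0"
    using ht_eq_0[OF \<nu>(1) z(1)] ht_eq_0[OF \<nu>'(1) z(2)] by blast
  have "\<kappa> = s3" using c(1) z(3) by auto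
  then have "\<mu>' = phi_wt D \<kappa>" "\<mu> = \<kappa> + \<nu>" using c by auto
  moreover have "phi_wt D \<nu> = \<nu>" using X by (intro phi_wt_on_X) blast
  ultimately show "phi_wt D (\<mu>' + \<mu>) = \<mu>' + \<mu>"
    by (simp only: phi_wt_add phi_wt_involution ac_simps)
qed

end

section \<open>Homogeneous elements of the nilpotent subalgebras\<close>

lemma subalg_add_sum_list: "(\<And>x. x \<in> set xs \<Longrightarrow> f x \<in> subalg s G) \<Longrightarrow> is_algebra s \<Longrightarrow> (\<Sum>x\<leftarrow>xs. f x) \<in> subalg s G"
proof (induction xs)
  case Nil
  then show ?case using subalg.const[of s 0 G] by (simp add: scal_simps(2))
qed (auto intro: subalg.add)

lemma subalg_mono_gen:
  assumes "x \<in> subalg s G" "G \<subseteq> subalg s H" shows "x \<in> subalg s H"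
  using assms(1) by (induction x rule: subalg.induct) (use assms(2) in \<open>auto intro: subalg.intros\<close>)

lemma subalg_prod_list:
  "(\<And>x. x \<in> set xs \<Longrightarrow> f x \<in> subalg s G) \<Longrightarrow> is_algebra s \<Longrightarrow> (\<Prod>x\<leftarrow>xs. f x) \<in> subalg s G"
proof (induction xs)
  case Nil
  then show ?case using subalg.const[of s 1 G] by (simp add: scal_simps(1))
qed (auto intro: subalg.mult)

lemma sum_list_concat_map: "(\<Sum>y\<leftarrow>concat (map g xs). f y) = (\<Sum>x\<leftarrow>xs. \<Sum>y\<leftarrow>g x. f y)"
  by (induction xs) auto

lemma sum_list_product:
  "(\<Sum>x\<leftarrow>xs. f x) * (\<Sum>y\<leftarrow>ys. g y) = (\<Sum>x\<leftarrow>xs. \<Sum>y\<leftarrow>ys. f x * (g y :: 'a::semiring_0))"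
  by (simp add: sum_list_mult_const sum_list_const_mult)

lemma subalg_monomials:
  assumes s: "is_algebra s" and "x \<in> subalg s (range g)"
  shows "\<exists>L. x = (\<Sum>p\<leftarrow>L. s (fst p) * (\<Prod>i\<leftarrow>snd p. g i))"
  using assms(2)
proof (induction x rule: subalg.induct)
  case (const c)
  show ?case by (rule exI[of _ "[(c, [])]"]) simp
next
  case (gen x)
  then obtain i where "x = g i" by auto
  then show ?case by (intro exI[of _ "[(1, [i])]"]) (simp add: scal_simps(1)[OF s])
next
  case (add x y)
  then obtain L1 L2 where "x = (\<Sum>p\<leftarrow>L1. s (fst p) * (\<Prod>i\<leftarrow>snd p. g i))"
    "y = (\<Sum>p\<leftarrow>L2. s (fst p) * (\<Prod>i\<leftarrow>snd p. g i))" by blast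
  then show ?case by (intro exI[of _ "L1 @ L2"]) simp
next
  case (mult x y)
  then obtain L1 L2 where L: "x = (\<Sum>p\<leftarrow>L1. s (fst p) * (\<Prod>i\<leftarrow>snd p. g i))"
    "y = (\<Sum>p\<leftarrow>L2. s (fst p) * (\<Prod>i\<leftarrow>snd p. g i))" by blast
  let ?L = "concat (map (\<lambda>p. map (\<lambda>p'. (fst p * fst p', snd p @ snd p')) L2) L1)"
  have e: "s (fst p) * (\<Prod>i\<leftarrow>snd p. g i) * (s (fst p') * (\<Prod>i\<leftarrow>snd p'. g i))
      = s (fst p * fst p') * (\<Prod>i\<leftarrow>snd p @ snd p'. g i)" for p p'
  proof -
    have "s (fst p) * (\<Prod>i\<leftarrow>snd p. g i) * (s (fst p') * (\<Prod>i\<leftarrow>snd p'. g i))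
        = s (fst p) * (s (fst p') * (\<Prod>i\<leftarrow>snd p. g i)) * (\<Prod>i\<leftarrow>snd p'. g i)"
      by (simp only: scal_simps(7)[OF s, of "fst p'" "\<Prod>i\<leftarrow>snd p. g i"] mult.assoc)
    then show ?thesis by (simp only: scal_simps(4)[OF s] mult.assoc map_append prod_list.append)
  qed
  have "x * y = (\<Sum>p\<leftarrow>?L. s (fst p) * (\<Prod>i\<leftarrow>snd p. g i))"
    unfolding L sum_list_product e by (simp add: sum_list_concat_map o_def)
  then show ?case by blast
qed

lemma scal_left_commute:
  assumes "is_algebra s" shows "k * (s c * m) = s c * (k * m)"
  using scal_simps(7)[OF assms, of c k] by (simp only: mult.assoc[symmetric])

text \<open>Stated for an arbitrary character \<open>\<theta>\<close> to cover both \<open>k\<^sub>h\<close> and \<open>k\<^sub>\<eta>\<close>, and for arbitrary weights \<open>\<beta> i\<close> of the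
  generators to cover both the \<open>E\<^sub>i\<close> and the \<open>F\<^sub>i\<close>.\<close>
lemma commute_monomial:
  assumes s: "is_algebra s" and k: "\<And>i. k * g i = s (\<theta> (\<beta> i)) * (g i * k)"
    and \<theta>: "\<theta> 0 = 1" "\<And>x y. \<theta> (x + y) = \<theta> x * \<theta> y"
  shows "k * (\<Prod>i\<leftarrow>is. g i) = s (\<theta> (\<Sum>i\<leftarrow>is. \<beta> i)) * ((\<Prod>i\<leftarrow>is. g i) * k)"
proof (induction "is")
  case Nil
  have "s (\<theta> (\<Sum>i\<leftarrow>[]. \<beta> i)) = 1" by (simp only: list.map sum_list.Nil \<theta>(1) scal_simps(1)[OF s])
  then show ?case by simp
next
  case (Cons i "is")
  let ?m = "\<Prod>i\<leftarrow>is. g i" and ?b = "\<Sum>i\<leftarrow>is. \<beta> i"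
  have "k * (g i * ?m) = s (\<theta> (\<beta> i)) * (g i * (k * ?m))"
    by (simp only: mult.assoc[symmetric] k)
  also have "\<dots> = s (\<theta> (\<beta> i)) * ((g i * s (\<theta> ?b)) * (?m * k))"
    unfolding Cons.IH by (simp only: mult.assoc)
  also have "g i * s (\<theta> ?b) = s (\<theta> ?b) * g i" by (rule scal_simps(7)[OF s, symmetric])
  also have "s (\<theta> (\<beta> i)) * ((s (\<theta> ?b) * g i) * (?m * k)) = s (\<theta> (\<beta> i + ?b)) * (g i * ?m * k)"
    by (simp only: \<theta>(2) scal_simps(4)[OF s] mult.assoc)
  finally show ?case by (simp only: list.map prod_list.Cons sum_list.Cons)
qed

lemma sum_list_group:
  assumes "finite S" "wt ` set L \<subseteq> S"
  shows "(\<Sum>\<kappa>\<in>S. f \<kappa> * (\<Sum>p\<leftarrow>filter (\<lambda>p. wt p = \<kappa>) L. m p)) = (\<Sum>p\<leftarrow>L. f (wt p) * (m p :: 'a::semiring_0))"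
  using assms(2)
proof (induction L)
  case (Cons p L)
  have "(\<Sum>\<kappa>\<in>S. f \<kappa> * (\<Sum>p\<leftarrow>filter (\<lambda>p. wt p = \<kappa>) (p # L). m p))
      = (\<Sum>\<kappa>\<in>S. (if \<kappa> = wt p then f (wt p) * m p else 0) + f \<kappa> * (\<Sum>p\<leftarrow>filter (\<lambda>p. wt p = \<kappa>) L. m p))"
    by (rule sum.cong) (auto simp: distrib_left)
  then show ?case using Cons assms(1) by (simp add: sum.distrib)
qed simp

text \<open>The monomials of weight different from \<open>\<nu>\<close> in an expression of \<open>x\<close> cancel, because the characters by which
  the torus acts on monomials of different weights are independent.\<close>
lemma homogeneous_monomials:
  fixes D :: "('i::finite, 'u::ring_1, 'z) qgroup_scheme" and \<beta> :: "'i \<Rightarrow> 'i wt"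
  assumes qg: "quantum_group D"
    and K: "\<And>h i. Kg D h * g i = scal D (qpow D (pair D (\<beta> i) h)) * (g i * Kg D h)"
    and x: "x \<in> subalg (scal D) (range g)" "x \<in> root_space D \<nu>"
  shows "\<exists>L. x = (\<Sum>p\<leftarrow>L. scal D (fst p) * (\<Prod>i\<leftarrow>snd p. g i)) \<and> (\<forall>p\<in>set L. (\<Sum>i\<leftarrow>snd p. \<beta> i) = \<nu>)"
proof -
  note s = qgroup_algebra[OF qg]
  define m where "m p = scal D (fst p) * (\<Prod>i\<leftarrow>snd p. g i)" for p :: "ff \<times> 'i list"
  define wt where "wt p = (\<Sum>i\<leftarrow>snd p. \<beta> i)" for p :: "ff \<times> 'i list"
  obtain L where L: "x = (\<Sum>p\<leftarrow>L. m p)" using subalg_monomials[OF s x(1)] unfolding m_def by blast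
  have Km: "Kg D h * m p * Kg D (- h) = scal D (qpow D (pair D (wt p) h)) * m p" for h p
  proof -
    have "Kg D h * (\<Prod>i\<leftarrow>snd p. g i) = scal D (qpow D (pair D (wt p) h)) * ((\<Prod>i\<leftarrow>snd p. g i) * Kg D h)"
      unfolding wt_def by (rule commute_monomial[where \<theta> = "\<lambda>\<nu>. qpow D (pair D \<nu> h)" and \<beta> = \<beta>, OF s K])
        (simp_all only: pair_linear qpow_0[OF qg] qpow_add[OF qg])
    then have "Kg D h * m p = scal D (qpow D (pair D (wt p) h)) * (m p * Kg D h)"
      unfolding m_def
      by (simp only: mult.assoc scal_left_commute[OF s, of "Kg D h"]
          scal_left_commute[OF s, of "scal D (fst p)" "qpow D (pair D (wt p) h)"])
    then have "Kg D h * m p * Kg D (- h) = scal D (qpow D (pair D (wt p) h)) * (m p * (Kg D h * Kg D (- h)))"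
      by (simp only: mult.assoc)
    then show ?thesis by (simp add: Kg_add[OF qg] Kg_0[OF qg])
  qed
  define S where "S = insert \<nu> (wt ` set L)"
  \<comment> \<open>\<open>x\<close> is moved to the weight \<open>\<nu>\<close> part, so that the parts \<open>y\<close> of all weights add up to zero.\<close>
  define y where "y \<kappa> = (\<Sum>p\<leftarrow>filter (\<lambda>p. wt p = \<kappa>) L. m p) - (if \<kappa> = \<nu> then x else 0)" for \<kappa>
  have "(\<Sum>\<kappa>\<in>S. scal D (qpow D (pair D \<kappa> h)) * y \<kappa>) = 0" for h
  proof -
    have "(\<Sum>\<kappa>\<in>S. scal D (qpow D (pair D \<kappa> h)) * y \<kappa>)
        = (\<Sum>p\<leftarrow>L. scal D (qpow D (pair D (wt p) h)) * m p)
          - (\<Sum>\<kappa>\<in>S. if \<kappa> = \<nu> then scal D (qpow D (pair D \<nu> h)) * x else 0)"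
      unfolding y_def right_diff_distrib sum_subtractf
      by (rule arg_cong2[where f = "(-)"]; (rule sum_list_group | rule sum.cong)) (auto simp: S_def)
    also have "(\<Sum>p\<leftarrow>L. scal D (qpow D (pair D (wt p) h)) * m p) = Kg D h * x * Kg D (- h)"
      unfolding L by (simp add: Km flip: sum_list_const_mult sum_list_mult_const)
    also have "\<dots> = scal D (qpow D (pair D \<nu> h)) * x" using x(2) by (simp add: root_space_def)
    finally show ?thesis by (simp add: S_def)
  qed
  moreover have "finite S" "\<nu> \<in> S" by (simp_all add: S_def)
  ultimately have "y \<nu> = 0" using weights_independent[OF qg s, of S y \<nu>] by blast
  then have "x = (\<Sum>p\<leftarrow>filter (\<lambda>p. wt p = \<nu>) L. m p)" by (simp add: y_def)
  then show ?thesis unfolding m_def wt_def by (intro exI conjI) auto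
qed

lemma weight_of_word: "(\<Sum>i\<leftarrow>is. (\<lambda>j. c * sroot i j)) j = c * of_nat (count_list is j)"
  by (induction "is") (auto simp: sroot_def algebra_simps)

text \<open>The coordinates of the weight of a monomial count its letters, so a monomial of weight \<open>\<nu>\<close> has no letter
  outside \<open>Y\<close>. The constant \<open>c\<close> is \<open>1\<close> for the \<open>E\<^sub>i\<close> and \<open>-1\<close> for the \<open>F\<^sub>i\<close>.\<close>
lemma homogeneous_in_parabolic:
  fixes D :: "('i::finite, 'u::ring_1, 'z) qgroup_scheme"
  assumes qg: "quantum_group D" and c: "c \<noteq> 0"
    and K: "\<And>h i. Kg D h * g i = scal D (qpow D (c * pair D (sroot i) h)) * (g i * Kg D h)"
    and k: "\<And>i. k * g i = scal D (qpow D (c * form D \<eta> (sroot i))) * (g i * k)"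
    and x: "x \<in> subalg (scal D) (range g)" "x \<in> root_space D \<nu>"
    and Y: "\<And>j. j \<notin> Y \<Longrightarrow> \<nu> j = 0"
  shows "x \<in> subalg (scal D) (g ` Y)" and "\<exists>d. k * x = scal D d * (x * k)"
proof -
  note s = qgroup_algebra[OF qg]
  define \<beta> where "\<beta> i = (\<lambda>j. c * sroot i j)" for i :: 'i
  have K': "Kg D h * g i = scal D (qpow D (pair D (\<beta> i) h)) * (g i * Kg D h)" for h i
    unfolding \<beta>_def pair_scale by (rule K)
  obtain L where L: "x = (\<Sum>p\<leftarrow>L. scal D (fst p) * (\<Prod>i\<leftarrow>snd p. g i))"
    "\<And>p. p \<in> set L \<Longrightarrow> (\<Sum>i\<leftarrow>snd p. \<beta> i) = \<nu>"
    using homogeneous_monomials[OF qg K' x] by blast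
  have Yp: "set (snd p) \<subseteq> Y" if "p \<in> set L" for p
  proof
    fix j assume j: "j \<in> set (snd p)"
    have "\<nu> j = c * of_nat (count_list (snd p) j)"
      using L(2)[OF that] weight_of_word[of c "snd p" j] by (simp add: \<beta>_def)
    moreover have "count_list (snd p) j \<noteq> 0" using j by (simp add: count_list_0_iff)
    ultimately show "j \<in> Y" using Y[of j] c by auto
  qed
  show "x \<in> subalg (scal D) (g ` Y)"
    unfolding L(1)
  proof (intro subalg_add_sum_list subalg.mult subalg.const subalg_prod_list s)
    fix p i assume "p \<in> set L" "i \<in> set (snd p)"
    then have "i \<in> Y" using Yp by blast
    then show "g i \<in> subalg (scal D) (g ` Y)" by (intro subalg.gen imageI)
  qed
  define \<theta> where "\<theta> \<nu> = qpow D (form D \<eta> \<nu>)" for \<nu> :: "'i wt"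
  have "form D \<eta> (\<beta> i) = c * form D \<eta> (sroot i)" for i
    by (simp add: \<beta>_def form_def sum_distrib_left mult.left_commute)
  then have k': "k * g i = scal D (\<theta> (\<beta> i)) * (g i * k)" for i
    unfolding \<theta>_def by (simp only: k)
  have \<theta>: "\<theta> 0 = 1" "\<theta> (x + y) = \<theta> x * \<theta> y" for x y
  proof -
    have "form D \<eta> 0 = 0" by (simp add: form_def)
    then show "\<theta> 0 = 1" by (simp only: \<theta>_def qpow_0[OF qg])
    have "form D \<eta> (x + y) = form D \<eta> x + form D \<eta> y"
      by (simp add: form_def distrib_left sum.distrib)
    then show "\<theta> (x + y) = \<theta> x * \<theta> y" by (simp only: \<theta>_def qpow_add[OF qg])
  qed
  have "k * (scal D (fst p) * (\<Prod>i\<leftarrow>snd p. g i)) = scal D (\<theta> \<nu>) * (scal D (fst p) * (\<Prod>i\<leftarrow>snd p. g i)) * k"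
    if "p \<in> set L" for p
  proof -
    have "k * (\<Prod>i\<leftarrow>snd p. g i) = scal D (\<theta> \<nu>) * ((\<Prod>i\<leftarrow>snd p. g i) * k)"
      using commute_monomial[where \<theta> = \<theta> and \<beta> = \<beta>, OF s k' \<theta>, of "snd p"] L(2)[OF that] by simp
    then show ?thesis
      by (simp only: mult.assoc scal_left_commute[OF s, of k]
          scal_left_commute[OF s, of "scal D (fst p)" "\<theta> \<nu>"])
  qed
  then have "k * x = (\<Sum>p\<leftarrow>L. scal D (\<theta> \<nu>) * (scal D (fst p) * (\<Prod>i\<leftarrow>snd p. g i)) * k)"
    unfolding L(1) sum_list_const_mult[symmetric] by (intro arg_cong[where f = sum_list] map_cong) auto
  also have "\<dots> = scal D (\<theta> \<nu>) * (x * k)"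
    unfolding L(1) by (subst sum_list_mult_const, subst sum_list_const_mult, rule mult.assoc)
  finally show "\<exists>d. k * x = scal D d * (x * k)" by blast
qed

section \<open>Expansion of the transfer map\<close>

text \<open>The element \<open>\<Sum> u \<otimes> A\<close> of the tensor product of an algebra with a matrix algebra, as a matrix with
  entries in the algebra. Keeping the list of summands allows statements about a product or a trace to be
  checked on single pairs \<open>(u, A)\<close>.\<close>
definition tens_mat :: "nat \<Rightarrow> (ff \<Rightarrow> 'u::ring_1) \<Rightarrow> ('u \<times> ff mat) list \<Rightarrow> 'u mat" where
  "tens_mat n s L = mat n n (\<lambda>ij. \<Sum>(u, A)\<leftarrow>L. u * s (A $$ ij))"

definition tens_span :: "nat \<Rightarrow> (ff \<Rightarrow> 'u::ring_1) \<Rightarrow> ('u \<times> ff mat) set \<Rightarrow> 'u mat set" where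
  "tens_span n s T = {tens_mat n s L | L. set L \<subseteq> T}"

lemma tens_mat_entry: "i < n \<Longrightarrow> j < n \<Longrightarrow> tens_mat n s L $$ (i, j) = (\<Sum>(u, A)\<leftarrow>L. u * s (A $$ (i, j)))"
  by (simp add: tens_mat_def)

lemma tens_mat_mult:
  assumes s: "is_algebra s" and L: "snd ` set L \<subseteq> carrier_mat n n" and L': "snd ` set L' \<subseteq> carrier_mat n n"
  shows "tens_mat n s L * tens_mat n s L'
    = tens_mat n s (concat (map (\<lambda>(u, A). map (\<lambda>(v, B). (u * v, A * B)) L') L))"
proof (rule eq_matI)
  let ?L = "concat (map (\<lambda>(u, A). map (\<lambda>(v, B). (u * v, A * B)) L') L)"
  fix i j assume "i < dim_row (tens_mat n s ?L)" "j < dim_col (tens_mat n s ?L)"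
  then have ij: "i < n" "j < n" by (simp_all add: tens_mat_def)
  have c: "tens_mat n s K \<in> carrier_mat n n" for K by (simp add: tens_mat_def)
  have e: "(\<Sum>l<n. (u * s (A $$ (i, l))) * (v * s (B $$ (l, j)))) = (u * v) * s ((A * B) $$ (i, j))"
    if AB: "A \<in> carrier_mat n n" "B \<in> carrier_mat n n" for u A v B
  proof -
    have "(u * s (A $$ (i, l))) * (v * s (B $$ (l, j))) = (u * v) * s (A $$ (i, l) * B $$ (l, j))" for l
    proof -
      have "(u * s (A $$ (i, l))) * (v * s (B $$ (l, j))) = u * (s (A $$ (i, l)) * v) * s (B $$ (l, j))"
        by (simp only: mult.assoc)
      also have "s (A $$ (i, l)) * v = v * s (A $$ (i, l))" by (rule scal_simps(7)[OF s])
      finally show ?thesis by (simp only: scal_simps(4)[OF s] mult.assoc)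
    qed
    then show ?thesis
      by (simp only: mat_mult_entry[OF AB ij] scal_sum[OF s] sum_distrib_left)
  qed
  have sw: "(\<Sum>l<n. \<Sum>x\<leftarrow>xs. f l x) = (\<Sum>x\<leftarrow>xs. \<Sum>l<n. f l x)" for f :: "nat \<Rightarrow> 'x \<Rightarrow> 'a" and xs
    by (induction xs) (simp_all add: sum.distrib)
  have "(tens_mat n s L * tens_mat n s L') $$ (i, j)
      = (\<Sum>l<n. (\<Sum>p\<leftarrow>L. fst p * s (snd p $$ (i, l))) * (\<Sum>p'\<leftarrow>L'. fst p' * s (snd p' $$ (l, j))))"
    unfolding mat_mult_entry[OF c c ij]
    by (rule sum.cong) (use ij in \<open>simp_all add: tens_mat_entry case_prod_unfold\<close>)
  also have "\<dots> = (\<Sum>p\<leftarrow>L. \<Sum>p'\<leftarrow>L'. \<Sum>l<n. (fst p * s (snd p $$ (i, l))) * (fst p' * s (snd p' $$ (l, j))))"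
    unfolding sum_list_product sw ..
  also have "\<dots> = (\<Sum>p\<leftarrow>L. \<Sum>p'\<leftarrow>L'. (fst p * fst p') * s ((snd p * snd p') $$ (i, j)))"
    by (intro arg_cong[where f = sum_list] map_cong[OF refl] e) (use L L' in auto)
  also have "\<dots> = tens_mat n s ?L $$ (i, j)"
    unfolding tens_mat_entry[OF ij] by (simp add: sum_list_concat_map case_prod_unfold o_def)
  finally show "(tens_mat n s L * tens_mat n s L') $$ (i, j) = tens_mat n s ?L $$ (i, j)" .
qed (simp_all add: tens_mat_def)

definition tens_prod :: "('u::ring_1 \<times> ff mat) set \<Rightarrow> ('u \<times> ff mat) set \<Rightarrow> ('u \<times> ff mat) set" where
  "tens_prod T T' = (\<lambda>((u, M), (v, N)). (u * v, M * N)) ` (T \<times> T')"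

lemma tens_prodE:
  assumes "z \<in> tens_prod T T'"
  obtains p p' where "p \<in> T" "p' \<in> T'" "z = (fst p * fst p', snd p * snd p')"
  using assms by (auto simp: tens_prod_def)

lemma tens_prod_carrier:
  assumes "snd ` T \<subseteq> carrier_mat n n" "snd ` T' \<subseteq> carrier_mat n n"
  shows "snd ` tens_prod T T' \<subseteq> carrier_mat n n"
proof
  fix Z assume "Z \<in> snd ` tens_prod T T'"
  then obtain p p' where p: "p \<in> T" "p' \<in> T'" "Z = snd p * snd p'"
    by (auto simp: tens_prod_def)
  then have "snd p \<in> carrier_mat n n" "snd p' \<in> carrier_mat n n" using assms by blast+
  then show "Z \<in> carrier_mat n n" unfolding p(3) by (rule mult_carrier_mat)
qed

lemma tens_span_mult:
  assumes s: "is_algebra s" and "A \<in> tens_span n s T" "B \<in> tens_span n s T'"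
    and "snd ` T \<subseteq> carrier_mat n n" "snd ` T' \<subseteq> carrier_mat n n"
  shows "A * B \<in> tens_span n s (tens_prod T T')"
proof -
  obtain L L' where L: "A = tens_mat n s L" "set L \<subseteq> T" "B = tens_mat n s L'" "set L' \<subseteq> T'"
    using assms(2,3) by (auto simp: tens_span_def)
  let ?C = "concat (map (\<lambda>(u, A). map (\<lambda>(v, B). (u * v, A * B)) L') L)"
  have "A * B = tens_mat n s ?C"
    unfolding L(1,3)
  proof (rule tens_mat_mult[OF s])
    show "snd ` set L \<subseteq> carrier_mat n n" using L(2) assms(4) by blast
    show "snd ` set L' \<subseteq> carrier_mat n n" using L(4) assms(5) by blast
  qed
  moreover have "set ?C \<subseteq> tens_prod (set L) (set L')" by (force simp: tens_prod_def)
  moreover have "tens_prod (set L) (set L') \<subseteq> tens_prod T T'"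
    unfolding tens_prod_def using L(2,4) by (intro image_mono Sigma_mono)
  ultimately show ?thesis unfolding tens_span_def by blast
qed

lemma tens_span_scalar:
  assumes "is_algebra s" "A \<in> carrier_mat n n" shows "map_mat s A \<in> tens_span n s {(1, A)}"
proof -
  have "map_mat s A = tens_mat n s [(1, A)]"
    using assms(2) by (intro eq_matI) (auto simp: tens_mat_def)
  then show ?thesis by (auto simp: tens_span_def)
qed

lemma tens_span_sum:
  assumes "finite S"
  shows "mat n n (\<lambda>ij. \<Sum>x\<in>S. \<Sum>(u, A)\<leftarrow>L x. u * s (A $$ ij)) \<in> tens_span n s (\<Union>x\<in>S. set (L x))"
proof -
  obtain xs where xs: "set xs = S" "distinct xs" using finite_distinct_list[OF assms] by blast
  have "mat n n (\<lambda>ij. \<Sum>x\<in>S. \<Sum>(u, A)\<leftarrow>L x. u * s (A $$ ij)) = tens_mat n s (concat (map L xs))"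
    by (rule eq_matI) (auto simp: tens_mat_def sum_list_concat_map sum_list_distinct_conv_sum_set xs)
  then show ?thesis unfolding tens_span_def using xs by auto
qed

lemma sum_list_zero: "(\<And>x. x \<in> set xs \<Longrightarrow> f x = 0) \<Longrightarrow> (\<Sum>x\<leftarrow>xs. f x) = (0 :: 'a::monoid_add)"
  by (induction xs) auto

lemma tens_span_pos_sum:
  fixes L :: "'i wt \<Rightarrow> ('u::ring_1 \<times> ff mat) list"
  assumes s: "is_algebra s" and fin: "finite F" "F \<subseteq> pos_lattice"
    and z: "\<And>\<nu> u A. \<nu> \<in> pos_lattice \<Longrightarrow> \<nu> \<notin> F \<Longrightarrow> (u, A) \<in> set (L \<nu>) \<Longrightarrow> A = 0\<^sub>m n n"
  shows "pos_sum n (\<lambda>\<nu>. tens_mat n s (L \<nu>)) \<in> tens_span n s (\<Union>\<nu>\<in>F. set (L \<nu>))"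
proof -
  have "pos_sum n (\<lambda>\<nu>. tens_mat n s (L \<nu>)) = mat n n (\<lambda>ij. \<Sum>\<nu>\<in>F. \<Sum>(u, A)\<leftarrow>L \<nu>. u * s (A $$ ij))"
  proof (rule eq_matI)
    fix i j assume "i < dim_row (mat n n (\<lambda>ij. \<Sum>\<nu>\<in>F. \<Sum>(u, A)\<leftarrow>L \<nu>. u * s (A $$ ij)))"
      "j < dim_col (mat n n (\<lambda>ij. \<Sum>\<nu>\<in>F. \<Sum>(u, A)\<leftarrow>L \<nu>. u * s (A $$ ij)))"
    then have ij: "i < n" "j < n" by auto
    have "tens_mat n s (L \<nu>) $$ (i, j) = 0" if "\<nu> \<in> pos_lattice" "\<nu> \<notin> F" for \<nu>
      unfolding tens_mat_entry[OF ij]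
    proof (rule sum_list_zero)
      fix p assume "p \<in> set (L \<nu>)"
      then have "snd p = 0\<^sub>m n n" using z[OF that, of "fst p" "snd p"] by simp
      then show "(case p of (u, A) \<Rightarrow> u * s (A $$ (i, j))) = 0"
        using ij by (simp add: case_prod_unfold scal_simps(2)[OF s])
    qed
    then have "(\<Sum>\<nu> | \<nu> \<in> pos_lattice \<and> tens_mat n s (L \<nu>) $$ (i, j) \<noteq> 0. tens_mat n s (L \<nu>) $$ (i, j))
        = (\<Sum>\<nu>\<in>F. tens_mat n s (L \<nu>) $$ (i, j))"
      by (intro sum.mono_neutral_left) (use fin in auto)
    then show "pos_sum n (\<lambda>\<nu>. tens_mat n s (L \<nu>)) $$ (i, j)
        = mat n n (\<lambda>ij. \<Sum>\<nu>\<in>F. \<Sum>(u, A)\<leftarrow>L \<nu>. u * s (A $$ ij)) $$ (i, j)"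
      using ij by (simp add: pos_sum_def tens_mat_entry)
  qed (simp_all add: pos_sum_def)
  then show ?thesis using tens_span_sum[OF fin(1)] by metis
qed

lemma tens_span_mono: "A \<in> tens_span n s T \<Longrightarrow> T \<subseteq> T' \<Longrightarrow> A \<in> tens_span n s T'"
  unfolding tens_span_def by blast

lemma tens_span_trace:
  assumes s: "is_algebra s" and A: "A \<in> tens_span n s T" and T: "snd ` T \<subseteq> carrier_mat n n"
    and S: "0 \<in> S" "\<And>x y. x \<in> S \<Longrightarrow> y \<in> S \<Longrightarrow> x + y \<in> S"
    and t: "\<And>u M. (u, M) \<in> T \<Longrightarrow> u * s (mat_trace M) \<in> S"
  shows "mat_trace A \<in> S"
proof -
  obtain L where L: "A = tens_mat n s L" "set L \<subseteq> T" using A by (auto simp: tens_span_def)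
  have "mat_trace A = (\<Sum>i<n. \<Sum>p\<leftarrow>L. fst p * s (snd p $$ (i, i)))"
    unfolding L mat_trace_def by (simp add: tens_mat_def case_prod_unfold)
  also have "\<dots> = (\<Sum>p\<leftarrow>L. \<Sum>i<n. fst p * s (snd p $$ (i, i)))"
    by (induction L) (simp_all add: sum.distrib)
  also have "\<dots> = (\<Sum>p\<leftarrow>L. fst p * s (mat_trace (snd p)))"
  proof (intro arg_cong[where f = sum_list] map_cong[OF refl])
    fix p assume "p \<in> set L"
    then have "snd p \<in> carrier_mat n n" using L(2) T by auto
    then show "(\<Sum>i<n. fst p * s (snd p $$ (i, i))) = fst p * s (mat_trace (snd p))"
      by (auto simp: mat_trace_def scal_sum[OF s] sum_distrib_left)
  qed
  also have "\<dots> \<in> S" using L(2) by (induction L) (auto intro!: S t)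
  finally show ?thesis .
qed

lemma span_prod_add:
  assumes "x \<in> span_prod A B" "y \<in> span_prod A B" shows "x + y \<in> span_prod A B"
  using assms(1)
proof (induction x rule: span_prod.induct)
  case (step a b x)
  then show ?case using span_prod.step[of a A b B "x + y"] by (simp add: add.assoc)
qed (simp add: assms(2))

lemma span_prod_uminus:
  assumes "\<And>a. a \<in> A \<Longrightarrow> - a \<in> A" "x \<in> span_prod A B" shows "- x \<in> span_prod A B"
  using assms(2)
proof (induction x rule: span_prod.induct)
  case (step a b x)
  then show ?case using span_prod.step[of "- a" A b B "- x"] assms(1) by simp
qed (simp add: span_prod.zero)

text \<open>Common form of the two R-matrices: for \<open>R\<^bsub>\<bullet>,V\<^esub>\<close> the weights are those of \<open>V\<close> and \<open>c\<close> is the identity, for the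
  flipped \<open>R\<^bsub>V',\<bullet>\<^esub>\<close> they are those of the twist and \<open>c \<nu> = \<phi>(- \<nu>)\<close>.\<close>
lemma (in fd_module) R_expansion:
  fixes c :: "'i wt \<Rightarrow> 'i wt" and L :: "'i wt \<Rightarrow> ('u \<times> ff mat) list"
  assumes W: "finite W" "\<And>\<mu>. Q \<mu> \<in> carrier_mat n n" and c: "inj c"
    and L: "\<And>\<nu> u A. \<nu> \<in> pos_lattice \<Longrightarrow> (u, A) \<in> set (L \<nu>) \<Longrightarrow> supported (\<lambda>\<kappa> \<rho>. \<kappa> = \<rho> + c \<nu>) A"
  shows "mat n n (\<lambda>ij. \<Sum>\<mu>\<in>W. Kw D \<mu> * scal D (Q \<mu> $$ ij)) * pos_sum n (\<lambda>\<nu>. tens_mat n (scal D) (L \<nu>))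
    \<in> tens_span n (scal D)
        {(Kw D \<mu> * u, Q \<mu> * A) | \<mu> \<nu> u A. \<mu> \<in> W \<and> \<nu> \<in> pos_lattice \<and> (u, A) \<in> set (L \<nu>)}"
proof -
  let ?T = "{(u, A). \<exists>\<nu>\<in>pos_lattice. (u, A) \<in> set (L \<nu>)}" and ?K = "(\<lambda>\<mu>. (Kw D \<mu>, Q \<mu>)) ` W"
  have "mat n n (\<lambda>ij. \<Sum>\<mu>\<in>W. \<Sum>(u, A)\<leftarrow>[(Kw D \<mu>, Q \<mu>)]. u * scal D (A $$ ij)) \<in> tens_span n (scal D) ?K"
    by (rule tens_span_mono[OF tens_span_sum[OF W(1)]]) auto
  then have 1: "mat n n (\<lambda>ij. \<Sum>\<mu>\<in>W. Kw D \<mu> * scal D (Q \<mu> $$ ij)) \<in> tens_span n (scal D) ?K" by simp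
  define F where "F = {\<nu> \<in> pos_lattice. \<exists>A\<in>snd ` set (L \<nu>). A \<noteq> 0\<^sub>m n n}"
  have "finite F"
    unfolding F_def by (rule finite_degrees[OF _ c]) (use L in auto)
  then have "pos_sum n (\<lambda>\<nu>. tens_mat n (scal D) (L \<nu>)) \<in> tens_span n (scal D) (\<Union>\<nu>\<in>F. set (L \<nu>))"
    by (rule tens_span_pos_sum[OF alg]) (force simp: F_def)+
  then have 2: "pos_sum n (\<lambda>\<nu>. tens_mat n (scal D) (L \<nu>)) \<in> tens_span n (scal D) ?T"
    by (rule tens_span_mono) (auto simp: F_def)
  have "snd ` ?T \<subseteq> carrier_mat n n" using L supported_carrier by fastforce
  then show ?thesis
    by (intro tens_span_mono[OF tens_span_mult[OF alg 1 2]]) (use W(2) in \<open>auto simp: tens_prod_def\<close>)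
qed

context qsp_module
begin

text \<open>Pairs \<open>(u, A)\<close> such that the transfer map at \<open>V\<close> is a sum of elements \<open>u \<cdot> tr(A)\<close>: one term is chosen in each
  factor \<open>\<kappa>\<close> and \<open>\<Xi>\<close> of the two R-matrices.\<close>
definition transfer_terms :: "('i wt \<Rightarrow> 'u tens) \<Rightarrow> ('i wt \<Rightarrow> 'u) \<Rightarrow> ('u \<times> ff mat) set" where
  "transfer_terms \<Xi> \<Upsilon> = {(Kw D \<mu>' * b' * (Kw D \<mu> * a),
      D_op D V * mat_inv (quasi_K_op \<Upsilon> V) *
        (wt_proj D V' \<mu>' * act V' a' * quasi_K_op \<Upsilon> V * (P \<mu> * act V b))) | \<mu> \<mu>' \<nu> \<nu>' a b a' b'.
      \<mu> \<in> Wt \<and> \<mu>' \<in> weights D V' \<and> \<nu> \<in> pos_lattice \<and> \<nu>' \<in> pos_lattice \<and>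
      (a, b) \<in> set (\<Xi> \<nu>) \<and> (a', b') \<in> set (\<Xi> \<nu>')}"

lemma tensor_K_expansion:
  assumes \<Xi>: "is_quasi_R D \<Xi>" and K: "is_quasi_K D \<phi> \<Upsilon>"
  shows "map_mat (scal D) (D_op D V * mat_inv (quasi_K_op \<Upsilon> V)) * tensor_K D \<phi> \<Xi> \<Upsilon> V
      \<in> tens_span n (scal D) (transfer_terms \<Xi> \<Upsilon>)"
    and "snd ` transfer_terms \<Xi> \<Upsilon> \<subseteq> carrier_mat n n"
proof -
  let ?Y = "quasi_K_op \<Upsilon> V" and ?DM = "D_op D V * mat_inv (quasi_K_op \<Upsilon> V)"
  have \<Xi>ab: "a \<in> root_space D (- \<nu>)" "b \<in> root_space D \<nu>"
    if "\<nu> \<in> pos_lattice" "(a, b) \<in> set (\<Xi> \<nu>)" for \<nu> a b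
    using \<Xi> that unfolding is_quasi_R_def by blast+
  have Yc: "?Y \<in> carrier_mat n n" using supported_carrier[OF quasi_K_triangular(1)[OF K]] .
  have "mat_inv ?Y \<in> carrier_mat n n"
    using supported_carrier[OF unitriangular_inverse[OF quasi_K_triangular[OF K]]] .
  moreover have "D_op D V \<in> carrier_mat n n" by (simp add: D_op_def)
  ultimately have DM: "?DM \<in> carrier_mat n n" by (simp add: square_mult)
  let ?L = "\<lambda>\<nu>. map (\<lambda>(a, b). (a, act V b)) (\<Xi> \<nu>)"
  let ?L' = "\<lambda>\<nu>. map (\<lambda>(a, b). (b, act V' a)) (\<Xi> \<nu>)"
  let ?T1 = "{(Kw D \<mu> * u, P \<mu> * A) | \<mu> \<nu> u A. \<mu> \<in> Wt \<and> \<nu> \<in> pos_lattice \<and> (u, A) \<in> set (?L \<nu>)}"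
  let ?T2 = "{(Kw D \<mu> * u, wt_proj D V' \<mu> * A) | \<mu> \<nu> u A.
    \<mu> \<in> weights D V' \<and> \<nu> \<in> pos_lattice \<and> (u, A) \<in> set (?L' \<nu>)}"
  have L: "tens_mat n (scal D) (?L \<nu>) = mat n n (\<lambda>ij. \<Sum>(a, b)\<leftarrow>\<Xi> \<nu>. a * scal D (act V b $$ ij))"
    "tens_mat n (scal D) (?L' \<nu>) = mat n n (\<lambda>ij. \<Sum>(a, b)\<leftarrow>\<Xi> \<nu>. b * scal D (act V' a $$ ij))" for \<nu>
    by (simp_all add: tens_mat_def o_def case_prod_unfold)
  have Lc: "supported (\<lambda>\<kappa> \<rho>. \<kappa> = \<rho> + \<nu>) A" if "\<nu> \<in> pos_lattice" "(u, A) \<in> set (?L \<nu>)" for \<nu> u A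
    using that homogeneous_supported(1)[OF \<Xi>ab(2)] by auto
  have L'c: "supported (\<lambda>\<kappa> \<rho>. \<kappa> = \<rho> + phi_wt D (- \<nu>)) A" if "\<nu> \<in> pos_lattice" "(u, A) \<in> set (?L' \<nu>)" for \<nu> u A
    using that homogeneous_supported(2)[OF \<Xi>ab(1)] by auto
  have inj: "inj (\<lambda>\<nu>. phi_wt D (- \<nu>))" by (rule injI) (simp add: phi_wt_inject)
  have R: "R_free_mod D \<Xi> V \<in> tens_span n (scal D) ?T1"
    unfolding R_free_mod_def kappa_free_def L[symmetric]
    by (rule R_expansion[OF finite_weights P_carrier _ Lc]) (simp_all add: inj_on_def)
  have R': "R_mod_free21 D \<Xi> V' \<in> tens_span n (scal D) ?T2"
    unfolding R_mod_free21_def kappa_free_def vdim_twist L[symmetric]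
    by (rule R_expansion[OF twisted.finite_weights _ inj L'c]) (use twisted.P_carrier in simp_all)
  have c1: "snd ` ?T1 \<subseteq> carrier_mat n n"
  proof
    fix M assume "M \<in> snd ` ?T1"
    then obtain z where z: "z \<in> ?T1" "M = snd z" by blast
    then obtain \<mu> \<nu> u A where "z = (Kw D \<mu> * u, P \<mu> * A)" "\<nu> \<in> pos_lattice" "(u, A) \<in> set (?L \<nu>)"
      by blast
    with z(2) show "M \<in> carrier_mat n n" using supported_carrier[OF Lc] by (simp add: square_mult)
  qed
  have P'c: "wt_proj D V' \<mu> \<in> carrier_mat n n" for \<mu> using twisted.P_carrier[of \<mu>] by simp
  have c2: "snd ` ?T2 \<subseteq> carrier_mat n n"
  proof
    fix M assume "M \<in> snd ` ?T2"
    then obtain z where z: "z \<in> ?T2" "M = snd z" by blast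
    then obtain \<mu> \<nu> u A where "z = (Kw D \<mu> * u, wt_proj D V' \<mu> * A)" "\<nu> \<in> pos_lattice" "(u, A) \<in> set (?L' \<nu>)"
      by blast
    with z(2) show "M \<in> carrier_mat n n" using supported_carrier[OF L'c] P'c[of \<mu>] by (simp add: square_mult)
  qed
  have c3: "snd ` {(1, ?Y)} \<subseteq> carrier_mat n n" "snd ` {(1, ?DM)} \<subseteq> carrier_mat n n"
    using Yc DM by auto
  let ?T3 = "tens_prod ?T2 {(1, ?Y)}"
  have s1: "R_mod_free21 D \<Xi> V' * map_mat (scal D) ?Y \<in> tens_span n (scal D) ?T3"
    by (rule tens_span_mult[OF alg R' tens_span_scalar[OF alg Yc] c2 c3(1)])
  note c4 = tens_prod_carrier[OF c2 c3(1)]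
  have s2: "tensor_K D \<phi> \<Xi> \<Upsilon> V \<in> tens_span n (scal D) (tens_prod ?T3 ?T1)"
    unfolding tensor_K_def by (rule tens_span_mult[OF alg s1 R c4 c1])
  note c5 = tens_prod_carrier[OF c4 c1]
  show "map_mat (scal D) ?DM * tensor_K D \<phi> \<Xi> \<Upsilon> V \<in> tens_span n (scal D) (transfer_terms \<Xi> \<Upsilon>)"
  proof (rule tens_span_mono[OF tens_span_mult[OF alg tens_span_scalar[OF alg DM] s2 c3(2) c5]], rule subsetI)
    fix z assume "z \<in> tens_prod {(1, ?DM)} (tens_prod ?T3 ?T1)"
    then obtain m r where r: "m \<in> {(1, ?DM)}" "r \<in> tens_prod ?T3 ?T1" "z = (fst m * fst r, snd m * snd r)"
      by (rule tens_prodE)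
    obtain t p' where t: "t \<in> ?T3" "p' \<in> ?T1" "r = (fst t * fst p', snd t * snd p')"
      using r(2) by (rule tens_prodE)
    obtain p y where p: "p \<in> ?T2" "y \<in> {(1, ?Y)}" "t = (fst p * fst y, snd p * snd y)"
      using t(1) by (rule tens_prodE)
    have m: "m = (1, ?DM)" "y = (1, ?Y)" using r(1) p(2) by simp_all
    have z: "p \<in> ?T2" "p' \<in> ?T1" "z = (1 * (fst p * 1 * fst p'), ?DM * (snd p * ?Y * snd p'))"
      using p(1) t(2) by (simp_all only: r(3) t(3) p(3) m fst_conv snd_conv)
    obtain \<mu>' \<nu>' u' A' where p: "p = (Kw D \<mu>' * u', wt_proj D V' \<mu>' * A')"
      "\<mu>' \<in> weights D V'" "\<nu>' \<in> pos_lattice" "(u', A') \<in> set (?L' \<nu>')" using z(1) by blast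
    obtain \<mu> \<nu> u A where p': "p' = (Kw D \<mu> * u, P \<mu> * A)"
      "\<mu> \<in> Wt" "\<nu> \<in> pos_lattice" "(u, A) \<in> set (?L \<nu>)" using z(2) by blast
    obtain a b where ab: "(a, b) \<in> set (\<Xi> \<nu>)" "u = a" "A = act V b" using p'(4) by auto
    obtain a' b' where ab': "(a', b') \<in> set (\<Xi> \<nu>')" "u' = b'" "A' = act V' a'" using p(4) by auto
    have "z = (Kw D \<mu>' * b' * (Kw D \<mu> * a),
        ?DM * (wt_proj D V' \<mu>' * act V' a' * ?Y * (P \<mu> * act V b)))"
      unfolding z(3) p(1) p'(1) ab(2,3) ab'(2,3) by (simp only: mult_1_left mult_1_right fst_conv snd_conv)
    then show "z \<in> transfer_terms \<Xi> \<Upsilon>"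
      unfolding transfer_terms_def using p(2,3) p'(2,3) ab(1) ab'(1) by blast
  qed
  show "snd ` transfer_terms \<Xi> \<Upsilon> \<subseteq> carrier_mat n n"
  proof
    fix M assume "M \<in> snd ` transfer_terms \<Xi> \<Upsilon>"
    then obtain z where z: "z \<in> transfer_terms \<Xi> \<Upsilon>" "M = snd z" by blast
    then obtain \<mu> \<mu>' \<nu> \<nu>' a b a' b' where
      e: "z = (Kw D \<mu>' * b' * (Kw D \<mu> * a), ?DM * (wt_proj D V' \<mu>' * act V' a' * ?Y * (P \<mu> * act V b)))"
      and m: "\<nu> \<in> pos_lattice" "\<nu>' \<in> pos_lattice" "(a, b) \<in> set (\<Xi> \<nu>)" "(a', b') \<in> set (\<Xi> \<nu>')"
      unfolding transfer_terms_def by blast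
    have "act V b \<in> carrier_mat n n" "act V' a' \<in> carrier_mat n n"
      using supported_carrier[OF homogeneous_supported(1)[OF \<Xi>ab(2)[OF m(1,3)]]]
        supported_carrier[OF homogeneous_supported(2)[OF \<Xi>ab(1)[OF m(2,4)]]] .
    then have "?DM * (wt_proj D V' \<mu>' * act V' a' * ?Y * (P \<mu> * act V b)) \<in> carrier_mat n n"
      by (intro mult_carrier_mat[of _ n n _ n] DM P'c Yc P_carrier)
    then show "M \<in> carrier_mat n n" unfolding z(2) e snd_conv .
  qed
qed

text \<open>In a term with non-zero trace, \<open>k\<^bsub>\<mu>'\<^esub>\<close> is moved past \<open>b'\<close>, and then \<open>k\<^bsub>\<mu>'+\<mu>\<^esub>\<close> past \<open>a\<close>.\<close>
lemma transfer_mod_in_span: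
  assumes \<Xi>: "is_quasi_R D \<Xi>" and K: "is_quasi_K D \<phi> \<Upsilon>"
  shows "transfer_mod D \<phi> \<Xi> \<Upsilon> V \<in> span_prod (UgX D) (UhphiP D)"
proof -
  let ?S = "span_prod (UgX D) (UhphiP D)"
  have key: "Kw D \<mu>' * b' * (Kw D \<mu> * a) * scal D t \<in> ?S"
    if mem: "\<mu> \<in> Wt" "\<mu>' \<in> weights D V'" "\<nu> \<in> pos_lattice" "\<nu>' \<in> pos_lattice"
      "(a, b) \<in> set (\<Xi> \<nu>)" "(a', b') \<in> set (\<Xi> \<nu>')"
      and t: "t = mat_trace (D_op D V * mat_inv (quasi_K_op \<Upsilon> V) *
        (wt_proj D V' \<mu>' * act V' a' * quasi_K_op \<Upsilon> V * (P \<mu> * act V b)))"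
    for \<mu> \<mu>' \<nu> \<nu>' a b a' b' t
  proof (cases "t = 0")
    case True
    then show ?thesis by (simp add: scal_simps(2)[OF alg] span_prod.zero)
  next
    case False
    have ab: "a \<in> Uminus D \<inter> root_space D (- \<nu>)" "b \<in> root_space D \<nu>"
      "a' \<in> root_space D (- \<nu>')" "b' \<in> Uplus D \<inter> root_space D \<nu>'"
      using \<Xi> mem(3-6) unfolding is_quasi_R_def by blast+
    note nz = trace_nonzero[OF K mem(3) ab(2) mem(4) ab(3) False[unfolded t]]
    have wl: "\<mu> \<in> wt_lattice D" "\<mu>' \<in> wt_lattice D" using mem(1,2) by (auto simp: weights_def)
    have gX: "Eg D i \<in> UgX D" "Fg D i \<in> UgX D" if "i \<in> Xset D" for i
      using that unfolding UgX_def by (auto intro!: subalg.gen)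
    have E: "Kg D h * Eg D i = scal D (qpow D (1 * pair D (sroot i) h)) * (Eg D i * Kg D h)"
      "Kw D \<mu>' * Eg D i = scal D (qpow D (1 * form D \<mu>' (sroot i))) * (Eg D i * Kw D \<mu>')" for h i
      using Kg_Eg[OF qg] Kw_Eg[OF qg wl(2)] by simp_all
    have sum: "\<mu>' + \<mu> \<in> wt_lattice D" using wl by (simp add: wt_lattice_def pair_linear)
    have F: "Kg D h * Fg D i = scal D (qpow D (- 1 * pair D (sroot i) h)) * (Fg D i * Kg D h)"
      "Kw D (\<mu>' + \<mu>) * Fg D i
        = scal D (qpow D (- 1 * form D (\<mu>' + \<mu>) (sroot i))) * (Fg D i * Kw D (\<mu>' + \<mu>))" for h i
      using Kg_Fg[OF qg] Kw_Fg[OF qg sum] by simp_all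
    have b': "b' \<in> subalg (scal D) (range (Eg D))" "b' \<in> root_space D \<nu>'" using ab(4) by (auto simp: Uplus_def)
    have a: "a \<in> subalg (scal D) (range (Fg D))" "a \<in> root_space D (- \<nu>)" using ab(1) by (auto simp: Uminus_def)
    have "b' \<in> subalg (scal D) (Eg D ` Xset D)"
      by (rule homogeneous_in_parabolic(1)[OF qg _ E b']) (use nz(1) in auto)
    then have b'X: "b' \<in> UgX D" using subalg_mono_gen gX(1) unfolding UgX_def by (metis (no_types, lifting) image_subsetI)
    have "a \<in> subalg (scal D) (Fg D ` Xset D)"
      by (rule homogeneous_in_parabolic(1)[OF qg _ F a]) (use nz(1) in auto)
    then have aX: "a \<in> UgX D" using subalg_mono_gen gX(2) unfolding UgX_def by (metis (no_types, lifting) image_subsetI)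
    obtain d where d: "Kw D \<mu>' * b' = scal D d * (b' * Kw D \<mu>')"
      using homogeneous_in_parabolic(2)[OF qg _ E b', of "Xset D"] nz(1) by auto
    obtain e where e: "Kw D (\<mu>' + \<mu>) * a = scal D e * (a * Kw D (\<mu>' + \<mu>))"
      using homogeneous_in_parabolic(2)[OF qg _ F a, of "Xset D"] nz(1) by auto
    have "Kw D \<mu>' * b' * (Kw D \<mu> * a) * scal D t = scal D d * (b' * (Kw D \<mu>' * Kw D \<mu> * a)) * scal D t"
      unfolding d by (simp only: mult.assoc)
    also have "\<dots> = scal D t * (scal D d * (b' * (scal D e * (a * Kw D (\<mu>' + \<mu>)))))"
      unfolding Kw_add[OF qg wl(2,1)] e by (rule scal_simps(7)[OF alg, symmetric])
    also have "\<dots> = scal D t * (scal D d * (b' * (scal D e * a))) * Kw D (\<mu>' + \<mu>) + 0"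
      by (simp only: mult.assoc add_0_right)
    also have "\<dots> \<in> ?S"
    proof (rule span_prod.step[OF _ _ span_prod.zero])
      show "scal D t * (scal D d * (b' * (scal D e * a))) \<in> UgX D"
        using b'X aX unfolding UgX_def by (intro subalg.mult subalg.const)
      show "Kw D (\<mu>' + \<mu>) \<in> UhphiP D"
        unfolding UhphiP_def by (rule subalg.gen) (use sum nz(2) in blast)
    qed
    finally show ?thesis .
  qed
  show ?thesis
    unfolding transfer_mod_def
  proof (rule tens_span_trace[OF alg tensor_K_expansion[OF \<Xi> K] span_prod.zero span_prod_add])
    fix u M assume "(u, M) \<in> transfer_terms \<Xi> \<Upsilon>"
    then obtain \<mu> \<mu>' \<nu> \<nu>' a b a' b' where "u = Kw D \<mu>' * b' * (Kw D \<mu> * a)"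
      "M = D_op D V * mat_inv (quasi_K_op \<Upsilon> V) *
        (wt_proj D V' \<mu>' * act V' a' * quasi_K_op \<Upsilon> V * (P \<mu> * act V b))"
      "\<mu> \<in> Wt" "\<mu>' \<in> weights D V'" "\<nu> \<in> pos_lattice" "\<nu>' \<in> pos_lattice"
      "(a, b) \<in> set (\<Xi> \<nu>)" "(a', b') \<in> set (\<Xi> \<nu>')"
      unfolding transfer_terms_def by blast
    then show "u * scal D (mat_trace M) \<in> ?S" using key by simp
  qed
qed

end

section \<open>The image of the transfer map\<close>

theorem lemma5p8p2:
  fixes D :: "('i::finite, 'u::ring_1) qsp"
    and \<phi> :: "'u \<Rightarrow> 'u"
    and \<Xi> :: "'i wt \<Rightarrow> 'u tens"
    and \<Upsilon> :: "'i wt \<Rightarrow> 'u"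
  assumes "quantum_symmetric_datum D"
    and "is_phi_q D \<phi>"
    and "is_quasi_R D \<Xi>"
    and "is_quasi_K D \<phi> \<Upsilon>"
  shows "transfer_hom D \<phi> \<Xi> \<Upsilon> ` carrier (groth_ring D) \<subseteq> span_prod (UgX D) (UhphiP D)"
proof (rule image_subsetI)
  let ?S = "span_prod (UgX D) (UhphiP D)"
  have qg: "quantum_group D" and sat: "generalized_satake D"
    using assms(1) by (auto simp: quantum_symmetric_datum_def)
  note alg = qgroup_algebra[OF qg]
  fix c assume "c \<in> carrier (groth_ring D)"
  then obtain x where x: "x \<in> carrier (groth_free D)" "c = groth_rels D #>\<^bsub>groth_free D\<^esub> x"
    by (auto simp: groth_ring_def RCOSETS_def)
  have "groth_rels D \<subseteq> carrier (groth_free D)"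
    unfolding groth_rels_def
  proof (rule group.generate_incl[OF group_free_Abelian_group], rule subsetI)
    fix y assume "y \<in> {frag_of V - frag_of V' - frag_of V'' | V' V V''.
        V' \<in> fdmod D \<and> V \<in> fdmod D \<and> V'' \<in> fdmod D \<and> short_exact D V' V V''}"
    then obtain V' V V'' where y: "y = frag_of V - frag_of V' - frag_of V''"
      "V \<in> fdmod D" "V' \<in> fdmod D" "V'' \<in> fdmod D" by blast
    have "Poly_Mapping.keys y \<subseteq> Poly_Mapping.keys (frag_of V) \<union> Poly_Mapping.keys (frag_of V') \<union> Poly_Mapping.keys (frag_of V'')"
      unfolding y using keys_diff[of "frag_of V - frag_of V'" "frag_of V''"] keys_diff[of "frag_of V" "frag_of V'"] by blast
    then show "y \<in> carrier (groth_free D)" using y by auto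
  qed
  then have "c \<subseteq> carrier (groth_free D)"
    unfolding x(2) using monoid.r_coset_subset_G[OF group.is_monoid[OF group_free_Abelian_group] _ x(1)] by blast
  moreover have "c \<noteq> {}"
    unfolding x(2) groth_rels_def r_coset_def using generate.one by fast
  ultimately have "(SOME x. x \<in> c) \<in> carrier (groth_free D)" using some_in_eq[of c] by blast
  then have keys: "Poly_Mapping.keys (SOME x. x \<in> c) \<subseteq> fdmod D" by simp
  \<comment> \<open>Classes have integer coefficients, so the target must be closed under integer multiples.\<close>
  have neg: "- y \<in> ?S" if "y \<in> ?S" for y
  proof (rule span_prod_uminus[OF _ that])
    fix a assume "a \<in> UgX D"
    then have "scal D (- 1) * a \<in> UgX D" unfolding UgX_def by (intro subalg.mult subalg.const)
    then show "- a \<in> UgX D" by (simp add: scal_simps(1,5)[OF alg])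
  qed
  have nat: "of_nat m * y \<in> ?S" if "y \<in> ?S" for m :: nat and y
    by (induction m) (simp_all add: span_prod.zero distrib_right span_prod_add that)
  have int: "of_int m * y \<in> ?S" if "y \<in> ?S" for m :: int and y
    using nat[OF that, of "nat m"] neg[OF nat[OF that, of "nat (- m)"]] by (cases "m \<ge> 0") simp_all
  have "transfer_mod D \<phi> \<Xi> \<Upsilon> V \<in> ?S" if "V \<in> fdmod D" for V
  proof -
    interpret qsp_module D V \<phi> by unfold_locales (use qg that sat assms(2) in auto)
    show ?thesis by (rule transfer_mod_in_span[OF assms(3,4)])
  qed
  then have terms: "of_int (Poly_Mapping.lookup x V) * transfer_mod D \<phi> \<Xi> \<Upsilon> V \<in> ?S" if "V \<in> fdmod D" for x V
    using int that by blast
  have "(\<Sum>V\<in>A. of_int (Poly_Mapping.lookup x V) * transfer_mod D \<phi> \<Xi> \<Upsilon> V) \<in> ?S"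
    if "finite A" "A \<subseteq> fdmod D" for A x
    using that by (induction A rule: finite_induct) (auto intro: span_prod.zero span_prod_add terms)
  then show "transfer_hom D \<phi> \<Xi> \<Upsilon> c \<in> ?S" unfolding transfer_hom_def Let_def using keys by simp
qed

end
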